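(* Let $p\in(0,1]$ and let $\tau^*_{p,n}$ be the time at which the vertex $1$ is frozen in the $p$-frozen model $(F_{p,n}(m))_{m\in\mathbb Z_+}$, that is, the first $m$ such that vertex $1$ is frozen in $F_{p,n}(m)$. Then, as $n\to\infty$, $$\frac{\tau^*_{p,n}}{n}\ \longrightarrow\ X_p\quad\text{in distribution},$$ where $X_p$ is a random variable with cumulative distribution function $g_p$.
   Context: Discrete $p$-frozen model. Fix $p\in(0,1]$. For an integer $n\ge 2$ the random (multi)graph process $(F_{p,n}(m))_{m\in\mathbb Z_+}$ on vertex set $\{1,\dots,n\}$ is defined recursively. All its connected components are either trees (number of edges = number of vertices minus one) or unicycles (number of edges = number of vertices); vertices of unicycles are called frozen. $F_{p,n}(0)$ has $n$ isolated non-frozen vertices. At step $m\ge 1$, given $F_{p,n}(m-1)$, one of the $n(n-1)/2$ possible edges is selected uniformly at random, independently of the past (the same edge may be selected several times), and: (i) if it connects two vertices of trees of $F_{p,n}(m-1)$ (possibly the same tree), it is added; if two different trees are involved this produces a new tree (non-frozen), otherwise it produces a unicycle whose vertices become frozen (if the selected edge is already present in the tree, it is added as a parallel edge, creating a cycle of length two); (ii) if it connects two vertices of unicycles (possibly the same), it is discarded; (iii) if it connects a tree and a unicycle, it is added with probability $p$ (the tree is glued to the unicycle and all its vertices become frozen) and discarded with probability $1-p$. Limit function: let $f_p:[0,1)\to[1/2,\infty)$, $f_p(s)=\frac12\sum_{j=0}^\infty \frac{s^j}{1+pj}$, an increasing bijection. The function $g_p:[0,\infty)\to[0,1)$ is $0$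 on $[0,1/2]$ and is the inverse of $f_p$ on $[1/2,\infty)$ (it is extended by $0$ on $(-\infty,0)$ as a cumulative distribution function). *)

theory Defs
  imports "HOL-Probability.Probability" "HOL-Library.Multiset"
begin

text \<open>A multigraph on \<open>{1..n}\<close> without loops is the multiset of its edges; the edge joining
  \<open>i < j\<close> is the pair \<open>(i, j)\<close>, and multiplicities count parallel edges.\<close>

type_synonym multigraph = "(nat \<times> nat) multiset"

definition possible_edges :: "nat \<Rightarrow> (nat \<times> nat) set" where
  "possible_edges n = {(i, j). 1 \<le> i \<and> i < j \<and> j \<le> n}"

definition component :: "multigraph \<Rightarrow> nat \<Rightarrow> nat set" where
  "component G v = {w. (v, w) \<in> (set_mset G \<union> (set_mset G)\<inverse>)\<^sup>*}"

definition component_edges :: "multigraph \<Rightarrow> nat \<Rightarrow> multigraph" where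
  "component_edges G v = filter_mset (\<lambda>(i, j). i \<in> component G v \<and> j \<in> component G v) G"

definition in_tree :: "multigraph \<Rightarrow> nat \<Rightarrow> bool" where
  "in_tree G v \<longleftrightarrow> size (component_edges G v) + 1 = card (component G v)"

text \<open>A vertex is frozen iff its component is a unicycle.\<close>

definition frozen :: "multigraph \<Rightarrow> nat \<Rightarrow> bool" where
  "frozen G v \<longleftrightarrow> size (component_edges G v) = card (component G v)"

text \<open>The law of the next graph given the current one. The last branch is the tree-unicycle case
  as long as every component is a tree or a unicycle, a property preserved by the dynamics.\<close>

definition frozen_step :: "real \<Rightarrow> nat \<Rightarrow> multigraph \<Rightarrow> multigraph pmf" where
  "frozen_step p n G =
     bind_pmf (pmf_of_set (possible_edges n)) (\<lambda>(i, j).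
       if in_tree G i \<and> in_tree G j then return_pmf (add_mset (i, j) G)
       else if frozen G i \<and> frozen G j then return_pmf G
       else map_pmf (\<lambda>b. if b then add_mset (i, j) G else G) (bernoulli_pmf p))"

text \<open>\<open>F\<close>, defined on the probability space \<open>M\<close>, is a version of the discrete \<open>p\<close>-frozen process:
  given the whole past up to time \<open>m\<close>, the next graph has law \<open>frozen_step\<close>.\<close>

definition frozen_process :: "real \<Rightarrow> nat \<Rightarrow> 'a measure \<Rightarrow> (nat \<Rightarrow> 'a \<Rightarrow> multigraph) \<Rightarrow> bool" where
  "frozen_process p n M F \<longleftrightarrow>
     prob_space M \<and>
     (\<forall>m. F m \<in> measurable M (count_space UNIV)) \<and>
     (AE \<omega> in M. F 0 \<omega> = {#}) \<and>
     (\<forall>m h G. \<P>(\<omega> in M. \<forall>i\<le>m. F i \<omega> = h i) > 0 \<longrightarrow>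
        \<P>(\<omega> in M. F (Suc m) \<omega> = G \<bar> \<forall>i\<le>m. F i \<omega> = h i) = pmf (frozen_step p n (h m)) G)"

text \<open>For \<open>n \<ge> 2\<close> vertex 1 is almost surely frozen eventually, so the unspecified value of
  \<open>LEAST\<close> when no such time exists only concerns a null event.\<close>

definition freezing_time :: "(nat \<Rightarrow> 'a \<Rightarrow> multigraph) \<Rightarrow> 'a \<Rightarrow> nat" where
  "freezing_time F \<omega> = (LEAST m. frozen (F m \<omega>) 1)"

definition f_fun :: "real \<Rightarrow> real \<Rightarrow> real" where
  "f_fun p s = 1 / 2 * (\<Sum>j. s ^ j / (1 + p * real j))"

definition g_fun :: "real \<Rightarrow> real \<Rightarrow> real" where
  "g_fun p t = (if t \<le> 1 / 2 then 0 else the_inv_into {0..<1} (f_fun p) t)"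

end

theory Submission imports Defs "HOL-Combinatorics.Transposition" begin

text \<open>Let \<open>\<nu>\<^sub>k\<close> be the proportion of vertices in trees with \<open>k\<close> vertices and \<open>\<gamma>\<close> the
  proportion of frozen ones. In the limit, \<open>\<nu>\<^sub>k' = k \<Sum>\<^sub>i \<nu>\<^sub>i \<nu>\<^sub>k\<^sub>-\<^sub>i - 2 k \<nu>\<^sub>k (1 - (1 - p) \<gamma>)\<close>, so that
  \<open>\<nu>\<^sub>k = \<tau>\<^sub>k (2 t)\<^sup>k\<^sup>-\<^sup>1 exp (- k (2 t - 2 (1 - p) A))\<close> with \<open>A t = \<integral>\<^sub>0\<^sup>t \<gamma>\<close>; an integrating factor and a
  second moment recursion make this rigorous. Trees with at least \<open>K\<close> vertices are negligible in time
  average: mergers of two of them consume a potential that starts at \<open>n / K\<close>, and in-tree edges are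
  controlled by the number of vertices they freeze. Hence \<open>\<gamma> = 1 - \<Sum>\<^sub>k \<nu>\<^sub>k\<close> is a decreasing function of
  \<open>A = \<integral> \<gamma>\<close>, and this equation is stable under perturbations, without any Lipschitz bound at the
  critical time \<open>1/2\<close>. The inverse of \<open>f\<close> solves it by the functional equation of the tree function.
  Finally \<open>\<gamma>\<close> is monotone in time, and by exchangeability its mean is the probability that vertex 1
  is frozen.\<close>

section \<open>Components after adding an edge\<close>

text \<open>The system for the densities is infinite and coupled to the still unknown \<gamma>, and
  the mean size of the tree of a vertex diverges at time 1/2. The coupling is harmless because the
  gain of size k involves only smaller sizes, and \<gamma> acts on size k only through a loss rate
  proportional to k. Hence the integrating factor can be formed with the actual, random past of the
  process: after it, the sizes below K form a closed finite system whose limit \<open>smol\<close>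
  is deterministic, although nothing is known yet about \<gamma>. The convergence of \<gamma> is
  then a separate, one-dimensional question about its time integral; since only that integral has to
  be controlled, a bound on large trees in time average is enough. The estimates are made under an
  explicit law of histories with finite support, where every expectation is a finite sum; an
  arbitrary version of the process enters only at the end, through the law of its history. Factors 2
  in the rates come from the two orderings of an edge.\<close>

lemma component_refl [simp]: "v \<in> component G v"
  by (simp add: component_def)

lemma component_eq:
  assumes "w \<in> component G v" shows "component G w = component G v"
proof -
  let ?R = "set_mset G \<union> (set_mset G)\<inverse>"
  have s: "sym (?R\<^sup>*)" by (simp add: sym_rtrancl sym_Un_converse)
  have vw: "(v, w) \<in> ?R\<^sup>*" using assms by (simp add: component_def)
  then have "(w, v) \<in> ?R\<^sup>*" using s by (meson symD)
  with vw show ?thesis unfolding component_def by (auto intro: rtrancl_trans)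
qed

lemma component_sym: "w \<in> component G v \<longleftrightarrow> v \<in> component G w"
  using component_eq component_refl by metis

lemma component_disjoint:
  "w \<notin> component G v \<Longrightarrow> component G w \<inter> component G v = {}"
  using component_eq by (metis component_refl disjoint_iff)

lemma component_edge: "(i, j) \<in># G \<Longrightarrow> component G i = component G j"
  by (rule component_eq) (auto simp: component_def)

lemma component_closed: "(i, j) \<in># G \<Longrightarrow> i \<in> component G v \<longleftrightarrow> j \<in> component G v"
  by (metis component_edge component_sym)

text \<open>Replaces path inductions: an upper bound on a component only needs a candidate set that
  no edge enters or leaves. With the preimage of a component as candidate it also gives the lower
  bound in \<open>component_relabel\<close>.\<close>

lemma component_least:
  assumes "v \<in> C" "\<And>i j. (i, j) \<in># G \<Longrightarrow> i \<in> C \<longleftrightarrow> j \<in> C"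
  shows "component G v \<subseteq> C"
proof
  fix w assume "w \<in> component G v"
  then have "(v, w) \<in> (set_mset G \<union> (set_mset G)\<inverse>)\<^sup>*" by (simp add: component_def)
  then show "w \<in> C" by (induction rule: rtrancl_induct) (use assms in auto)
qed

lemma component_mono: "G \<subseteq># H \<Longrightarrow> component G v \<subseteq> component H v"
  unfolding component_def
  using rtrancl_mono[of "set_mset G \<union> (set_mset G)\<inverse>" "set_mset H \<union> (set_mset H)\<inverse>"] set_mset_mono[of G H]
  by blast

lemma component_add:
  "component (add_mset (i, j) G) v =
    (if v \<in> component G i \<union> component G j then component G i \<union> component G j else component G v)"
    (is "?L v = ?R v")
proof -
  have sub: "component G x \<subseteq> ?L x" for x by (rule component_mono) simp
  have ij: "?L i = ?L j" by (rule component_edge) simp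
  have "?L v \<subseteq> ?R v"
  proof (rule component_least)
    fix x y assume "(x, y) \<in># add_mset (i, j) G"
    then consider "x = i \<and> y = j" | "(x, y) \<in># G" by auto
    then show "x \<in> ?R v \<longleftrightarrow> y \<in> ?R v"
    proof cases
      case 1
      then show ?thesis using component_sym[of _ G v] by auto
    next
      case 2
      then show ?thesis using component_closed[OF 2] by auto
    qed
  qed auto
  moreover have "?R v \<subseteq> ?L v"
  proof (cases "v \<in> component G i \<union> component G j")
    case True
    then have "?L v = ?L i" using sub[of i] sub[of j] ij component_eq by blast
    then show ?thesis using True sub[of i] sub[of j] ij by auto
  qed (use sub in auto)
  ultimately show ?thesis by simp
qed

section \<open>Invariant states and the effect of an edge on trees and unicycles\<close>

text \<open>The invariant of the dynamics. It guarantees that a vertex which is not in a tree is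
  frozen, and so that the last branch of \<open>frozen_step\<close> really is the tree-unicycle
  case.\<close>

definition wf_state :: "nat \<Rightarrow> multigraph \<Rightarrow> bool" where
  "wf_state n G \<longleftrightarrow> set_mset G \<subseteq> possible_edges n \<and> (\<forall>v\<in>{1..n}. in_tree G v \<or> frozen G v)"

lemma component_subset:
  assumes "set_mset G \<subseteq> possible_edges n" "v \<in> {1..n}"
  shows "component G v \<subseteq> {1..n}"
  by (rule component_least) (use assms in \<open>auto simp: possible_edges_def\<close>)

lemma not_tree_and_frozen: "\<not> (in_tree G v \<and> frozen G v)"
  by (auto simp: in_tree_def frozen_def)

lemma in_tree_cong: "w \<in> component G v \<Longrightarrow> in_tree G w = in_tree G v"
  using component_eq[of w G v] by (simp add: in_tree_def component_edges_def)

lemma frozen_cong: "w \<in> component G v \<Longrightarrow> frozen G w = frozen G v"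
  using component_eq[of w G v] by (simp add: frozen_def component_edges_def)

lemma component_edges_outside:
  assumes "v \<notin> component G i \<union> component G j"
  shows "component_edges (add_mset (i, j) G) v = component_edges G v"
proof -
  have "i \<notin> component G v" using assms by (metis UnCI component_sym)
  then show ?thesis using assms by (simp add: component_edges_def component_add)
qed

lemma component_edges_same:
  assumes "component G i = component G j" "v \<in> component G i"
  shows "component_edges (add_mset (i, j) G) v = add_mset (i, j) (component_edges G i)"
  using assms component_refl[of i G] component_refl[of j G]
  by (simp add: component_edges_def component_add)

lemma component_edges_join:
  assumes "component G i \<noteq> component G j" "v \<in> component G i \<union> component G j"
  shows "component_edges (add_mset (i, j) G) v = add_mset (i, j) (component_edges G i + component_edges G j)"
proof -
  have d: "component G i \<inter> component G j = {}"
    using component_disjoint component_eq assms(1) by metis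
  let ?P = "\<lambda>v (x, y). x \<in> component G v \<and> y \<in> component G v"
  have "filter_mset (\<lambda>(x, y). x \<in> component G i \<union> component G j \<and> y \<in> component G i \<union> component G j) G
     = filter_mset (\<lambda>e. ?P i e \<or> ?P j e) G"
    by (rule filter_mset_cong) (use component_closed in auto)
  also have "\<dots> = filter_mset (?P i) G + filter_mset (?P j) G"
    by (rule multiset_eqI) (use d in \<open>auto simp: disjoint_iff\<close>)
  finally show ?thesis using assms component_refl[of i G] component_refl[of j G]
    by (simp add: component_edges_def component_add)
qed

lemma outside_status:
  assumes "v \<notin> component G i \<union> component G j"
  shows "in_tree (add_mset (i, j) G) v = in_tree G v" "frozen (add_mset (i, j) G) v = frozen G v"
    "component (add_mset (i, j) G) v = component G v"
  using assms component_edges_outside[OF assms] by (simp_all add: in_tree_def frozen_def component_add)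

lemma same_tree_status:
  assumes "in_tree G i" "component G i = component G j" "v \<in> component G i"
  shows "frozen (add_mset (i, j) G) v"
  using assms component_edges_same[of G i j v] by (simp add: frozen_def in_tree_def component_add)

text \<open>Vertex numbers and edge numbers both add, and the new edge adds one more. So an edge
  deficit of one on each side leaves a deficit of one, and a deficit on one side only leaves
  none.\<close>

lemma join_status:
  assumes "set_mset G \<subseteq> possible_edges n" "i \<in> {1..n}" "j \<in> {1..n}"
    and ne: "component G i \<noteq> component G j" and v: "v \<in> component G i \<union> component G j"
  shows "card (component (add_mset (i, j) G) v) = card (component G i) + card (component G j)"
    "in_tree G i \<Longrightarrow> in_tree G j \<Longrightarrow> in_tree (add_mset (i, j) G) v"
    "in_tree G i \<Longrightarrow> frozen G j \<Longrightarrow> frozen (add_mset (i, j) G) v"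
    "frozen G i \<Longrightarrow> in_tree G j \<Longrightarrow> frozen (add_mset (i, j) G) v"
proof -
  have d: "component G i \<inter> component G j = {}"
    using component_disjoint component_eq ne by metis
  have "finite (component G i)" "finite (component G j)"
    using component_subset[OF assms(1)] assms(2,3) finite_subset by blast+
  then show c: "card (component (add_mset (i, j) G) v) = card (component G i) + card (component G j)"
    using v d by (simp add: component_add card_Un_disjoint)
  show "in_tree G i \<Longrightarrow> in_tree G j \<Longrightarrow> in_tree (add_mset (i, j) G) v"
    "in_tree G i \<Longrightarrow> frozen G j \<Longrightarrow> frozen (add_mset (i, j) G) v"
    "frozen G i \<Longrightarrow> in_tree G j \<Longrightarrow> frozen (add_mset (i, j) G) v"
    using c component_edges_join[OF ne v] unfolding in_tree_def frozen_def by simp_all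
qed

section \<open>Weighted sums over the vertices in trees\<close>

text \<open>The sum runs over vertices, so a tree with a vertices contributes
  \<open>a * w a\<close>, which is what \<open>tree_weight\<close> records. All statistics are
  instances: sizes equal to k, all unfrozen vertices (constant weight 1), sizes at least K, and the
  potential for large trees.\<close>

definition tree_sum :: "nat \<Rightarrow> (nat \<Rightarrow> real) \<Rightarrow> multigraph \<Rightarrow> real" where
  "tree_sum n w G = (\<Sum>v\<in>{1..n}. if in_tree G v then w (card (component G v)) else 0)"

definition tree_weight :: "(nat \<Rightarrow> real) \<Rightarrow> multigraph \<Rightarrow> nat \<Rightarrow> real" where
  "tree_weight w G v = (if in_tree G v then real (card (component G v)) * w (card (component G v)) else 0)"

lemma component_partition: "component G i = component G j \<or> component G i \<inter> component G j = {}"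
  using component_disjoint component_eq by metis

lemma sum_component_weight:
  "(\<Sum>v\<in>component G i. if in_tree G v then w (card (component G v)) else 0) = tree_weight w G i"
proof -
  have "(\<Sum>v\<in>component G i. if in_tree G v then w (card (component G v)) else 0)
    = (\<Sum>v\<in>component G i. if in_tree G i then w (card (component G i)) else 0)"
    by (rule sum.cong) (auto simp: in_tree_cong component_eq)
  then show ?thesis by (simp add: tree_weight_def)
qed

lemma tree_weight_frozen: "frozen G i \<Longrightarrow> tree_weight w G i = 0"
  using not_tree_and_frozen[of G i] by (auto simp: tree_weight_def)

text \<open>Only the two touched components change. Their vertices lose their old contribution,
  counted once if the components coincide, and gain a new one exactly when two different trees
  merge, since every other permitted edge leaves them frozen.\<close>

lemma tree_sum_add:
  assumes wf: "wf_state n G" and ij: "i \<in> {1..n}" "j \<in> {1..n}"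
    and nf: "\<not> (frozen G i \<and> frozen G j)"
  shows "tree_sum n w (add_mset (i, j) G) = tree_sum n w G
    + (if in_tree G i \<and> in_tree G j \<and> component G i \<noteq> component G j
       then real (card (component G i) + card (component G j)) * w (card (component G i) + card (component G j)) else 0)
    - tree_weight w G i - (if component G i = component G j then 0 else tree_weight w G j)"
proof -
  have wfe: "set_mset G \<subseteq> possible_edges n" and tf: "\<And>v. v \<in> {1..n} \<Longrightarrow> in_tree G v \<or> frozen G v"
    using wf by (auto simp: wf_state_def)
  let ?G = "add_mset (i, j) G"
  let ?h = "\<lambda>G v. if in_tree G v then w (card (component G v)) else 0"
  let ?U = "component G i \<union> component G j"
  have U: "?U \<subseteq> {1..n}" using component_subset[OF wfe] ij by auto
  have fin: "finite (component G i)" "finite (component G j)"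
    using U by (meson finite_Un finite_atLeastAtMost finite_subset)+
  have out: "(\<Sum>v\<in>{1..n} - ?U. ?h ?G v) = (\<Sum>v\<in>{1..n} - ?U. ?h G v)"
    by (rule sum.cong) (simp_all add: outside_status)
  have split: "tree_sum n w H = (\<Sum>v\<in>{1..n} - ?U. ?h H v) + (\<Sum>v\<in>?U. ?h H v)" for H
    unfolding tree_sum_def using sum.subset_diff[OF U, of "?h H"] by simp
  have old: "(\<Sum>v\<in>?U. ?h G v) = tree_weight w G i + (if component G i = component G j then 0 else tree_weight w G j)"
  proof (cases "component G i = component G j")
    case True
    then show ?thesis using sum_component_weight[where i=i and w=w and G=G] by simp
  next
    case False
    then have "component G i \<inter> component G j = {}" using component_partition by blast
    then show ?thesis using False fin by (simp add: sum.union_disjoint sum_component_weight)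
  qed
  have new: "(\<Sum>v\<in>?U. ?h ?G v) = (if in_tree G i \<and> in_tree G j \<and> component G i \<noteq> component G j
       then real (card (component G i) + card (component G j)) * w (card (component G i) + card (component G j)) else 0)"
  proof (cases "component G i = component G j")
    case True
    then have "in_tree G i" using nf tf ij in_tree_cong[of j G i] frozen_cong[of j G i] component_refl[of j G] by auto
    then have "(\<Sum>v\<in>?U. ?h ?G v) = 0"
      using same_tree_status[of G i j] True not_tree_and_frozen by (intro sum.neutral) auto
    then show ?thesis using True by simp
  next
    case False
    then have d: "component G i \<inter> component G j = {}" using component_partition by blast
    show ?thesis
    proof (cases "in_tree G i \<and> in_tree G j")
      case True
      then have "(\<Sum>v\<in>?U. ?h ?G v) = (\<Sum>v\<in>?U. w (card (component G i) + card (component G j)))"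
        using join_status[OF wfe ij False] by (intro sum.cong) auto
      then show ?thesis using True False d fin by (simp add: card_Un_disjoint)
    next
      case nt: False
      then have "frozen ?G v" if "v \<in> ?U" for v
        using join_status(3,4)[OF wfe ij False that] tf ij nf by auto
      then have "(\<Sum>v\<in>?U. ?h ?G v) = 0"
        using not_tree_and_frozen by (intro sum.neutral) auto
      then show ?thesis using nt by auto
    qed
  qed
  show ?thesis unfolding split out old new by simp
qed

lemma status_add:
  assumes wf: "wf_state n G" and ij: "i \<in> {1..n}" "j \<in> {1..n}"
    and nf: "\<not> (frozen G i \<and> frozen G j)" and v: "v \<in> {1..n}"
  shows "in_tree (add_mset (i, j) G) v \<or> frozen (add_mset (i, j) G) v"
    "frozen G v \<Longrightarrow> frozen (add_mset (i, j) G) v"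
proof -
  have wfe: "set_mset G \<subseteq> possible_edges n" and tf: "\<And>v. v \<in> {1..n} \<Longrightarrow> in_tree G v \<or> frozen G v"
    using wf by (auto simp: wf_state_def)
  have *: "(in_tree (add_mset (i, j) G) v \<or> frozen (add_mset (i, j) G) v) \<and>
    (frozen G v \<longrightarrow> frozen (add_mset (i, j) G) v)"
  proof (cases "v \<in> component G i \<union> component G j")
    case False
    then show ?thesis using tf[OF v] by (simp add: outside_status)
  next
    case True
    show ?thesis
    proof (cases "component G i = component G j")
      case eq: True
      then have "in_tree G i" using nf tf ij in_tree_cong[of j G i] frozen_cong[of j G i] component_refl[of j G] by auto
      then show ?thesis using same_tree_status eq True by auto
    next
      case ne: False
      have "in_tree G i \<and> in_tree G j \<Longrightarrow> \<not> frozen G v"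
        using True in_tree_cong not_tree_and_frozen by blast
      then show ?thesis using join_status(2-4)[OF wfe ij ne True] tf ij nf by blast
    qed
  qed
  then show "in_tree (add_mset (i, j) G) v \<or> frozen (add_mset (i, j) G) v"
    "frozen G v \<Longrightarrow> frozen (add_mset (i, j) G) v" by auto
qed

lemma possible_edges_mem: "(i, j) \<in> possible_edges n \<Longrightarrow> i \<in> {1..n} \<and> j \<in> {1..n} \<and> i < j"
  by (auto simp: possible_edges_def)

lemma wf_state_add:
  assumes "wf_state n G" "(i, j) \<in> possible_edges n" "\<not> (frozen G i \<and> frozen G j)"
  shows "wf_state n (add_mset (i, j) G)"
  using assms status_add(1)[OF assms(1) _ _ assms(3)] possible_edges_mem[OF assms(2)]
  unfolding wf_state_def by auto

lemma component_empty: "component {#} v = {v}"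
  by (simp add: component_def)

lemma in_tree_empty: "in_tree {#} v"
  by (simp add: in_tree_def component_edges_def component_empty)

lemma wf_state_empty: "wf_state n {#}"
  by (simp add: wf_state_def in_tree_empty)

section \<open>Law and mean of a single step\<close>

lemma finite_possible_edges [simp]: "finite (possible_edges n)"
  by (rule finite_subset[of _ "{1..n} \<times> {1..n}"]) (auto simp: possible_edges_def)

lemma possible_edges_nonempty: "2 \<le> n \<Longrightarrow> possible_edges n \<noteq> {}"
proof -
  assume "2 \<le> n"
  then have "(1, 2) \<in> possible_edges n" by (simp add: possible_edges_def)
  then show ?thesis by blast
qed

text \<open>Over ordered pairs the drifts become double sums over vertices, and these factor into
  products of one-vertex statistics up to pairs in a common component.\<close>

lemma sum_possible_edges:
  fixes h :: "nat \<Rightarrow> nat \<Rightarrow> real"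
  assumes "\<And>i j. h i j = h j i"
  shows "2 * (\<Sum>(i, j)\<in>possible_edges n. h i j) = (\<Sum>i\<in>{1..n}. \<Sum>j\<in>{1..n} - {i}. h i j)"
proof -
  let ?E = "possible_edges n" and ?F = "{(i, j). 1 \<le> j \<and> j < i \<and> i \<le> n}"
  have F: "?F = prod.swap ` ?E" by (auto simp: possible_edges_def image_iff)
  have "(\<Sum>i\<in>{1..n}. \<Sum>j\<in>{1..n} - {i}. h i j) = (\<Sum>(i, j)\<in>(SIGMA i:{1..n}. {1..n} - {i}). h i j)"
    by (rule sum.Sigma) auto
  also have "(SIGMA i:{1..n}. {1..n} - {i}) = ?E \<union> ?F" by (auto simp: possible_edges_def)
  also have "(\<Sum>(i, j)\<in>?E \<union> ?F. h i j) = (\<Sum>(i, j)\<in>?E. h i j) + (\<Sum>(i, j)\<in>?F. h i j)"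
  proof (rule sum.union_disjoint)
    show "finite ?F" unfolding F by (intro finite_imageI finite_possible_edges)
    show "?E \<inter> ?F = {}" by (auto simp: possible_edges_def)
  qed simp
  also have "(\<Sum>(i, j)\<in>?F. h i j) = (\<Sum>(i, j)\<in>?E. h i j)"
    unfolding F by (subst sum.reindex) (auto simp: assms intro!: sum.cong)
  finally show ?thesis by simp
qed

lemma card_possible_edges: "2 * real (card (possible_edges n)) = real n * (real n - 1)"
proof -
  have "2 * real (card (possible_edges n)) = 2 * (\<Sum>(i, j)\<in>possible_edges n. 1)" by (simp add: case_prod_unfold)
  also have "\<dots> = (\<Sum>i\<in>{1..n}. \<Sum>j\<in>{1..n} - {i}. 1)" by (rule sum_possible_edges) simp
  also have "\<dots> = (\<Sum>i\<in>{1..n}. real n - 1)" by (rule sum.cong) (auto simp: of_nat_diff)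
  finally show ?thesis by simp
qed

lemma set_frozen_step:
  assumes "2 \<le> n" "G' \<in> set_pmf (frozen_step p n G)"
  obtains "G' = G" | i j where "(i, j) \<in> possible_edges n" "\<not> (frozen G i \<and> frozen G j)" "G' = add_mset (i, j) G"
proof -
  have nf: "in_tree G v \<Longrightarrow> \<not> frozen G v" for v using not_tree_and_frozen by blast
  show thesis using assms that nf
    by (auto simp: frozen_step_def possible_edges_nonempty split: if_splits)
qed

lemma finite_set_frozen_step: "2 \<le> n \<Longrightarrow> finite (set_pmf (frozen_step p n G))"
  by (auto simp: frozen_step_def possible_edges_nonempty)

lemma expectation_bind_finite:
  fixes h :: "'b \<Rightarrow> real"
  assumes "finite (set_pmf p)" "\<And>x. x \<in> set_pmf p \<Longrightarrow> finite (set_pmf (f x))"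
  shows "measure_pmf.expectation (bind_pmf p f) h = measure_pmf.expectation p (\<lambda>x. measure_pmf.expectation (f x) h)"
  by (subst pmf_expectation_bind[OF assms(1)]) (use assms in \<open>auto simp: integral_measure_pmf[OF assms(1)]\<close>)

lemma expectation_frozen_step:
  assumes n: "2 \<le> n" and p: "0 \<le> p" "p \<le> 1"
  shows "measure_pmf.expectation (frozen_step p n G) \<phi> =
    (\<Sum>(i, j)\<in>possible_edges n. if in_tree G i \<and> in_tree G j then \<phi> (add_mset (i, j) G)
        else if frozen G i \<and> frozen G j then \<phi> G
        else p * \<phi> (add_mset (i, j) G) + (1 - p) * \<phi> G) / real (card (possible_edges n))"
  unfolding frozen_step_def
  apply (subst expectation_bind_finite)
    apply (auto simp: possible_edges_nonempty n)[2]
  apply (subst integral_pmf_of_set)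
    apply (auto simp: possible_edges_nonempty n)[2]
  apply (rule arg_cong[where f = "\<lambda>x. x / _"])
  apply (rule sum.cong)
  using p apply (auto simp: mult.commute)
  done

text \<open>Mean change caused by selecting the edge between i and j. Frozen vertices have weight 0,
  so the last branch covers the tree-unicycle pair and also gives 0 for two frozen endpoints; being
  symmetric, the term can be summed over ordered pairs.\<close>

definition drift_term :: "real \<Rightarrow> (nat \<Rightarrow> real) \<Rightarrow> multigraph \<Rightarrow> nat \<Rightarrow> nat \<Rightarrow> real" where
  "drift_term p w G i j =
    (if in_tree G i \<and> in_tree G j then
       (if component G i = component G j then - tree_weight w G i
        else real (card (component G i) + card (component G j)) * w (card (component G i) + card (component G j))
          - tree_weight w G i - tree_weight w G j)
     else - p * (tree_weight w G i + tree_weight w G j))"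

lemma tree_weight_cong: "component G i = component G j \<Longrightarrow> tree_weight w G i = tree_weight w G j"
  using in_tree_cong[of j G i] component_refl[of j G] by (simp add: tree_weight_def)

lemma drift_term_sym: "drift_term p w G i j = drift_term p w G j i"
  using tree_weight_cong[of G i j w] by (auto simp: drift_term_def add.commute)

lemma expectation_tree_sum:
  assumes n: "2 \<le> n" and p: "0 \<le> p" "p \<le> 1" and wf: "wf_state n G"
  shows "measure_pmf.expectation (frozen_step p n G) (tree_sum n w) =
    tree_sum n w G + (\<Sum>i\<in>{1..n}. \<Sum>j\<in>{1..n} - {i}. drift_term p w G i j) / (real n * (real n - 1))"
proof -
  have c: "real (card (possible_edges n)) > 0" using n by (simp add: card_gt_0_iff possible_edges_nonempty)
  have "measure_pmf.expectation (frozen_step p n G) (tree_sum n w) =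
    (\<Sum>(i, j)\<in>possible_edges n. tree_sum n w G + drift_term p w G i j) / real (card (possible_edges n))"
  proof (subst expectation_frozen_step[OF n p], rule arg_cong[where f = "\<lambda>x. x / _"], rule sum.cong, simp, clarify)
    fix i j assume e: "(i, j) \<in> possible_edges n"
    then have ij: "i \<in> {1..n}" "j \<in> {1..n}" using possible_edges_mem by blast+
    have ti: "in_tree G i = (\<not> frozen G i)" "in_tree G j = (\<not> frozen G j)"
      using ij wf not_tree_and_frozen by (auto simp: wf_state_def)
    have ne: "component G i = component G j \<Longrightarrow> frozen G i = frozen G j"
      using frozen_cong[of j G i] component_refl[of j G] by auto
    note add = tree_sum_add[OF wf ij, of w]
    show "(if in_tree G i \<and> in_tree G j then tree_sum n w (add_mset (i, j) G)
          else if frozen G i \<and> frozen G j then tree_sum n w G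
               else p * tree_sum n w (add_mset (i, j) G) + (1 - p) * tree_sum n w G) =
         tree_sum n w G + drift_term p w G i j"
      using add ne tree_weight_frozen[of G i w] tree_weight_frozen[of G j w] ti
      by (cases "frozen G i"; cases "frozen G j"; cases "component G i = component G j")
        (simp_all add: drift_term_def algebra_simps flip: distrib_left)
  qed
  also have "\<dots> = tree_sum n w G + (\<Sum>(i, j)\<in>possible_edges n. drift_term p w G i j) / real (card (possible_edges n))"
    using c by (auto simp: sum.distrib case_prod_unfold add_divide_distrib)
  also have "(\<Sum>(i, j)\<in>possible_edges n. drift_term p w G i j) / real (card (possible_edges n)) =
     (2 * (\<Sum>(i, j)\<in>possible_edges n. drift_term p w G i j)) / (2 * real (card (possible_edges n)))" by simp
  also have "\<dots> = (\<Sum>i\<in>{1..n}. \<Sum>j\<in>{1..n} - {i}. drift_term p w G i j) / (real n * (real n - 1))"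
    unfolding card_possible_edges by (subst sum_possible_edges) (simp_all add: drift_term_sym)
  finally show ?thesis .
qed

lemma wf_state_step:
  assumes "2 \<le> n" "wf_state n G" "G' \<in> set_pmf (frozen_step p n G)"
  shows "wf_state n G'" "v \<in> {1..n} \<Longrightarrow> frozen G v \<Longrightarrow> frozen G' v"
proof -
  show "wf_state n G'" using assms(1,3) by (rule set_frozen_step) (use assms(2) wf_state_add in auto)
  show "frozen G' v" if "v \<in> {1..n}" "frozen G v"
    using assms(1,3) by (rule set_frozen_step) (use assms(2) that status_add(2) possible_edges_mem in blast)+
qed

section \<open>One-step drifts of tree statistics\<close>

abbreviation size_count :: "nat \<Rightarrow> nat \<Rightarrow> multigraph \<Rightarrow> real" where
  "size_count n k \<equiv> tree_sum n (\<lambda>a. of_bool (a = k))"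

definition frozen_count :: "nat \<Rightarrow> multigraph \<Rightarrow> real" where
  "frozen_count n G = (\<Sum>v\<in>{1..n}. of_bool (frozen G v))"

lemma tree_sum_one:
  assumes "wf_state n G"
  shows "tree_sum n (\<lambda>_. 1) G = real n - frozen_count n G"
proof -
  have "tree_sum n (\<lambda>_. 1) G + frozen_count n G = (\<Sum>v\<in>{1..n}. 1)"
    unfolding tree_sum_def frozen_count_def sum.distrib[symmetric]
    by (rule sum.cong) (use assms not_tree_and_frozen in \<open>auto simp: wf_state_def\<close>)
  then show ?thesis by simp
qed

lemma tree_sum_mono:
  "(\<And>a. w a \<le> w' a) \<Longrightarrow> tree_sum n w G \<le> tree_sum n w' G"
  unfolding tree_sum_def by (rule sum_mono) auto

lemma tree_sum_nonneg: "(\<And>a. 0 \<le> w a) \<Longrightarrow> 0 \<le> tree_sum n w G"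
  unfolding tree_sum_def by (rule sum_nonneg) auto

lemma tree_sum_add_weights: "tree_sum n (\<lambda>a. w a + w' a) G = tree_sum n w G + tree_sum n w' G"
  unfolding tree_sum_def sum.distrib[symmetric] by (rule sum.cong) auto

lemma tree_sum_scale: "tree_sum n (\<lambda>a. c * w a) G = c * tree_sum n w G"
  unfolding tree_sum_def sum_distrib_left by (rule sum.cong) auto

lemma tree_sum_le:
  assumes "\<And>a. w a \<le> c" "0 \<le> c" shows "tree_sum n w G \<le> real n * c"
proof -
  have "tree_sum n w G \<le> (\<Sum>v\<in>{1..n}. c)" unfolding tree_sum_def by (rule sum_mono) (use assms in auto)
  then show ?thesis by simp
qed

lemma frozen_count_bounds: "0 \<le> frozen_count n G" "frozen_count n G \<le> real n"
proof -
  show "0 \<le> frozen_count n G" unfolding frozen_count_def by (rule sum_nonneg) auto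
  have "frozen_count n G \<le> (\<Sum>v\<in>{1..n}. 1)" unfolding frozen_count_def by (rule sum_mono) auto
  then show "frozen_count n G \<le> real n" by simp
qed

lemma card_component_bounds:
  assumes "wf_state n G" "v \<in> {1..n}"
  shows "1 \<le> card (component G v)" "finite (component G v)" "component G v \<subseteq> {1..n}"
proof -
  show s: "component G v \<subseteq> {1..n}" using component_subset assms by (auto simp: wf_state_def)
  then show f: "finite (component G v)" by (rule finite_subset) simp
  have "card (component G v) \<noteq> 0" using f component_refl[of v G] card_0_eq by blast
  then show "1 \<le> card (component G v)" by simp
qed

text \<open>The right-hand side of Smoluchowski's equation with gluing: unfrozen partners count
  fully, frozen ones with weight p. The double sum of \<open>h\<close> factors exactly, and
  \<open>drift_term\<close> differs from \<open>h\<close> only for j in the component of i: at most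
  k relevant pairs for each i, each off by at most k, plus the absent diagonal term, at most 2
  k.\<close>

lemma drift_size_count:
  assumes wf: "wf_state n G" and p: "0 \<le> p" "p \<le> 1"
  shows "\<bar>(\<Sum>i\<in>{1..n}. \<Sum>j\<in>{1..n} - {i}. drift_term p (\<lambda>a. of_bool (a = k)) G i j)
    - (real k * (\<Sum>a\<in>{1..<k}. size_count n a G * size_count n (k - a) G)
       - 2 * real k * size_count n k G * (tree_sum n (\<lambda>_. 1) G + p * frozen_count n G))\<bar>
    \<le> real n * (real k ^ 2 + 2 * real k)"
proof -
  let ?V = "{1..n}" and ?w = "\<lambda>a. of_bool (a = k) :: real"
  let ?s = "\<lambda>i. card (component G i)"
  define t where "t i = tree_weight ?w G i" for i
  define c where "c i = (if in_tree G i then 1 else p)" for i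
  define h where "h i j = real k * of_bool (in_tree G i \<and> in_tree G j \<and> ?s i + ?s j = k) - t i * c j - t j * c i" for i j
  have tf: "\<And>v. v \<in> ?V \<Longrightarrow> in_tree G v = (\<not> frozen G v)"
    using wf not_tree_and_frozen by (auto simp: wf_state_def)
  have t_eq: "t i = real k * of_bool (in_tree G i \<and> ?s i = k)" for i by (simp add: t_def tree_weight_def)
  have sum_t: "(\<Sum>i\<in>?V. t i) = real k * size_count n k G"
    unfolding t_eq tree_sum_def sum_distrib_left by (rule sum.cong) auto
  have sum_c: "(\<Sum>i\<in>?V. c i) = tree_sum n (\<lambda>_. 1) G + p * frozen_count n G"
    unfolding c_def tree_sum_def frozen_count_def sum_distrib_left sum.distrib[symmetric]
    by (rule sum.cong) (auto simp: tf)
  \<comment> \<open>The indicator is expanded over the size a of the first component; since both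
    sizes are at least 1, a ranges over \<open>{1..<k}\<close>.\<close>
  have pair: "(\<Sum>i\<in>?V. \<Sum>j\<in>?V. of_bool (in_tree G i \<and> in_tree G j \<and> ?s i + ?s j = k))
     = (\<Sum>a\<in>{1..<k}. size_count n a G * size_count n (k - a) G)"
  proof -
    have "(\<Sum>i\<in>?V. \<Sum>j\<in>?V. of_bool (in_tree G i \<and> in_tree G j \<and> ?s i + ?s j = k)) =
      (\<Sum>i\<in>?V. \<Sum>j\<in>?V. \<Sum>a\<in>{1..<k}. of_bool (in_tree G i \<and> ?s i = a) * (of_bool (in_tree G j \<and> ?s j = k - a) :: real))"
    proof (intro sum.cong refl)
      fix i j assume ij: "i \<in> ?V" "j \<in> ?V"
      have p1: "1 \<le> ?s i" "1 \<le> ?s j" using card_component_bounds(1)[OF wf] ij by auto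
      have "(\<Sum>a\<in>{1..<k}. of_bool (in_tree G i \<and> ?s i = a) * (of_bool (in_tree G j \<and> ?s j = k - a) :: real))
        = (\<Sum>a\<in>{1..<k}. if a = ?s i then of_bool (in_tree G i \<and> in_tree G j \<and> ?s i + ?s j = k) else 0)"
        using p1 by (intro sum.cong) auto
      also have "\<dots> = of_bool (in_tree G i \<and> in_tree G j \<and> ?s i + ?s j = k)"
        using p1 by (subst sum.delta) auto
      finally show "of_bool (in_tree G i \<and> in_tree G j \<and> ?s i + ?s j = k) =
        (\<Sum>a\<in>{1..<k}. of_bool (in_tree G i \<and> ?s i = a) * (of_bool (in_tree G j \<and> ?s j = k - a) :: real))" ..
    qed
    also have "\<dots> = (\<Sum>i\<in>?V. \<Sum>a\<in>{1..<k}. \<Sum>j\<in>?V. of_bool (in_tree G i \<and> ?s i = a) * of_bool (in_tree G j \<and> ?s j = k - a))"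
      by (rule sum.cong[OF refl], rule sum.swap)
    also have "\<dots> = (\<Sum>a\<in>{1..<k}. \<Sum>i\<in>?V. \<Sum>j\<in>?V. of_bool (in_tree G i \<and> ?s i = a) * of_bool (in_tree G j \<and> ?s j = k - a))"
      by (rule sum.swap)
    also have "\<dots> = (\<Sum>a\<in>{1..<k}. size_count n a G * size_count n (k - a) G)"
    proof (intro sum.cong refl)
      fix a
      have "size_count n a G = (\<Sum>i\<in>?V. of_bool (in_tree G i \<and> ?s i = a))" for a
        unfolding tree_sum_def by (rule sum.cong) auto
      then show "(\<Sum>i\<in>?V. \<Sum>j\<in>?V. of_bool (in_tree G i \<and> ?s i = a) * of_bool (in_tree G j \<and> ?s j = k - a)) =
         size_count n a G * size_count n (k - a) G"
        by (simp only: sum_product)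
    qed
    finally show ?thesis .
  qed
  have total: "(\<Sum>i\<in>?V. \<Sum>j\<in>?V. h i j) = real k * (\<Sum>a\<in>{1..<k}. size_count n a G * size_count n (k - a) G)
       - 2 * real k * size_count n k G * (tree_sum n (\<lambda>_. 1) G + p * frozen_count n G)"
  proof -
    have "(\<Sum>i\<in>?V. \<Sum>j\<in>?V. h i j) = real k * (\<Sum>i\<in>?V. \<Sum>j\<in>?V. of_bool (in_tree G i \<and> in_tree G j \<and> ?s i + ?s j = k))
      - (\<Sum>i\<in>?V. t i) * (\<Sum>i\<in>?V. c i) - (\<Sum>i\<in>?V. \<Sum>j\<in>?V. t j * c i)"
      unfolding h_def sum_subtractf sum_product[of t] by (simp only: sum_distrib_left)
    also have "(\<Sum>i\<in>?V. \<Sum>j\<in>?V. t j * c i) = (\<Sum>i\<in>?V. t i) * (\<Sum>i\<in>?V. c i)"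
      unfolding sum_product by (rule sum.swap)
    finally show ?thesis unfolding pair sum_t sum_c by simp
  qed
  have row: "\<bar>(\<Sum>j\<in>?V - {i}. drift_term p ?w G i j) - (\<Sum>j\<in>?V. h i j)\<bar> \<le> real k ^ 2 + 2 * real k" if i: "i \<in> ?V" for i
  proof -
    define d where "d j = drift_term p ?w G i j - h i j" for j
    note cb = card_component_bounds[OF wf i]
    have d_out: "d j = 0" if "j \<in> ?V" "j \<notin> component G i" for j
    proof -
      have "component G i \<noteq> component G j" using that component_refl by blast
      then show ?thesis using that i tf by (auto simp: d_def drift_term_def h_def t_eq c_def tree_weight_def algebra_simps)
    qed
    have d_in: "\<bar>d j\<bar> \<le> (if ?s i \<le> k then real k else 0)" if "j \<in> component G i" for j
    proof -
      have "component G j = component G i" "in_tree G j = in_tree G i" using component_eq in_tree_cong that by auto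
      then show ?thesis using tf[OF i] p
        by (auto simp: d_def drift_term_def h_def t_eq c_def tree_weight_def algebra_simps mult_left_le_one_le)
    qed
    have "\<bar>\<Sum>j\<in>?V - {i}. d j\<bar> \<le> (\<Sum>j\<in>?V - {i}. \<bar>d j\<bar>)" by (rule sum_abs)
    also have "\<dots> \<le> (\<Sum>j\<in>?V. \<bar>d j\<bar>)" by (rule sum_mono2) auto
    also have "\<dots> = (\<Sum>j\<in>component G i. \<bar>d j\<bar>)" using cb(3) d_out by (intro sum.mono_neutral_right) auto
    also have "\<dots> \<le> (\<Sum>j\<in>component G i. if ?s i \<le> k then real k else 0)" by (rule sum_mono) (rule d_in)
    also have "\<dots> \<le> real k ^ 2" by (simp add: power2_eq_square mult_right_mono)
    finally have 1: "\<bar>\<Sum>j\<in>?V - {i}. d j\<bar> \<le> real k ^ 2" .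
    have 2: "\<bar>h i i\<bar> \<le> 2 * real k" using p by (auto simp: h_def t_eq c_def tf[OF i])
    have "(\<Sum>j\<in>?V. h i j) = h i i + (\<Sum>j\<in>?V - {i}. h i j)" using i by (subst sum.remove[of _ i]) auto
    then have "(\<Sum>j\<in>?V - {i}. drift_term p ?w G i j) - (\<Sum>j\<in>?V. h i j) = (\<Sum>j\<in>?V - {i}. d j) - h i i"
      by (simp add: d_def sum_subtractf)
    then show ?thesis using 1 2 by linarith
  qed
  have "\<bar>(\<Sum>i\<in>?V. \<Sum>j\<in>?V - {i}. drift_term p ?w G i j) - (\<Sum>i\<in>?V. \<Sum>j\<in>?V. h i j)\<bar>
    \<le> (\<Sum>i\<in>?V. \<bar>(\<Sum>j\<in>?V - {i}. drift_term p ?w G i j) - (\<Sum>j\<in>?V. h i j)\<bar>)"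
    unfolding sum_subtractf[symmetric] by (rule sum_abs)
  also have "\<dots> \<le> (\<Sum>i\<in>?V. real k ^ 2 + 2 * real k)" by (rule sum_mono) (rule row)
  finally show ?thesis unfolding total by simp
qed

section \<open>Mass loss inside trees and the potential for large trees\<close>

text \<open>Mergers of trees conserve the number of unfrozen vertices. What remains is the loss
  through the \<open>a * (a - 1)\<close> ordered pairs inside a tree of size a, each of which
  freezes a vertices; gluing to unicycles only lowers the sum further.\<close>

lemma drift_trees:
  assumes wf: "wf_state n G" and p: "0 \<le> p" "p \<le> 1"
  shows "(\<Sum>i\<in>{1..n}. \<Sum>j\<in>{1..n} - {i}. drift_term p (\<lambda>_. 1) G i j) \<le> - tree_sum n (\<lambda>a. real a * (real a - 1)) G"
proof -
  have "(\<Sum>i\<in>{1..n}. \<Sum>j\<in>{1..n} - {i}. drift_term p (\<lambda>_. 1) G i j) \<le>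
    (\<Sum>i\<in>{1..n}. - (if in_tree G i then real (card (component G i)) * (real (card (component G i)) - 1) else 0))"
  proof (rule sum_mono)
    fix i assume i: "i \<in> {1..n}"
    let ?s = "card (component G i)"
    note cb = card_component_bounds[OF wf i]
    have "(\<Sum>j\<in>{1..n} - {i}. drift_term p (\<lambda>_. 1) G i j) \<le> (\<Sum>j\<in>{1..n} - {i}. if j \<in> component G i \<and> in_tree G i then - real ?s else 0)"
    proof (rule sum_mono)
      fix j
      show "drift_term p (\<lambda>_. 1) G i j \<le> (if j \<in> component G i \<and> in_tree G i then - real ?s else 0)"
      proof (cases "component G i = component G j")
        case True
        moreover have "j \<in> component G i" using True by simp
        ultimately show ?thesis using in_tree_cong[of j G i] p by (simp add: drift_term_def tree_weight_def)
      next
        case False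
        then have "j \<notin> component G i" using component_eq by metis
        then show ?thesis using False p by (simp add: drift_term_def tree_weight_def)
      qed
    qed
    also have "\<dots> = (\<Sum>j\<in>component G i - {i}. if in_tree G i then - real ?s else 0)"
      using cb(3) by (intro sum.mono_neutral_cong_right) auto
    also have "\<dots> = - (if in_tree G i then real ?s * (real ?s - 1) else 0)"
      using cb by (simp add: card_Diff_singleton of_nat_diff algebra_simps)
    finally show "(\<Sum>j\<in>{1..n} - {i}. drift_term p (\<lambda>_. 1) G i j) \<le> - (if in_tree G i then real ?s * (real ?s - 1) else 0)" .
  qed
  then show ?thesis by (simp only: tree_sum_def sum_negf)
qed

text \<open>For the weight \<open>1 / max K a\<close>, every tree contributes \<open>min 1 (a / K)\<close>, which drops by one
  whenever two trees with at least \<open>K\<close> vertices merge.\<close>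

lemma drift_large:
  assumes wf: "wf_state n G" and p: "0 \<le> p" "p \<le> 1" and K: "1 \<le> K"
  shows "(\<Sum>i\<in>{1..n}. \<Sum>j\<in>{1..n} - {i}. drift_term p (\<lambda>a. 1 / real (max K a)) G i j)
    \<le> tree_sum n real G - (tree_sum n (\<lambda>a. of_bool (K \<le> a)) G)\<^sup>2"
proof -
  let ?V = "{1..n}" and ?s = "\<lambda>i. card (component G i)" and ?w = "\<lambda>a. 1 / real (max K a)"
  define L where "L i = (of_bool (in_tree G i \<and> K \<le> ?s i) :: real)" for i
  have L_sum: "tree_sum n (\<lambda>a. of_bool (K \<le> a)) G = (\<Sum>i\<in>?V. L i)"
    unfolding tree_sum_def L_def by (rule sum.cong) auto
  \<comment> \<open>Subadditivity of the concave function \<open>min 1 (a / K)\<close>, which makes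
    all other mergers harmless.\<close>
  have theta: "real (a + b) * (1 / real (max K (a + b))) - real a * (1 / real (max K a)) - real b * (1 / real (max K b))
    \<le> - of_bool (K \<le> a \<and> K \<le> b)" for a b :: nat
  proof -
    have t: "real a * (1 / real (max K a)) = (if K \<le> a then 1 else real a / real K)" for a
      using K by (auto simp: max_def)
    consider "K \<le> a" "K \<le> b" | "K \<le> a" "\<not> K \<le> b" | "\<not> K \<le> a" "K \<le> b"
      | "\<not> K \<le> a" "\<not> K \<le> b" "K \<le> a + b" | "\<not> K \<le> a" "\<not> K \<le> b" "\<not> K \<le> a + b" by blast
    then show ?thesis
    proof cases
      case 4
      then have "1 \<le> (real a + real b) / real K" using K by simp
      then show ?thesis unfolding t using 4 by (simp add: add_divide_distrib)
    qed (unfold t, use K in \<open>auto simp: field_simps\<close>)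
  qed
  have row: "(\<Sum>j\<in>?V - {i}. drift_term p ?w G i j) \<le> (if in_tree G i then real (?s i) else 0) - L i * (\<Sum>j\<in>?V. L j)" if i: "i \<in> ?V" for i
  proof -
    note cb = card_component_bounds[OF wf i]
    have nn: "tree_weight ?w G j \<ge> 0" for j by (simp add: tree_weight_def)
    have "(\<Sum>j\<in>?V - {i}. drift_term p ?w G i j) \<le> (\<Sum>j\<in>?V - {i}. of_bool (in_tree G i \<and> j \<in> component G i) - L i * L j)"
    proof (rule sum_mono)
      fix j
      show "drift_term p ?w G i j \<le> of_bool (in_tree G i \<and> j \<in> component G i) - L i * L j"
      proof (cases "in_tree G i \<and> in_tree G j")
        case False
        have "p * (tree_weight ?w G i + tree_weight ?w G j) \<ge> 0" using nn p by (intro mult_nonneg_nonneg add_nonneg_nonneg) auto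
        then show ?thesis using False by (auto simp: drift_term_def L_def)
      next
        case True
        show ?thesis
        proof (cases "component G i = component G j")
          case eq: True
          then have "j \<in> component G i" by simp
          then show ?thesis using True eq nn[of i] by (auto simp: drift_term_def L_def)
        next
          case ne: False
          then have "j \<notin> component G i" using component_eq by metis
          have "drift_term p ?w G i j = real (?s i + ?s j) * (1 / real (max K (?s i + ?s j)))
            - real (?s i) * (1 / real (max K (?s i))) - real (?s j) * (1 / real (max K (?s j)))"
            using True ne by (simp only: drift_term_def tree_weight_def if_True if_False simp_thms)
          also have "\<dots> \<le> - of_bool (K \<le> ?s i \<and> K \<le> ?s j)" by (rule theta)
          also have "\<dots> = of_bool (in_tree G i \<and> j \<in> component G i) - L i * L j"
            using True \<open>j \<notin> component G i\<close> by (simp add: L_def)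
          finally show ?thesis .
        qed
      qed
    qed
    also have "\<dots> = (\<Sum>j\<in>?V - {i}. of_bool (in_tree G i \<and> j \<in> component G i)) - L i * (\<Sum>j\<in>?V - {i}. L j)"
      by (simp add: sum_subtractf sum_distrib_left)
    also have "(\<Sum>j\<in>?V - {i}. of_bool (in_tree G i \<and> j \<in> component G i)) = (\<Sum>j\<in>component G i - {i}. of_bool (in_tree G i) :: real)"
      using cb(3) by (intro sum.mono_neutral_cong_right) auto
    also have "\<dots> = (if in_tree G i then real (?s i) - 1 else 0)"
      using cb by (simp add: card_Diff_singleton of_nat_diff)
    \<comment> \<open>The missing diagonal term \<open>L i * L i\<close> is at most 1 and vanishes
      outside trees; the pair i, i is also absent from the tree size, so
      \<open>real (?s i) - 1\<close> pays for it.\<close>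
    also have "(\<Sum>j\<in>?V - {i}. L j) = (\<Sum>j\<in>?V. L j) - L i" using i by (subst (2) sum.remove[of _ i]) auto
    finally show ?thesis by (auto simp: L_def algebra_simps split: if_splits)
  qed
  have "(\<Sum>i\<in>?V. \<Sum>j\<in>?V - {i}. drift_term p ?w G i j) \<le> (\<Sum>i\<in>?V. (if in_tree G i then real (?s i) else 0) - L i * (\<Sum>j\<in>?V. L j))"
    by (rule sum_mono) (rule row)
  also have "\<dots> = tree_sum n real G - (\<Sum>i\<in>?V. L i)\<^sup>2"
    by (simp add: sum_subtractf tree_sum_def power2_eq_square sum_distrib_right)
  finally show ?thesis unfolding L_sum .
qed

text \<open>The constant \<open>1 / K\<close> is a correction. In \<open>drift_large\<close> each
  pair inside a tree is estimated by 1, and the total \<open>tree_sum n real G\<close> has no bound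
  linear in n. Adding the number of unfrozen vertices divided by K yields a drift of at most
  \<open>- a * (a - 1) / K\<close> per vertex in a tree of size a, which absorbs the sizes above K +
  1.\<close>

definition large_potential :: "nat \<Rightarrow> nat \<Rightarrow> multigraph \<Rightarrow> real" where
  "large_potential n K = tree_sum n (\<lambda>a. 1 / real (max K a) + 1 / real K)"

lemma drift_term_add_weights: "drift_term p (\<lambda>a. w a + c) G i j = drift_term p w G i j + c * drift_term p (\<lambda>_. 1) G i j"
  by (simp add: drift_term_def tree_weight_def algebra_simps)

lemma expectation_large_potential:
  assumes n: "2 \<le> n" and p: "0 \<le> p" "p \<le> 1" and wf: "wf_state n G" and K: "1 \<le> K"
  shows "measure_pmf.expectation (frozen_step p n G) (large_potential n K) \<le> large_potential n K G
    - ((tree_sum n (\<lambda>a. of_bool (K \<le> a)) G)\<^sup>2 - real n * (real K + 1)) / (real n * (real n - 1))"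
proof -
  have a: "real a \<le> (real K + 1) + 1 / real K * (real a * (real a - 1))" for a
  proof (cases "a \<le> K + 1")
    case True
    have "0 \<le> 1 / real K * (real a * (real a - 1))" by (cases a) auto
    then show ?thesis using True by linarith
  next
    case False
    then have "real a * real K \<le> real a * (real a - 1)" by (intro mult_left_mono) auto
    then have "real a \<le> 1 / real K * (real a * (real a - 1))" using K by (simp add: field_simps)
    then show ?thesis by linarith
  qed
  have "tree_sum n real G \<le> tree_sum n (\<lambda>a. (real K + 1) + 1 / real K * (real a * (real a - 1))) G"
    by (rule tree_sum_mono) (rule a)
  also have "\<dots> = tree_sum n (\<lambda>a. real K + 1) G + 1 / real K * tree_sum n (\<lambda>a. real a * (real a - 1)) G"
    by (simp only: tree_sum_add_weights tree_sum_scale)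
  also have "\<dots> \<le> real n * (real K + 1) + 1 / real K * tree_sum n (\<lambda>a. real a * (real a - 1)) G"
    by (intro add_right_mono tree_sum_le) auto
  finally have 1: "tree_sum n real G \<le> real n * (real K + 1) + 1 / real K * tree_sum n (\<lambda>a. real a * (real a - 1)) G" .
  have "(\<Sum>i\<in>{1..n}. \<Sum>j\<in>{1..n} - {i}. drift_term p (\<lambda>a. 1 / real (max K a) + 1 / real K) G i j)
    = (\<Sum>i\<in>{1..n}. \<Sum>j\<in>{1..n} - {i}. drift_term p (\<lambda>a. 1 / real (max K a)) G i j)
    + 1 / real K * (\<Sum>i\<in>{1..n}. \<Sum>j\<in>{1..n} - {i}. drift_term p (\<lambda>_. 1) G i j)"
    unfolding drift_term_add_weights sum.distrib sum_distrib_left ..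
  also have "\<dots> \<le> tree_sum n real G - (tree_sum n (\<lambda>a. of_bool (K \<le> a)) G)\<^sup>2
    + 1 / real K * (- tree_sum n (\<lambda>a. real a * (real a - 1)) G)"
    by (intro add_mono mult_left_mono drift_large drift_trees wf p K) auto
  also have "\<dots> \<le> - ((tree_sum n (\<lambda>a. of_bool (K \<le> a)) G)\<^sup>2 - real n * (real K + 1))"
    using 1 by simp
  finally have "(\<Sum>i\<in>{1..n}. \<Sum>j\<in>{1..n} - {i}. drift_term p (\<lambda>a. 1 / real (max K a) + 1 / real K) G i j) / (real n * (real n - 1))
     \<le> - ((tree_sum n (\<lambda>a. of_bool (K \<le> a)) G)\<^sup>2 - real n * (real K + 1)) / (real n * (real n - 1))"
    using n by (intro divide_right_mono) auto
  then show ?thesis unfolding large_potential_def expectation_tree_sum[OF n p wf] minus_divide_left[symmetric] by linarith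
qed

lemma size_count_step:
  assumes n: "2 \<le> n" and wf: "wf_state n G" and G': "G' \<in> set_pmf (frozen_step p n G)"
  shows "\<bar>size_count n k G' - size_count n k G\<bar> \<le> 2 * real k"
  using n G'
proof (rule set_frozen_step)
  fix i j assume e: "(i, j) \<in> possible_edges n" and nf: "\<not> (frozen G i \<and> frozen G j)" and [simp]: "G' = add_mset (i, j) G"
  have "0 \<le> tree_weight (\<lambda>a. of_bool (a = k)) G i \<and> tree_weight (\<lambda>a. of_bool (a = k)) G i \<le> real k" for i
    by (simp add: tree_weight_def)
  from this[of i] this[of j]
  show ?thesis using possible_edges_mem[OF e] tree_sum_add[OF wf _ _ nf, of "\<lambda>a. of_bool (a = k)"] by auto
qed auto

section \<open>Exchangeability and the law of the history\<close>

text \<open>\<open>min\<close> and \<open>max\<close> restore the convention that an edge is stored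
  with its smaller endpoint first.\<close>

definition relabel_edge :: "(nat \<Rightarrow> nat) \<Rightarrow> nat \<times> nat \<Rightarrow> nat \<times> nat" where
  "relabel_edge f = (\<lambda>(i, j). (min (f i) (f j), max (f i) (f j)))"

definition relabel :: "(nat \<Rightarrow> nat) \<Rightarrow> multigraph \<Rightarrow> multigraph" where
  "relabel f = image_mset (relabel_edge f)"

lemma component_relabel:
  assumes "inj f" shows "component (relabel f G) (f v) = f ` component G v"
proof
  show "component (relabel f G) (f v) \<subseteq> f ` component G v"
  proof (rule component_least)
    fix x y assume "(x, y) \<in># relabel f G"
    then obtain i j where e: "(i, j) \<in># G" "x = min (f i) (f j)" "y = max (f i) (f j)"
      by (auto simp: relabel_def relabel_edge_def)
    have "f i \<in> f ` component G v \<longleftrightarrow> f j \<in> f ` component G v"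
      using component_closed[OF e(1), of v] by (simp add: inj_image_mem_iff[OF assms])
    then show "x \<in> f ` component G v \<longleftrightarrow> y \<in> f ` component G v" using e(2,3) by (auto simp: min_def max_def)
  qed simp
  have "component G v \<subseteq> f -` component (relabel f G) (f v)"
  proof (rule component_least)
    fix i j assume e: "(i, j) \<in># G"
    then have "(min (f i) (f j), max (f i) (f j)) \<in># relabel f G"
      by (force simp: relabel_def relabel_edge_def)
    from component_closed[OF this, of "f v"]
    show "i \<in> f -` component (relabel f G) (f v) \<longleftrightarrow> j \<in> f -` component (relabel f G) (f v)"
      by (auto simp: min_def max_def split: if_splits)
  qed simp
  then show "f ` component G v \<subseteq> component (relabel f G) (f v)" by auto
qed

lemma size_filter_image_mset: "size (filter_mset P (image_mset f M)) = size (filter_mset (\<lambda>x. P (f x)) M)"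
  by (induction M) auto

lemma size_component_edges_relabel:
  assumes "inj f" shows "size (component_edges (relabel f G) (f v)) = size (component_edges G v)"
proof -
  have "(case relabel_edge f e of (i, j) \<Rightarrow> i \<in> f ` component G v \<and> j \<in> f ` component G v)
    = (case e of (i, j) \<Rightarrow> i \<in> component G v \<and> j \<in> component G v)" for e
    by (auto simp: relabel_edge_def inj_image_mem_iff[OF assms] min_def max_def split: prod.splits)
  then show ?thesis unfolding component_edges_def component_relabel[OF assms]
    unfolding relabel_def size_filter_image_mset by simp
qed

lemma status_relabel:
  assumes "inj f"
  shows "frozen (relabel f G) (f v) = frozen G v" "in_tree (relabel f G) (f v) = in_tree G v"
proof -
  have "card (f ` component G v) = card (component G v)"
    using assms by (intro card_image) (auto intro: inj_on_subset)
  then show "frozen (relabel f G) (f v) = frozen G v" "in_tree (relabel f G) (f v) = in_tree G v"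
    by (simp_all add: frozen_def in_tree_def component_relabel size_component_edges_relabel assms)
qed

lemma bij_betw_relabel_edge:
  assumes inv: "\<And>x. f (f x) = x" and im: "\<And>x. x \<in> {1..n} \<Longrightarrow> f x \<in> {1..n}"
  shows "bij_betw (relabel_edge f) (possible_edges n) (possible_edges n)"
proof (rule bij_betwI[where g = "relabel_edge f"])
  have ne: "f i \<noteq> f j" if "i \<noteq> j" for i j using inv that by metis
  show maps: "relabel_edge f \<in> possible_edges n \<rightarrow> possible_edges n"
  proof clarify
    fix i j assume e: "(i, j) \<in> possible_edges n"
    then have "f i \<in> {1..n}" "f j \<in> {1..n}" "f i \<noteq> f j" using possible_edges_mem[OF e] im ne by auto
    then show "relabel_edge f (i, j) \<in> possible_edges n"
      by (auto simp: relabel_edge_def possible_edges_def min_def max_def)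
  qed
  then show "relabel_edge f \<in> possible_edges n \<rightarrow> possible_edges n" .
  show "relabel_edge f (relabel_edge f e) = e" if "e \<in> possible_edges n" for e
    using that possible_edges_mem[of "fst e" "snd e" n] by (cases e) (auto simp: relabel_edge_def min_def max_def inv)
  then show "relabel_edge f (relabel_edge f e) = e" if "e \<in> possible_edges n" for e
    using that by blast
qed

text \<open>Involutions suffice, because two vertices are compared by a transposition; such a map is
  its own inverse, which makes the bijection on edges immediate.\<close>

lemma map_relabel_frozen_step:
  assumes n: "2 \<le> n" and inv: "\<And>x. f (f x) = x" and im: "\<And>x. x \<in> {1..n} \<Longrightarrow> f x \<in> {1..n}"
  shows "map_pmf (relabel f) (frozen_step p n G) = frozen_step p n (relabel f G)"
proof -
  define s where "s H = (\<lambda>(i, j). if in_tree H i \<and> in_tree H j then return_pmf (add_mset (i, j) H)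
       else if frozen H i \<and> frozen H j then return_pmf H
       else map_pmf (\<lambda>b. if b then add_mset (i, j) H else H) (bernoulli_pmf p))" for H
  have inj: "inj f" using inv by (metis injI)
  have st: "map_pmf (relabel f) (s G e) = s (relabel f G) (relabel_edge f e)" for e
  proof (cases e)
    case (Pair i j)
    have add: "add_mset (relabel_edge f (i, j)) (relabel f G) = relabel f (add_mset (i, j) G)"
      by (simp add: relabel_def)
    note [simp] = status_relabel[OF inj]
    show ?thesis
      unfolding Pair s_def using add
      by (cases "f i \<le> f j") (auto simp: relabel_edge_def map_pmf_comp min_def max_def intro!: map_pmf_cong)
  qed
  have "map_pmf (relabel f) (frozen_step p n G) = bind_pmf (pmf_of_set (possible_edges n)) (\<lambda>e. s (relabel f G) (relabel_edge f e))"
    by (simp add: frozen_step_def s_def[symmetric] map_bind_pmf st)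
  also have "\<dots> = bind_pmf (map_pmf (relabel_edge f) (pmf_of_set (possible_edges n))) (s (relabel f G))"
    by (simp add: bind_map_pmf)
  also have "map_pmf (relabel_edge f) (pmf_of_set (possible_edges n)) = pmf_of_set (possible_edges n)"
    by (rule map_pmf_of_set_bij_betw[OF bij_betw_relabel_edge[OF inv im]]) (simp_all add: possible_edges_nonempty n)
  finally show ?thesis by (simp add: frozen_step_def s_def[symmetric])
qed

section \<open>Law of the history\<close>

primrec path_law :: "real \<Rightarrow> nat \<Rightarrow> nat \<Rightarrow> multigraph list pmf" where
  "path_law p n 0 = return_pmf [{#}]"
| "path_law p n (Suc m) = bind_pmf (path_law p n m) (\<lambda>hs. map_pmf (\<lambda>G. G # hs) (frozen_step p n (hd hs)))"

lemma map_hd_path_law_Suc: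
  "map_pmf hd (path_law p n (Suc m)) = bind_pmf (map_pmf hd (path_law p n m)) (frozen_step p n)"
  by (simp add: map_bind_pmf bind_map_pmf map_pmf_comp)

lemma map_relabel_path_law:
  assumes n: "2 \<le> n" and inv: "\<And>x. f (f x) = x" and im: "\<And>x. x \<in> {1..n} \<Longrightarrow> f x \<in> {1..n}"
  shows "map_pmf (relabel f) (map_pmf hd (path_law p n m)) = map_pmf hd (path_law p n m)"
proof (induction m)
  case 0
  show ?case by (simp add: relabel_def)
next
  case (Suc m)
  have step: "map_pmf (relabel f) (frozen_step p n G) = frozen_step p n (relabel f G)" for G
    by (rule map_relabel_frozen_step[OF n inv im])
  have "map_pmf (relabel f) (map_pmf hd (path_law p n (Suc m))) =
    bind_pmf (map_pmf (relabel f) (map_pmf hd (path_law p n m))) (frozen_step p n)"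
    unfolding map_hd_path_law_Suc by (simp add: map_bind_pmf bind_map_pmf step)
  then show ?case unfolding Suc.IH map_hd_path_law_Suc .
qed

lemma frozen_prob_exchangeable:
  assumes n: "2 \<le> n" and v: "v \<in> {1..n}" "u \<in> {1..n}"
  shows "measure_pmf.prob (path_law p n m) {hs. frozen (hd hs) v} = measure_pmf.prob (path_law p n m) {hs. frozen (hd hs) u}"
proof -
  let ?f = "Transposition.transpose v u"
  let ?L = "map_pmf hd (path_law p n m)"
  have "measure_pmf.prob ?L {G. frozen G v} = measure_pmf.prob (map_pmf (relabel ?f) ?L) {G. frozen G v}"
    by (subst map_relabel_path_law[OF n]) (use v in \<open>auto simp: Transposition.transpose_def\<close>)
  also have "\<dots> = measure_pmf.prob ?L {G. frozen G u}"
  proof -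
    have "frozen (relabel ?f G) v = frozen G u" for G
      using status_relabel(1)[of ?f G u] by simp
    then show ?thesis by (simp add: vimage_def)
  qed
  finally show ?thesis by (simp add: vimage_def)
qed

lemma finite_set_path_law: "2 \<le> n \<Longrightarrow> finite (set_pmf (path_law p n m))"
  by (induction m) (auto simp: finite_set_frozen_step)

text \<open>Freezing is irreversible, so being frozen at some time up to m is a property of the
  present graph. This is what allows the distribution function of the freezing time to be read off
  from one-time marginals.\<close>

lemma path_law_support:
  assumes n: "2 \<le> n" and "hs \<in> set_pmf (path_law p n m)"
  shows "length hs = Suc m \<and> wf_state n (hd hs) \<and> (\<forall>v\<in>{1..n}. (\<exists>G\<in>set hs. frozen G v) \<longleftrightarrow> frozen (hd hs) v)"
  using assms(2)
proof (induction m arbitrary: hs)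
  case 0
  then show ?case by (simp add: wf_state_empty)
next
  case (Suc m)
  then obtain hs' G where hs: "hs' \<in> set_pmf (path_law p n m)" "G \<in> set_pmf (frozen_step p n (hd hs'))" "hs = G # hs'"
    by auto
  note IH = Suc.IH[OF hs(1)]
  show ?case using IH wf_state_step[OF n _ hs(2)] by (auto simp: hs(3))
qed

lemma expectation_path_law_Suc:
  fixes h :: "multigraph list \<Rightarrow> real"
  assumes "2 \<le> n"
  shows "measure_pmf.expectation (path_law p n (Suc m)) h =
    measure_pmf.expectation (path_law p n m) (\<lambda>hs. measure_pmf.expectation (frozen_step p n (hd hs)) (\<lambda>G. h (G # hs)))"
  using assms by (simp add: expectation_bind_finite finite_set_path_law finite_set_frozen_step)

lemma integrable_path_law:
  fixes h :: "multigraph list \<Rightarrow> real"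
  assumes "2 \<le> n" shows "integrable (measure_pmf (path_law p n m)) h"
  by (rule integrable_measure_pmf_finite) (rule finite_set_path_law[OF assms])

lemma integrable_frozen_step:
  fixes h :: "multigraph \<Rightarrow> real"
  assumes "2 \<le> n" shows "integrable (measure_pmf (frozen_step p n G)) h"
  by (rule integrable_measure_pmf_finite) (rule finite_set_frozen_step[OF assms])

lemma expectation_frozen_count:
  assumes n: "2 \<le> n"
  shows "measure_pmf.expectation (path_law p n m) (\<lambda>hs. frozen_count n (hd hs)) =
    real n * measure_pmf.prob (path_law p n m) {hs. frozen (hd hs) 1}"
proof -
  have "measure_pmf.expectation (path_law p n m) (\<lambda>hs. frozen_count n (hd hs)) =
    (\<Sum>v\<in>{1..n}. measure_pmf.expectation (path_law p n m) (indicator {hs. frozen (hd hs) v}))"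
    unfolding frozen_count_def
    by (subst Bochner_Integration.integral_sum[symmetric]) (auto simp: integrable_path_law[OF n] indicator_def)
  also have "\<dots> = (\<Sum>v\<in>{1..n}. measure_pmf.prob (path_law p n m) {hs. frozen (hd hs) 1})"
    using n by (intro sum.cong) (auto intro: frozen_prob_exchangeable)
  finally show ?thesis by simp
qed

section \<open>The limit function\<close>

text \<open>The derivative is returned multiplied by z, with coefficients \<open>n * c n\<close>,
  because the differential equations for f and for the tree function are obtained by comparing
  coefficients in that form.\<close>

lemma power_series_deriv:
  fixes c :: "nat \<Rightarrow> real"
  assumes sm: "summable (\<lambda>n. c n * K ^ n)" and z: "\<bar>z\<bar> < K"
  obtains D where "((\<lambda>z. \<Sum>n. c n * z ^ n) has_real_derivative D) (at z)"
    "(\<lambda>n. real n * c n * z ^ n) sums (z * D)"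
proof -
  let ?D = "\<Sum>n. diffs c n * z ^ n"
  have "norm z < norm K" using z by simp
  then have d: "((\<lambda>z. \<Sum>n. c n * z ^ n) has_real_derivative ?D) (at z)" by (rule termdiffs_strong[OF sm])
  have "summable (\<lambda>n. diffs c n * z ^ n)"
  proof (rule termdiff_converges[where K = K])
    show "norm z < K" using z by simp
    fix x :: real assume "norm x < K"
    then show "summable (\<lambda>n. c n * x ^ n)" using powser_inside[OF sm, of x] by simp
  qed
  then have "(\<lambda>n. z * (diffs c n * z ^ n)) sums (z * ?D)" by (intro sums_mult summable_sums)
  then have "(\<lambda>n. real (Suc n) * c (Suc n) * z ^ Suc n) sums (z * ?D)"
    by (simp add: diffs_def mult_ac)
  then have "(\<lambda>n. real n * c n * z ^ n) sums (z * ?D)"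
    using sums_Suc_iff[of "\<lambda>n. real n * c n * z ^ n" "z * ?D"] by simp
  with d that show thesis by blast
qed

section \<open>The series f and its inverse\<close>

context
  fixes p :: real
  assumes p: "0 < p" "p \<le> 1"
begin

lemma f_fun_summable: "\<bar>s\<bar> < 1 \<Longrightarrow> summable (\<lambda>j. (1 / (1 + p * real j)) * s ^ j)"
proof (rule summable_comparison_test[of _ "\<lambda>j. \<bar>s\<bar> ^ j"])
  show "\<exists>N. \<forall>n\<ge>N. norm (1 / (1 + p * real n) * s ^ n) \<le> \<bar>s\<bar> ^ n"
  proof (intro exI allI impI)
    fix n :: nat
    have "0 \<le> p * real n" using p by simp
    then have "1 / (1 + p * real n) \<le> 1" by (simp add: field_simps)
    moreover have "0 \<le> 1 / (1 + p * real n)" using p by simp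
    ultimately have "1 / (1 + p * real n) * \<bar>s\<bar> ^ n \<le> 1 * \<bar>s\<bar> ^ n" by (intro mult_right_mono) auto
    then show "norm (1 / (1 + p * real n) * s ^ n) \<le> \<bar>s\<bar> ^ n" using p
      by (simp add: norm_mult norm_divide power_abs abs_of_nonneg)
  qed
qed (simp add: summable_geometric)

lemma f_fun_eq: "f_fun p s = 1 / 2 * (\<Sum>j. (1 / (1 + p * real j)) * s ^ j)"
  by (simp add: f_fun_def)

lemma f_fun_0: "f_fun p 0 = 1 / 2"
  using powser_zero[of "\<lambda>j. 1 / (1 + p * real j)"] by (simp only: f_fun_eq) simp

text \<open>Termwise, \<open>(1 + p j) / (1 + p j) = 1\<close>: this gives the differential equation.\<close>

lemma f_fun_deriv:
  assumes s: "0 \<le> s" "s < 1"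
  obtains D where "(f_fun p has_real_derivative D) (at s)" "2 * p * s * D + 2 * f_fun p s = 1 / (1 - s)" "0 < D"
proof -
  define K where "K = (s + 1) / 2"
  have K: "\<bar>s\<bar> < K" "\<bar>K\<bar> < 1" using s by (auto simp: K_def)
  let ?c = "\<lambda>j. 1 / (1 + p * real j)"
  obtain D where D: "((\<lambda>z. \<Sum>n. ?c n * z ^ n) has_real_derivative D) (at s)"
    "(\<lambda>n. real n * ?c n * s ^ n) sums (s * D)"
    using power_series_deriv[OF f_fun_summable[OF K(2)] K(1)] by blast
  have "((\<lambda>z. 1 / 2 * (\<Sum>n. ?c n * z ^ n)) has_real_derivative 1 / 2 * D) (at s)"
    by (rule DERIV_cmult[OF D(1)])
  then have 1: "(f_fun p has_real_derivative D / 2) (at s)" by (simp add: f_fun_eq[abs_def])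
  have "(\<lambda>n. ?c n * s ^ n) sums (2 * f_fun p s)"
    using f_fun_summable[of s] s by (simp add: f_fun_eq summable_sums)
  then have "(\<lambda>n. p * (real n * ?c n * s ^ n) + ?c n * s ^ n) sums (p * (s * D) + 2 * f_fun p s)"
    by (intro sums_add sums_mult D(2))
  moreover have "p * (real n * ?c n * s ^ n) + ?c n * s ^ n = s ^ n" for n
  proof -
    have "1 + p * real n > 0" using p by (simp add: add_pos_nonneg)
    then have "(p * real n + 1) * ?c n = 1" by (simp add: add.commute)
    moreover have "p * (real n * c * x) + c * x = ((p * real n + 1) * c) * x" for c x by (simp add: algebra_simps)
    ultimately show ?thesis by (simp only: mult_1)
  qed
  ultimately have "(\<lambda>n. s ^ n) sums (p * (s * D) + 2 * f_fun p s)" by simp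
  then have 2: "p * (s * D) + 2 * f_fun p s = 1 / (1 - s)" using geometric_sums[of s] s sums_unique2 by fastforce
  have 3: "0 < D"
  proof -
    have "norm s < norm K" using K by simp
    then have D': "((\<lambda>z. \<Sum>n. ?c n * z ^ n) has_real_derivative (\<Sum>n. diffs ?c n * s ^ n)) (at s)"
      by (rule termdiffs_strong[OF f_fun_summable[OF K(2)]])
    have sm: "summable (\<lambda>n. diffs ?c n * s ^ n)"
      by (rule termdiff_converges[where K = 1]) (use s f_fun_summable in auto)
    have "(\<Sum>n\<in>{0}. diffs ?c n * s ^ n) \<le> (\<Sum>n. diffs ?c n * s ^ n)"
      by (rule sum_le_suminf[OF sm]) (use p s in \<open>auto simp: diffs_def\<close>)
    moreover have "diffs ?c 0 > 0" using p by (simp add: diffs_def)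
    ultimately show ?thesis using DERIV_unique[OF D(1) D'] by simp
  qed
  show thesis using that[OF 1] 2 3 by simp
qed

lemma f_fun_cont: "continuous_on {0..<1} (f_fun p)"
proof (rule continuous_at_imp_continuous_on, clarify)
  fix s :: real assume "s \<in> {0..<1}"
  then show "isCont (f_fun p) s" using f_fun_deriv[of s] by (metis DERIV_isCont atLeastLessThan_iff)
qed

lemma f_fun_strict_mono:
  assumes "0 \<le> a" "a < b" "b < 1" shows "f_fun p a < f_fun p b"
proof (rule DERIV_pos_imp_increasing[OF assms(2)])
  fix x :: real assume "a \<le> x" "x \<le> b"
  with assms show "\<exists>y. (f_fun p has_real_derivative y) (at x) \<and> 0 < y" using f_fun_deriv[of x] by (metis dual_order.trans le_less_trans)
qed

lemma f_fun_inj: "inj_on (f_fun p) {0..<1}"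
  by (rule linorder_inj_onI) (use f_fun_strict_mono in \<open>force+\<close>)

text \<open>This makes f unbounded, which surjectivity needs. As p \<le> 1, the coefficients of 2 f
  dominate those of \<open>- ln (1 - s) / s\<close>; here it is read off from the differential
  equation, which turns the derivative of \<open>?h\<close> into
  \<open>2 * (1 - p) * x * D\<close>.\<close>

lemma f_fun_ge_ln:
  assumes s: "0 \<le> s" "s < 1" shows "- ln (1 - s) \<le> 2 * f_fun p s"
proof -
  let ?h = "\<lambda>s. 2 * s * f_fun p s + ln (1 - s)"
  have "?h 0 \<le> ?h s"
  proof (rule DERIV_nonneg_imp_nondecreasing[OF s(1)])
    fix x assume x: "0 \<le> x" "x \<le> s"
    then have x1: "x < 1" using s by simp
    obtain D where D: "(f_fun p has_real_derivative D) (at x)" "2 * p * x * D + 2 * f_fun p x = 1 / (1 - x)" "0 < D"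
      using f_fun_deriv[OF x(1) x1] .
    have "(?h has_real_derivative (2 * f_fun p x + 2 * x * D - 1 / (1 - x))) (at x)"
      using x1 by (auto intro!: derivative_eq_intros D(1) simp: field_simps)
    moreover have "p * (2 * x * D) \<le> 1 * (2 * x * D)" using p x D(3) by (intro mult_right_mono) auto
    then have "0 \<le> 2 * f_fun p x + 2 * x * D - 1 / (1 - x)" using D(2) by (simp add: mult_ac)
    ultimately show "\<exists>y. (?h has_real_derivative y) (at x) \<and> 0 \<le> y" by blast
  qed
  then have "- ln (1 - s) \<le> s * (2 * f_fun p s)" by simp
  also have "0 \<le> f_fun p s" using f_fun_strict_mono[of 0 s] s f_fun_0 by (cases "s = 0") auto
  then have "s * (2 * f_fun p s) \<le> 1 * (2 * f_fun p s)" using s by (intro mult_right_mono) auto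
  finally show ?thesis by simp
qed

lemma f_fun_surj:
  assumes "1 / 2 \<le> t" shows "\<exists>s\<in>{0..<1}. f_fun p s = t"
proof -
  \<comment> \<open>Solves \<open>- ln (1 - b) = 2 * t\<close>, so that f at b is at least
    t.\<close>
  define b where "b = 1 - exp (- 2 * t)"
  have b: "0 \<le> b" "b < 1" using assms by (auto simp: b_def)
  have "- ln (1 - b) \<le> 2 * f_fun p b" by (rule f_fun_ge_ln[OF b])
  then have "t \<le> f_fun p b" by (simp add: b_def)
  moreover have "continuous_on {0..b} (f_fun p)" by (rule continuous_on_subset[OF f_fun_cont]) (use b in auto)
  ultimately show ?thesis using IVT'[of "f_fun p" 0 t b] assms b f_fun_0 by force
qed

lemma g_fun_inverse:
  assumes "1 / 2 \<le> t" shows "f_fun p (g_fun p t) = t" "0 \<le> g_fun p t" "g_fun p t < 1"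
proof -
  have *: "f_fun p (g_fun p t) = t \<and> g_fun p t \<in> {0..<1}"
  proof (cases "t = 1 / 2")
    case True
    then show ?thesis by (simp add: g_fun_def f_fun_0)
  next
    case False
    obtain s where s: "s \<in> {0..<1}" "f_fun p s = t" using f_fun_surj[OF assms] by blast
    then have "g_fun p t = s" using False assms the_inv_into_f_f[OF f_fun_inj s(1)] by (simp add: g_fun_def)
    then show ?thesis using s by simp
  qed
  then show "f_fun p (g_fun p t) = t" "0 \<le> g_fun p t" "g_fun p t < 1" by auto
qed

lemma g_fun_early: "t \<le> 1 / 2 \<Longrightarrow> g_fun p t = 0"
  by (simp add: g_fun_def)

lemma g_fun_bounds: "0 \<le> g_fun p t" "g_fun p t < 1"
  using g_fun_inverse[of t] g_fun_early[of t] by (cases "t \<le> 1 / 2"; simp)+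

lemma g_fun_f_fun: "s \<in> {0..<1} \<Longrightarrow> g_fun p (f_fun p s) = s"
proof -
  assume s: "s \<in> {0..<1}"
  have "1 / 2 \<le> f_fun p s" using f_fun_strict_mono[of 0 s] s f_fun_0 by (cases "s = 0") auto
  from g_fun_inverse[OF this] show ?thesis using inj_onD[OF f_fun_inj] s by (metis atLeastLessThan_iff)
qed

lemma g_fun_mono: "mono (g_fun p)"
proof
  fix a b :: real assume ab: "a \<le> b"
  show "g_fun p a \<le> g_fun p b"
  proof (cases "a \<le> 1 / 2")
    case True
    then show ?thesis using g_fun_bounds by (simp add: g_fun_early)
  next
    case False
    show ?thesis
    proof (rule ccontr)
      assume "\<not> ?thesis"
      then have "f_fun p (g_fun p b) < f_fun p (g_fun p a)"
        using g_fun_bounds by (intro f_fun_strict_mono) auto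
      then show False using g_fun_inverse(1)[of a] g_fun_inverse(1)[of b] ab False by simp
    qed
  qed
qed

text \<open>The continuity theorem for inverses needs a compact domain. So f is restricted to
  [0, c], whose image reaches up to some b > t, and the resulting interval [1/2, b] is glued to the
  closed half-line on which the function is 0.\<close>

lemma g_fun_cont: "isCont (g_fun p) t"
proof -
  define b where "b = max t 1 + 1"
  define c where "c = g_fun p b"
  have c: "0 \<le> c" "c < 1" "f_fun p c = b" using g_fun_inverse[of b] by (auto simp: b_def c_def)
  have cont: "continuous_on {0..c} (f_fun p)" by (rule continuous_on_subset[OF f_fun_cont]) (use c in auto)
  have "continuous_on (f_fun p ` {0..c}) (g_fun p)"
    by (rule continuous_on_inv[OF cont]) (use c g_fun_f_fun in auto)
  moreover have "{1 / 2..b} \<subseteq> f_fun p ` {0..c}"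
  proof
    fix y assume "y \<in> {1 / 2..b}"
    then show "y \<in> f_fun p ` {0..c}" using IVT'[of "f_fun p" 0 y c] c cont f_fun_0 by force
  qed
  ultimately have "continuous_on {1 / 2..b} (g_fun p)" by (rule continuous_on_subset)
  moreover have "continuous_on {..1 / 2} (g_fun p)"
    by (rule continuous_on_eq[of _ "\<lambda>_. 0"]) (auto simp: g_fun_early)
  ultimately have "continuous_on ({1 / 2..b} \<union> {..1 / 2}) (g_fun p)"
    by (intro continuous_on_closed_Un) auto
  then have "continuous_on {..<b} (g_fun p)" by (rule continuous_on_subset) (auto simp: b_def)
  then show ?thesis by (rule continuous_on_interior) (auto simp: b_def interior_open)
qed

lemma g_fun_continuous_on: "continuous_on S (g_fun p)"
  by (simp add: continuous_at_imp_continuous_on g_fun_cont)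

lemma g_fun_at_top: "(g_fun p \<longlongrightarrow> 1) at_top"
proof (rule order_tendstoI)
  fix a :: real assume a: "a < 1"
  define s where "s = max a 0"
  have s: "s \<in> {0..<1}" using a by (auto simp: s_def)
  then have s2: "(s + 1) / 2 \<in> {0..<1}" by auto
  have "a < g_fun p x" if "f_fun p ((s + 1) / 2) \<le> x" for x
    using monoD[OF g_fun_mono that] g_fun_f_fun[OF s2] s by (auto simp: s_def split: if_splits)
  then show "eventually (\<lambda>x. a < g_fun p x) at_top" by (meson eventually_at_top_linorderI)
next
  fix a :: real assume "1 < a"
  then show "eventually (\<lambda>x. g_fun p x < a) at_top" using g_fun_bounds(2) by (auto intro: always_eventually less_trans)
qed

section \<open>The integral of the limit function and the equation it satisfies\<close>

definition limit_integral :: "real \<Rightarrow> real" where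
  "limit_integral t = integral {0..t} (g_fun p)"

lemma limit_integral_increment:
  assumes "0 \<le> a" "a \<le> b"
  shows "g_fun p a * (b - a) \<le> limit_integral b - limit_integral a"
    "limit_integral b - limit_integral a \<le> g_fun p b * (b - a)"
proof -
  have i: "g_fun p integrable_on {c..d}" for c d by (rule integrable_continuous_interval) (rule g_fun_continuous_on)
  have "limit_integral b = limit_integral a + integral {a..b} (g_fun p)"
    using Henstock_Kurzweil_Integration.integral_combine[OF assms i] by (simp add: limit_integral_def)
  moreover have "integral {a..b} (\<lambda>_. g_fun p a) \<le> integral {a..b} (g_fun p)"
    by (rule integral_le) (auto intro: i monoD[OF g_fun_mono])
  moreover have "integral {a..b} (g_fun p) \<le> integral {a..b} (\<lambda>_. g_fun p b)"
    by (rule integral_le) (auto intro: i monoD[OF g_fun_mono])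
  ultimately show "g_fun p a * (b - a) \<le> limit_integral b - limit_integral a"
    "limit_integral b - limit_integral a \<le> g_fun p b * (b - a)" using assms by (auto simp: mult.commute)
qed

lemma limit_integral_0: "limit_integral 0 = 0" by (simp add: limit_integral_def)

lemma limit_integral_early: "0 \<le> t \<Longrightarrow> t \<le> 1 / 2 \<Longrightarrow> limit_integral t = 0"
  using limit_integral_increment[of 0 t] limit_integral_0 g_fun_early[of t] g_fun_early[of 0] by simp

lemma limit_integral_bounds: assumes "0 \<le> t" shows "0 \<le> limit_integral t" "limit_integral t \<le> t"
proof -
  have "g_fun p t * t \<le> 1 * t" using g_fun_bounds[of t] assms by (intro mult_right_mono) auto
  moreover have "0 \<le> g_fun p 0 * t" using g_fun_bounds[of 0] assms by simp
  ultimately show "0 \<le> limit_integral t" "limit_integral t \<le> t"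
    using limit_integral_increment[of 0 t] assms limit_integral_0 by auto
qed

lemma limit_integral_deriv:
  assumes "0 < t" shows "(limit_integral has_real_derivative g_fun p t) (at t)"
proof -
  have "((\<lambda>x. integral {0..x} (g_fun p)) has_real_derivative g_fun p t) (at t within {0..t + 1})"
    by (rule integral_has_real_derivative) (use assms g_fun_continuous_on in auto)
  moreover have "at t within {0..t + 1} = at t" by (rule at_within_interior) (use assms in auto)
  ultimately show ?thesis by (simp add: limit_integral_def[abs_def])
qed

text \<open>Inverse function rule, with the differential equation of f read at s = g(t), where f(s)
  = t. Multiplied out, it needs no division by \<open>1 - 2 * t * (1 - g_fun p t)\<close>.\<close>

lemma g_fun_deriv:
  assumes t: "1 / 2 < t"
  obtains D where "(g_fun p has_real_derivative D) (at t)"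
    "(1 - 2 * t * (1 - g_fun p t)) * D = 2 * p * g_fun p t * (1 - g_fun p t)"
proof -
  let ?s = "g_fun p t"
  have s: "0 \<le> ?s" "?s < 1" "f_fun p ?s = t" using g_fun_inverse[of t] t by auto
  obtain E where E: "(f_fun p has_real_derivative E) (at ?s)" "2 * p * ?s * E + 2 * f_fun p ?s = 1 / (1 - ?s)" "0 < E"
    using f_fun_deriv[OF s(1,2)] .
  have d: "(g_fun p has_real_derivative inverse E) (at t)"
  proof (rule DERIV_inverse_function[where f = "f_fun p" and g = "g_fun p" and x = t and a = "1 / 2" and b = "t + 1", OF E(1)])
    show "f_fun p (g_fun p y) = y" if "1 / 2 < y" for y using that g_fun_inverse(1)[of y] by simp
  qed (use t E(3) g_fun_cont in auto)
  have "2 * p * ?s * E + 2 * t = 1 / (1 - ?s)" using E(2) unfolding s(3) .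
  then have "(2 * p * ?s * E + 2 * t) * (1 - ?s) = 1" using s by simp
  then have "1 - 2 * t * (1 - ?s) = 2 * p * ?s * (1 - ?s) * E" by (simp add: algebra_simps)
  then have "(1 - 2 * t * (1 - ?s)) * inverse E = 2 * p * ?s * (1 - ?s)" using E(3) by simp
  with d that show thesis by blast
qed

text \<open>\<open>2 * t * (1 - g_fun p t)\<close> is the parameter u at which the tree series will
  be evaluated, and \<open>tree_fps_eq\<close> is available only for u in [0, 1]. The upper bound
  follows by dropping the nonnegative derivative term from the differential equation of f.\<close>

lemma limit_subcritical:
  assumes "0 \<le> t" shows "0 \<le> 2 * t * (1 - g_fun p t)" "2 * t * (1 - g_fun p t) \<le> 1"
proof -
  show "0 \<le> 2 * t * (1 - g_fun p t)" using assms g_fun_bounds[of t] by simp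
  show "2 * t * (1 - g_fun p t) \<le> 1"
  proof (cases "t \<le> 1 / 2")
    case True
    then show ?thesis by (simp add: g_fun_early)
  next
    case False
    let ?s = "g_fun p t"
    have s: "0 \<le> ?s" "?s < 1" "f_fun p ?s = t" using g_fun_inverse[of t] False by auto
    obtain E where E: "2 * p * ?s * E + 2 * f_fun p ?s = 1 / (1 - ?s)" "0 < E"
      using f_fun_deriv[OF s(1,2)] .
    have "0 \<le> 2 * p * ?s * E" using p s E by simp
    then have "2 * t \<le> 1 / (1 - ?s)" using E(1) s(3) by linarith
    then show ?thesis using s by (simp add: field_simps)
  qed
qed

text \<open>With x = 1 - g(t) and u = 2 t x, the exponential factor of the limiting densities
  becomes \<open>x * exp (- u)\<close>, which is what makes them sum to x. Before 1/2 both sides are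
  \<open>exp (- 2 * t)\<close>; afterwards the logarithm of their quotient is constant by
  \<open>g_fun_deriv\<close>.\<close>

lemma limit_equation:
  assumes "0 \<le> t"
  shows "exp (- (2 * t - 2 * (1 - p) * limit_integral t)) = (1 - g_fun p t) * exp (- (2 * t * (1 - g_fun p t)))"
proof (cases "t \<le> 1 / 2")
  case True
  then show ?thesis using assms by (simp add: g_fun_early limit_integral_early)
next
  case False
  let ?H = "\<lambda>t. ln (1 - g_fun p t) - 2 * t * (1 - g_fun p t) + (2 * t - 2 * (1 - p) * limit_integral t)"
  \<comment> \<open>Derivatives are needed only in the open interval, so the corner of g at 1/2 does
    no harm.\<close>
  have "?H t = ?H (1 / 2)"
  proof (rule DERIV_isconst_end[where f = ?H])
    show "1 / 2 < t" using False by simp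
    show "continuous_on {1 / 2..t} ?H"
    proof (intro continuous_intros g_fun_continuous_on ballI)
      show "1 - g_fun p x \<noteq> 0" for x using g_fun_bounds(2)[of x] by simp
      show "continuous_on {1 / 2..t} limit_integral"
        by (rule continuous_at_imp_continuous_on) (auto intro!: DERIV_isCont limit_integral_deriv)
    qed
    fix x assume x: "1 / 2 < x" "x < t"
    let ?s = "g_fun p x"
    obtain D where D: "(g_fun p has_real_derivative D) (at x)" "(1 - 2 * x * (1 - ?s)) * D = 2 * p * ?s * (1 - ?s)"
      using g_fun_deriv[OF x(1)] .
    have s: "1 - ?s > 0" using g_fun_bounds[of x] by simp
    have "(?H has_real_derivative (- D / (1 - ?s) - (2 * (1 - ?s) + 2 * x * (- D)) + (2 - 2 * (1 - p) * ?s))) (at x)"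
      using s x by (auto intro!: derivative_eq_intros D(1) limit_integral_deriv simp: algebra_simps)
    moreover have "- D / (1 - ?s) - (2 * (1 - ?s) + 2 * x * (- D)) + (2 - 2 * (1 - p) * ?s)
      = (2 * p * ?s * (1 - ?s) - (1 - 2 * x * (1 - ?s)) * D) / (1 - ?s)"
      using s by (simp add: field_simps)
    ultimately show "(?H has_real_derivative 0) (at x)" using D(2) by simp
  qed
  also have "?H (1 / 2) = 0" by (simp add: g_fun_early limit_integral_early)
  finally have "- (2 * t - 2 * (1 - p) * limit_integral t) = ln (1 - g_fun p t) + - (2 * t * (1 - g_fun p t))" by simp
  then show ?thesis using g_fun_bounds(2)[of t] by (simp only: exp_add) simp
qed

end

section \<open>Smoluchowski's equation and the tree function\<close>

text \<open>The coefficients \<open>tree_coeff k = k ^ (k - 1) / k!\<close> of the tree function, given by the recursion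
  that comes from Smoluchowski's equation.\<close>

function tree_coeff :: "nat \<Rightarrow> real" where
  "tree_coeff k = (if k = 0 then 0 else if k = 1 then 1
     else real k / (2 * (real k - 1)) * (\<Sum>i\<in>{1..<k}. tree_coeff i * tree_coeff (k - i)))"
  by auto
termination by (relation "Wellfounded.measure id") auto

declare tree_coeff.simps [simp del]

lemma tree_coeff_0 [simp]: "tree_coeff 0 = 0" and tree_coeff_1 [simp]: "tree_coeff (Suc 0) = 1"
  by (simp_all add: tree_coeff.simps)

lemma tree_coeff_rec: "2 * (real k - 1) * tree_coeff k = real k * (\<Sum>i\<in>{1..<k}. tree_coeff i * tree_coeff (k - i))"
proof (cases "k \<le> 1")
  case True
  then have "k = 0 \<or> k = 1" by auto
  then show ?thesis by auto
next
  case False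
  then show ?thesis by (subst tree_coeff.simps) (simp add: field_simps)
qed

lemma tree_coeff_nonneg: "0 \<le> tree_coeff k"
proof (induction k rule: less_induct)
  case (less k)
  then show ?case
    by (subst tree_coeff.simps) (auto intro!: mult_nonneg_nonneg divide_nonneg_nonneg sum_nonneg)
qed

definition smol :: "nat \<Rightarrow> real \<Rightarrow> real" where
  "smol k s = tree_coeff k * (2 * s) ^ (k - 1)"

lemma smol_nonneg: "0 \<le> s \<Longrightarrow> 0 \<le> smol k s"
  by (simp add: smol_def tree_coeff_nonneg)

lemma smol_at_0: "smol k 0 = of_bool (k = 1)"
  by (cases "k = 0"; cases "k = 1") (auto simp: smol_def)

lemma smol_deriv:
  "(smol k has_real_derivative real k * (\<Sum>i\<in>{1..<k}. smol i s * smol (k - i) s)) (at s)"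
proof -
  have "(smol k has_real_derivative tree_coeff k * (real (k - 1) * (2 * s) ^ (k - 1 - 1) * 2)) (at s)"
  proof -
    have "((\<lambda>s. 2 * s) has_real_derivative 2) (at s)" by (auto intro!: derivative_eq_intros)
    from DERIV_cmult[OF DERIV_power[OF this, of "k - 1"], of "tree_coeff k"]
    show ?thesis unfolding smol_def[abs_def] by (simp add: mult_ac)
  qed
  also have "tree_coeff k * (real (k - 1) * (2 * s) ^ (k - 1 - 1) * 2) = real k * (\<Sum>i\<in>{1..<k}. smol i s * smol (k - i) s)"
  proof (cases "k \<le> 1")
    case True
    then show ?thesis by simp
  next
    case False
    have "(\<Sum>i\<in>{1..<k}. smol i s * smol (k - i) s) = (\<Sum>i\<in>{1..<k}. tree_coeff i * tree_coeff (k - i) * (2 * s) ^ (k - 2))"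
    proof (rule sum.cong[OF refl])
      fix i assume "i \<in> {1..<k}"
      then have e: "k - 2 = (i - 1) + (k - i - 1)" by auto
      show "smol i s * smol (k - i) s = tree_coeff i * tree_coeff (k - i) * (2 * s) ^ (k - 2)"
        unfolding e smol_def power_add by simp
    qed
    then have "real k * (\<Sum>i\<in>{1..<k}. smol i s * smol (k - i) s) =
      (2 * (real k - 1) * tree_coeff k) * (2 * s) ^ (k - 2)"
      unfolding tree_coeff_rec by (simp add: sum_distrib_right mult.assoc)
    moreover have "real (k - 1) = real k - 1" "k - 1 - 1 = k - 2" using False by auto
    ultimately show ?thesis by (simp only: mult_ac)
  qed
  finally show ?thesis .
qed

text \<open>The truncated sum of the solution of Smoluchowski's equation stays below \<open>1\<close>, because
  truncation only discards gain terms.\<close>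

lemma smol_sum_le_1:
  assumes "0 \<le> s" shows "(\<Sum>k\<in>{1..K}. smol k s * exp (- 2 * s * real k)) \<le> 1"
proof (cases "K = 0")
  case True
  then show ?thesis by simp
next
  case K: False
  define c where "c k s = smol k s * exp (- 2 * s * real k)" for k s
  define S where "S s = (\<Sum>k\<in>{1..K}. c k s)" for s
  define Q where "Q s = (\<Sum>k\<in>{1..K}. real k * c k s)" for s
  have c_nonneg: "0 \<le> c k s" if "0 \<le> s" for k s using smol_nonneg[OF that] by (simp add: c_def)
  have c_deriv: "(c k has_real_derivative (real k * (\<Sum>i\<in>{1..<k}. c i s * c (k - i) s) - 2 * (real k * c k s))) (at s)" for k s
  proof -
    have "(c k has_real_derivative real k * (\<Sum>i\<in>{1..<k}. smol i s * smol (k - i) s) * exp (- 2 * s * real k)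
      + smol k s * (exp (- 2 * s * real k) * (- 2 * real k))) (at s)"
      unfolding c_def[abs_def] by (auto intro!: derivative_eq_intros smol_deriv)
    moreover have "(\<Sum>i\<in>{1..<k}. c i s * c (k - i) s) = (\<Sum>i\<in>{1..<k}. smol i s * smol (k - i) s) * exp (- 2 * s * real k)"
      unfolding sum_distrib_right
    proof (rule sum.cong[OF refl])
      fix i assume "i \<in> {1..<k}"
      then have "- 2 * s * real k = - 2 * s * real i + - 2 * s * real (k - i)" by (simp add: of_nat_diff algebra_simps)
      then have "exp (- 2 * s * real k) = exp (- 2 * s * real i) * exp (- 2 * s * real (k - i))" by (simp only: exp_add)
      then show "c i s * c (k - i) s = smol i s * smol (k - i) s * exp (- 2 * s * real k)"
        by (simp only: c_def) simp
    qed
    ultimately show ?thesis by (simp add: c_def algebra_simps)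
  qed
  \<comment> \<open>Symmetrising i and k - i turns the factor k into 2 i; then the triangle i + j
    \<le> K is enlarged to a square, which only adds nonnegative terms.\<close>
  have gain: "(\<Sum>k\<in>{1..K}. real k * (\<Sum>i\<in>{1..<k}. c i s * c (k - i) s)) \<le> 2 * Q s * S s" if s: "0 \<le> s" for s
  proof -
    have sym: "(\<Sum>i\<in>{1..<k}. real (k - i) * (c i s * c (k - i) s)) = (\<Sum>i\<in>{1..<k}. real i * (c i s * c (k - i) s))" for k
      by (rule sum.reindex_bij_witness[of _ "\<lambda>i. k - i" "\<lambda>i. k - i"]) auto
    have "real k * (\<Sum>i\<in>{1..<k}. c i s * c (k - i) s) = 2 * (\<Sum>i\<in>{1..<k}. real i * (c i s * c (k - i) s))" for k
    proof -
      have "real k * (\<Sum>i\<in>{1..<k}. c i s * c (k - i) s) = (\<Sum>i\<in>{1..<k}. real i * (c i s * c (k - i) s) + real (k - i) * (c i s * c (k - i) s))"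
        unfolding sum_distrib_left by (rule sum.cong) (auto simp: of_nat_diff algebra_simps)
      then show ?thesis unfolding sum.distrib sym by simp
    qed
    then have "(\<Sum>k\<in>{1..K}. real k * (\<Sum>i\<in>{1..<k}. c i s * c (k - i) s)) = 2 * (\<Sum>k\<in>{1..K}. \<Sum>i\<in>{1..<k}. real i * (c i s * c (k - i) s))"
      by (simp add: sum_distrib_left)
    also have "(\<Sum>k\<in>{1..K}. \<Sum>i\<in>{1..<k}. real i * (c i s * c (k - i) s)) = (\<Sum>(k, i)\<in>(SIGMA k:{1..K}. {1..<k}). real i * (c i s * c (k - i) s))"
      by (rule sum.Sigma) auto
    also have "\<dots> = (\<Sum>(i, j)\<in>{(i, j). 1 \<le> i \<and> 1 \<le> j \<and> i + j \<le> K}. real i * (c i s * c j s))"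
      by (rule sum.reindex_bij_witness[of _ "\<lambda>(i, j). (i + j, i)" "\<lambda>(k, i). (i, k - i)"]) auto
    also have "\<dots> \<le> (\<Sum>(i, j)\<in>{1..K} \<times> {1..K}. real i * (c i s * c j s))"
      by (rule sum_mono2) (auto intro!: mult_nonneg_nonneg c_nonneg s)
    also have "\<dots> = Q s * S s" unfolding Q_def S_def sum_product sum.cartesian_product by (simp add: mult.assoc)
    finally show ?thesis by simp
  qed
  \<comment> \<open>Starting the integral at -1 makes 0 an interior point, so that P has a two-sided
    derivative there.\<close>
  define P where "P t = integral {-1..t} Q" for t
  have c_cont: "isCont (c k) s" for k s using c_deriv DERIV_isCont by blast
  have P_deriv: "(P has_real_derivative Q t) (at t)" if "0 \<le> t" for t
  proof -
    have "continuous_on {-1..t + 1} Q" unfolding Q_def[abs_def]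
      by (intro continuous_intros continuous_at_imp_continuous_on ballI c_cont)
    then have "((\<lambda>x. integral {-1..x} Q) has_real_derivative Q t) (at t within {-1..t + 1})"
      by (rule integral_has_real_derivative) (use that in auto)
    moreover have "at t within {-1..t + 1} = at t" by (rule at_within_interior) (use that in auto)
    ultimately show ?thesis by (simp add: P_def[abs_def])
  qed
  \<comment> \<open>Gronwall: by \<open>gain\<close> the derivative of \<open>S - 1\<close> is at
    most \<open>2 * Q * (S - 1)\<close>, and its initial value is 0.\<close>
  have "(S s - 1) * exp (- 2 * P s) \<le> (S 0 - 1) * exp (- 2 * P 0)"
  proof (rule DERIV_nonpos_imp_nonincreasing[OF assms])
    fix x assume x: "0 \<le> x" "x \<le> s"
    let ?S' = "\<Sum>k\<in>{1..K}. real k * (\<Sum>i\<in>{1..<k}. c i x * c (k - i) x) - 2 * (real k * c k x)"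
    have S': "?S' = (\<Sum>k\<in>{1..K}. real k * (\<Sum>i\<in>{1..<k}. c i x * c (k - i) x)) - 2 * Q x"
      by (simp add: Q_def sum_subtractf sum_distrib_left)
    have "(S has_real_derivative ?S') (at x)"
      unfolding S_def[abs_def] by (intro DERIV_sum c_deriv)
    then have d: "((\<lambda>s. (S s - 1) * exp (- 2 * P s)) has_real_derivative
       ?S' * exp (- 2 * P x) + (S x - 1) * (exp (- 2 * P x) * (- 2 * Q x))) (at x)"
      using P_deriv[OF x(1)] by (auto intro!: derivative_eq_intros)
    have "?S' * exp (- 2 * P x) + (S x - 1) * (exp (- 2 * P x) * (- 2 * Q x)) =
       ((\<Sum>k\<in>{1..K}. real k * (\<Sum>i\<in>{1..<k}. c i x * c (k - i) x)) - 2 * Q x * S x) * exp (- 2 * P x)"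
      unfolding S' by (simp add: algebra_simps)
    moreover have "\<dots> \<le> 0" using gain[OF x(1)] by (intro mult_nonpos_nonneg) auto
    ultimately have "?S' * exp (- 2 * P x) + (S x - 1) * (exp (- 2 * P x) * (- 2 * Q x)) \<le> 0" by (simp only:)
    with d show "\<exists>y. ((\<lambda>s. (S s - 1) * exp (- 2 * P s)) has_real_derivative y) (at x) \<and> y \<le> 0" by blast
  qed
  moreover have "S 0 = (\<Sum>k\<in>{1..K}. of_bool (k = 1))" by (simp add: S_def c_def smol_at_0)
  then have "S 0 = 1" using K by (simp add: of_bool_def)
  ultimately have "(S s - 1) * exp (- 2 * P s) \<le> 0" by simp
  then have "S s - 1 \<le> 0" by (simp add: mult_le_0_iff)
  then show ?thesis by (simp add: S_def c_def)
qed

section \<open>The tree function\<close>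

text \<open>The tree function divided by its argument. The shift gives constant term 1, so that
  logarithms make sense down to z = 0.\<close>

definition tree_fps :: "real \<Rightarrow> real" where
  "tree_fps z = (\<Sum>k. tree_coeff (Suc k) * z ^ k)"

text \<open>The bound at \<open>s = u / 2\<close>, written with \<open>z = u e\<^sup>-\<^sup>u\<close>.\<close>

lemma tree_partial_sum_le:
  assumes "0 \<le> u" shows "(\<Sum>k<K. tree_coeff (Suc k) * (u * exp (- u)) ^ k) \<le> exp u"
proof -
  have "(\<Sum>k\<in>{1..K}. smol k (u / 2) * exp (- 2 * (u / 2) * real k)) = (\<Sum>k<K. smol (Suc k) (u / 2) * exp (- 2 * (u / 2) * real (Suc k)))"
    by (rule sum.reindex_bij_witness[of _ Suc "\<lambda>k. k - 1"]) auto
  also have "\<dots> = exp (- u) * (\<Sum>k<K. tree_coeff (Suc k) * (u * exp (- u)) ^ k)"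
    unfolding sum_distrib_left
  proof (rule sum.cong[OF refl])
    fix k
    have "exp (- 2 * (u / 2) * real (Suc k)) = exp (- u) * exp (- u) ^ k"
      by (simp add: exp_of_nat_mult[symmetric] exp_add[symmetric] algebra_simps)
    then show "smol (Suc k) (u / 2) * exp (- 2 * (u / 2) * real (Suc k)) = exp (- u) * (tree_coeff (Suc k) * (u * exp (- u)) ^ k)"
      by (simp add: smol_def power_mult_distrib)
  qed
  finally have "exp (- u) * (\<Sum>k<K. tree_coeff (Suc k) * (u * exp (- u)) ^ k) \<le> 1"
    using smol_sum_le_1[of "u / 2" K] assms by simp
  then show ?thesis by (simp add: exp_minus field_simps)
qed

text \<open>The bound on partial sums, taken at u = 1, already gives convergence at the critical
  argument \<open>exp (- 1)\<close>, with no asymptotics of the coefficients.\<close>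

lemma tree_summable:
  assumes "0 \<le> u" shows "summable (\<lambda>k. tree_coeff (Suc k) * (u * exp (- u)) ^ k)"
  by (rule bounded_imp_summable[where B = "exp u"])
    (use tree_partial_sum_le[OF assms, of "Suc _"] assms tree_coeff_nonneg in \<open>auto simp: lessThan_Suc_atMost\<close>)

lemma tree_fps_le: "0 \<le> u \<Longrightarrow> tree_fps (u * exp (- u)) \<le> exp u"
  unfolding tree_fps_def by (rule suminf_le_const[OF tree_summable tree_partial_sum_le])

text \<open>The recursion for the coefficients says \<open>2 (z Y' - Y) = z (Y\<^sup>2)'\<close> for \<open>Y z = z * tree_fps z\<close>,
  that is \<open>Y' / Y - Y' = 1 / z\<close>, so \<open>ln Y - Y - ln z = ln (tree_fps z) - z * tree_fps z\<close> is constant.\<close>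

lemma tree_fps_functional:
  assumes z: "0 < z" "z < exp (- 1)" shows "tree_fps z = exp (z * tree_fps z)"
proof -
  define K where "K = exp (- 1 :: real)"
  have smR: "summable (\<lambda>k. tree_coeff (Suc k) * K ^ k)" using tree_summable[of 1] by (simp add: K_def)
  have smY: "summable (\<lambda>k. tree_coeff k * x ^ k)" if "0 \<le> x" "x \<le> K" for x
  proof -
    have "summable (\<lambda>k. tree_coeff (Suc k) * x ^ k)"
      by (rule summable_comparison_test'[OF smR, of 0]) (use that tree_coeff_nonneg in \<open>auto simp: norm_mult abs_of_nonneg power_abs intro!: mult_left_mono power_mono\<close>)
    from summable_mult[OF this, of x] have "summable (\<lambda>k. tree_coeff (Suc k) * x ^ Suc k)" by (simp add: mult_ac)
    then show ?thesis by (subst (asm) summable_Suc_iff)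
  qed
  define Y where "Y z = (\<Sum>k. tree_coeff k * z ^ k)" for z
  define q where "q k = (\<Sum>i\<le>k. tree_coeff i * tree_coeff (k - i))" for k
  have q_eq: "q k = (\<Sum>i\<in>{1..<k}. tree_coeff i * tree_coeff (k - i))" for k
    unfolding q_def by (rule sum.mono_neutral_right) (auto simp: not_less_eq_eq less_eq_Suc_le not_le le_Suc_eq)
  have Y_eq: "Y x = x * tree_fps x" if "0 \<le> x" "x \<le> K" for x
  proof -
    have "Y x = (\<Sum>k. tree_coeff (Suc k) * x ^ Suc k)"
      unfolding Y_def using suminf_split_head[OF smY[OF that]] by simp
    also have "\<dots> = (\<Sum>k. x * (tree_coeff (Suc k) * x ^ k))" by (simp add: mult_ac)
    also have "\<dots> = x * tree_fps x" unfolding tree_fps_def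
    proof (rule suminf_mult)
      show "summable (\<lambda>k. tree_coeff (Suc k) * x ^ k)"
        by (rule summable_comparison_test'[OF smR, of 0]) (use that tree_coeff_nonneg in \<open>auto simp: norm_mult abs_of_nonneg power_abs intro!: mult_left_mono power_mono\<close>)
    qed
    finally show ?thesis .
  qed
  have sq: "(\<lambda>k. q k * x ^ k) sums (Y x)\<^sup>2" if x: "0 \<le> x" "x \<le> K" for x
  proof -
    have ab: "summable (\<lambda>k. norm (tree_coeff k * x ^ k))" using smY[OF x] x tree_coeff_nonneg by simp
    have "(\<lambda>k. \<Sum>i\<le>k. (tree_coeff i * x ^ i) * (tree_coeff (k - i) * x ^ (k - i))) sums (Y x * Y x)"
      unfolding Y_def by (rule Cauchy_product_sums[OF ab ab])
    moreover have "(\<Sum>i\<le>k. (tree_coeff i * x ^ i) * (tree_coeff (k - i) * x ^ (k - i))) = q k * x ^ k" for k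
      unfolding q_def sum_distrib_right by (rule sum.cong) (auto simp: power_add[symmetric] mult_ac)
    ultimately show ?thesis by (simp add: power2_eq_square)
  qed
  have R_ge_1: "1 \<le> tree_fps x" if "0 \<le> x" "x \<le> K" for x
  proof -
    have "summable (\<lambda>k. tree_coeff (Suc k) * x ^ k)"
        by (rule summable_comparison_test'[OF smR, of 0]) (use that tree_coeff_nonneg in \<open>auto simp: norm_mult abs_of_nonneg power_abs intro!: mult_left_mono power_mono\<close>)
    from sum_le_suminf[OF this, of "{0}"] show ?thesis using that tree_coeff_nonneg by (simp add: tree_fps_def)
  qed
  have ode: "\<exists>D R'. (Y has_real_derivative D) (at x) \<and> x * D * (1 - Y x) = Y x \<and> (tree_fps has_real_derivative R') (at x)"
    if x: "0 \<le> x" "x < K" for x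
  proof -
    have xK: "\<bar>x\<bar> < K" using x by simp
    obtain D where D: "(Y has_real_derivative D) (at x)" "(\<lambda>n. real n * tree_coeff n * x ^ n) sums (x * D)"
      using power_series_deriv[OF smY[of K] xK] unfolding Y_def[abs_def] K_def by auto
    have smq: "summable (\<lambda>k. q k * K ^ k)" using sq[of K] by (simp add: K_def sums_iff)
    obtain E where E: "((\<lambda>z. \<Sum>n. q n * z ^ n) has_real_derivative E) (at x)" "(\<lambda>n. real n * q n * x ^ n) sums (x * E)"
      using power_series_deriv[OF smq xK] by blast
    obtain R' where R': "(tree_fps has_real_derivative R') (at x)"
      using power_series_deriv[OF smR xK] unfolding tree_fps_def[abs_def] by blast
    have Y_sums: "(\<lambda>n. tree_coeff n * x ^ n) sums Y x" unfolding Y_def using smY x by (simp add: summable_sums)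
    have "(\<lambda>n. 2 * (real n * tree_coeff n * x ^ n - tree_coeff n * x ^ n)) sums (2 * (x * D - Y x))"
      by (intro sums_mult sums_diff D(2) Y_sums)
    moreover have "2 * (real n * tree_coeff n * x ^ n - tree_coeff n * x ^ n) = real n * q n * x ^ n" for n
      unfolding q_eq tree_coeff_rec[symmetric] by (simp add: algebra_simps)
    ultimately have 1: "2 * (x * D - Y x) = x * E" using E(2) sums_unique2 by simp
    \<comment> \<open>The series with coefficients \<open>q\<close> is known to equal the square of
      \<open>Y\<close> only on [0, K], hence the neighbourhood inside (0, K); at x = 0 the factor x
      makes the claim trivial.\<close>
    have "x * E = x * (2 * Y x * D)"
    proof (cases "x = 0")
      case False
      have "((\<lambda>z. (Y z)\<^sup>2) has_real_derivative 2 * Y x * D) (at x)"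
        using D(1) by (auto intro!: derivative_eq_intros)
      then have "((\<lambda>z. \<Sum>n. q n * z ^ n) has_real_derivative 2 * Y x * D) (at x)"
      proof (rule has_field_derivative_transform_within[where d = "min x (K - x)"])
        show "0 < min x (K - x)" using False x by simp
        fix y assume "dist y x < min x (K - x)"
        then have "0 \<le> y" "y \<le> K" by (auto simp: dist_real_def)
        then show "(Y y)\<^sup>2 = (\<Sum>n. q n * y ^ n)" using sq sums_unique by blast
      qed simp
      then show ?thesis using DERIV_unique[OF E(1)] by simp
    qed simp
    with 1 have "2 * (x * D - Y x) = x * (2 * Y x * D)" by (simp only:)
    then have "x * D * (1 - Y x) = Y x" by (simp add: algebra_simps)
    then show ?thesis using D(1) R' by blast
  qed
  let ?G = "\<lambda>x. ln (tree_fps x) - x * tree_fps x"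
  have zK: "z < K" using z by (simp add: K_def)
  have "?G z = ?G 0"
  proof (rule DERIV_isconst_end[OF z(1), where f = ?G])
    show "continuous_on {0..z} ?G"
    proof -
      have "continuous_on {0..z} tree_fps"
      proof (rule continuous_at_imp_continuous_on, rule ballI)
        fix x assume "x \<in> {0..z}"
        then show "isCont tree_fps x" using ode[of x] zK DERIV_isCont by fastforce
      qed
      moreover have "tree_fps x \<noteq> 0" if "x \<in> {0..z}" for x using R_ge_1[of x] that zK by auto
      ultimately show ?thesis by (intro continuous_intros ballI) auto
    qed
    fix x assume x: "0 < x" "x < z"
    then have xK: "0 \<le> x" "x < K" using zK by auto
    obtain D R' where D: "(Y has_real_derivative D) (at x)" "x * D * (1 - Y x) = Y x" and R': "(tree_fps has_real_derivative R') (at x)"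
      using ode[OF xK] by blast
    have R: "1 \<le> tree_fps x" using R_ge_1[of x] xK by simp
    have Yx: "Y x = x * tree_fps x" using Y_eq xK by simp
    have "((\<lambda>x. x * tree_fps x) has_real_derivative tree_fps x + x * R') (at x)"
      using R' by (auto intro!: derivative_eq_intros)
    moreover have "((\<lambda>x. x * tree_fps x) has_real_derivative D) (at x)"
      using D(1)
    proof (rule has_field_derivative_transform_within[where d = "min x (K - x)"])
      show "0 < min x (K - x)" using x xK by simp
      fix y assume "dist y x < min x (K - x)"
      then have "0 \<le> y" "y \<le> K" by (auto simp: dist_real_def)
      then show "Y y = y * tree_fps y" by (rule Y_eq)
    qed simp
    ultimately have D_eq: "D = tree_fps x + x * R'" using DERIV_unique by blast
    have "(?G has_real_derivative R' / tree_fps x - (tree_fps x + x * R')) (at x)"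
      using R' R by (auto intro!: derivative_eq_intros)
    moreover have "R' / tree_fps x - (tree_fps x + x * R') = 0"
    proof -
      have "x * (R' - tree_fps x * (tree_fps x + x * R')) = 0"
      proof -
        have "x * ((tree_fps x + x * R') * (1 - x * tree_fps x)) = x * tree_fps x"
          using D(2) unfolding D_eq Yx by (simp only: mult.assoc)
        then have "(tree_fps x + x * R') * (1 - x * tree_fps x) = tree_fps x" using x by simp
        moreover have "x * (R' - tree_fps x * (tree_fps x + x * R')) = (tree_fps x + x * R') * (1 - x * tree_fps x) - tree_fps x"
          by (simp add: algebra_simps)
        ultimately show ?thesis by linarith
      qed
      then have "x = 0 \<or> R' - tree_fps x * (tree_fps x + x * R') = 0" by (simp only: mult_eq_0_iff)
      then have "R' = tree_fps x * (tree_fps x + x * R')" using x(1) by linarith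
      then have "R' / tree_fps x = tree_fps x * (tree_fps x + x * R') / tree_fps x" by (rule arg_cong)
      also have "\<dots> = tree_fps x + x * R'" using R by (intro nonzero_mult_div_cancel_left) auto
      finally show ?thesis by simp
    qed
    ultimately show "(?G has_real_derivative 0) (at x)" by simp
  qed
  also have "?G 0 = 0"
    using powser_zero[of "\<lambda>k. tree_coeff (Suc k)"] by (simp add: tree_fps_def)
  finally have "ln (tree_fps z) = z * tree_fps z" by simp
  then show ?thesis using R_ge_1[of z] z(1) zK exp_ln[of "tree_fps z"] by simp
qed

lemma x_exp_strict_mono:
  fixes a b :: real assumes "0 \<le> a" "a < b" "b \<le> 1" shows "a * exp (- a) < b * exp (- b)"
proof (rule DERIV_pos_imp_increasing_open[OF assms(2), where f = "\<lambda>x. x * exp (- x)"])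
  fix x assume x: "a < x" "x < b"
  have "((\<lambda>x. x * exp (- x)) has_real_derivative (1 - x) * exp (- x)) (at x)"
    by (auto intro!: derivative_eq_intros simp: algebra_simps)
  moreover have "0 < (1 - x) * exp (- x)" using x assms by simp
  ultimately show "\<exists>y. ((\<lambda>x. x * exp (- x)) has_real_derivative y) (at x) \<and> 0 < y" by blast
qed (auto intro!: continuous_intros)

text \<open>The number \<open>y = z * tree_fps z\<close> solves
  \<open>y * exp (- y) = u * exp (- u)\<close>, an equation that for 0 < u < 1 has a second solution
  above 1. The bound \<open>tree_fps_le\<close> forces y \<le> u, and on [0, 1] the map is
  injective. The critical endpoint u = 1 follows by letting u increase to 1.\<close>

lemma tree_fps_eq:
  assumes u: "0 \<le> u" "u \<le> 1" shows "tree_fps (u * exp (- u)) = exp u"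
proof -
  have lt: "tree_fps (u * exp (- u)) = exp u" if u: "0 < u" "u < 1" for u
  proof -
    define z T y where "z = u * exp (- u)" and "T = tree_fps z" and "y = z * T"
    have z: "0 < z" "z < exp (- 1)" using u x_exp_strict_mono[of u 1] by (auto simp: z_def)
    have R: "T = exp y" unfolding T_def y_def by (rule tree_fps_functional[OF z])
    have "y \<le> z * exp u" unfolding y_def
      using tree_fps_le[of u] u z by (intro mult_left_mono) (auto simp: T_def z_def)
    also have "\<dots> = u" by (simp add: z_def exp_minus)
    finally have yu: "y \<le> u" .
    have "0 < T" by (simp only: R exp_gt_zero)
    then have y0: "0 \<le> y" using z by (simp add: y_def)
    have "y * exp (- y) = z * (T * exp (- y))" by (simp only: y_def mult.assoc)
    also have "T * exp (- y) = 1" by (simp only: R exp_minus) simp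
    finally have "y * exp (- y) = u * exp (- u)" by (simp add: z_def)
    then have "\<not> y < u" using x_exp_strict_mono[of y u] y0 u by auto
    then have "y = u" using yu by simp
    then show ?thesis using R by (simp add: T_def z_def)
  qed
  consider "u = 0" | "0 < u" "u < 1" | "u = 1" using u by linarith
  then show ?thesis
  proof cases
    case 1
    then show ?thesis using powser_zero[of "\<lambda>k. tree_coeff (Suc k)"] by (simp add: tree_fps_def)
  next
    case 3
    have "exp 1 \<le> tree_fps (1 * exp (- 1))"
    proof (rule tendsto_upperbound)
      show "((\<lambda>u. exp u) \<longlongrightarrow> exp (1::real)) (at_left 1)"
        by (rule tendsto_within_subset[of _ _ _ UNIV]) (auto intro!: tendsto_intros)
      have "exp u \<le> tree_fps (1 * exp (- 1))" if u: "0 < u" "u < 1" for u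
      proof -
        have "tree_fps (u * exp (- u)) \<le> tree_fps (1 * exp (- 1))"
          unfolding tree_fps_def
          by (rule suminf_le[OF _ tree_summable tree_summable])
            (use u x_exp_strict_mono[of u 1] tree_coeff_nonneg in \<open>auto intro!: mult_left_mono power_mono\<close>)
        then show ?thesis using lt[OF u] by simp
      qed
      then show "\<forall>\<^sub>F u in at_left 1. exp u \<le> tree_fps (1 * exp (- 1))"
        using eventually_at_left_real[of 0 1] by (auto elim!: eventually_mono)
    qed simp
    then show ?thesis using 3 tree_fps_le[of 1] by simp
  qed (rule lt)
qed

section \<open>Tails of the tree series and the mass balance in the limit\<close>

text \<open>Taken at \<open>exp (- 1)\<close>, the largest value of \<open>u * exp (- u)\<close>, so
  that one tail serves all times, the critical one included. The shift is K - 1 because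
  \<open>tree_coeff k\<close> comes with exponent k - 1.\<close>

definition tree_tail :: "nat \<Rightarrow> real" where
  "tree_tail K = (\<Sum>k. tree_coeff (Suc (k + (K - 1))) * exp (- 1) ^ (k + (K - 1)))"

lemma tree_tail_tendsto: "tree_tail \<longlonglongrightarrow> 0"
proof -
  let ?f = "\<lambda>k. tree_coeff (Suc k) * exp (- 1) ^ k"
  have sm: "summable ?f" using tree_summable[of 1] by simp
  have "(\<lambda>K. \<Sum>k. ?f (k + K)) \<longlonglongrightarrow> 0"
    by (rule suminf_exist_split2[OF sm])
  then have "(\<lambda>K. tree_tail (Suc K)) \<longlonglongrightarrow> 0" by (simp add: tree_tail_def)
  then show ?thesis by (simp add: filterlim_sequentially_Suc)
qed

lemma tree_tail_bound:
  assumes u: "0 \<le> u" "u \<le> 1"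
  shows "(\<Sum>k\<in>{1..<K}. tree_coeff k * (u * exp (- u)) ^ (k - 1)) \<le> exp u"
    "exp u - tree_tail K \<le> (\<Sum>k\<in>{1..<K}. tree_coeff k * (u * exp (- u)) ^ (k - 1))"
proof -
  let ?f = "\<lambda>k. tree_coeff (Suc k) * (u * exp (- u)) ^ k"
  have e: "(\<Sum>k\<in>{1..<K}. tree_coeff k * (u * exp (- u)) ^ (k - 1)) = (\<Sum>k<K - 1. ?f k)"
    by (rule sum.reindex_bij_witness[of _ Suc "\<lambda>k. k - 1"]) auto
  show "(\<Sum>k\<in>{1..<K}. tree_coeff k * (u * exp (- u)) ^ (k - 1)) \<le> exp u"
    unfolding e by (rule tree_partial_sum_le[OF u(1)])
  have "exp u = (\<Sum>k. ?f k)" using tree_fps_eq[OF u] by (simp add: tree_fps_def)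
  also have "\<dots> = (\<Sum>k. ?f (k + (K - 1))) + (\<Sum>k<K - 1. ?f k)"
    by (rule suminf_split_initial_segment[OF tree_summable[OF u(1)]])
  also have "(\<Sum>k. ?f (k + (K - 1))) \<le> tree_tail K"
    unfolding tree_tail_def
  proof (rule suminf_le)
    have ue: "u * exp (- u) \<le> exp (- 1)" using x_exp_strict_mono[of u 1] u by (cases "u = 1") auto
    show "?f (k + (K - 1)) \<le> tree_coeff (Suc (k + (K - 1))) * exp (- 1) ^ (k + (K - 1))" for k
      by (rule mult_left_mono[OF power_mono[OF ue]]) (use u tree_coeff_nonneg in auto)
    show "summable (\<lambda>k. ?f (k + (K - 1)))" by (rule summable_ignore_initial_segment[OF tree_summable[OF u(1)]])
    show "summable (\<lambda>k. tree_coeff (Suc (k + (K - 1))) * exp (- 1) ^ (k + (K - 1)))"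
      using summable_ignore_initial_segment[OF tree_summable[of 1], of "K - 1"] by simp
  qed
  finally show "exp u - tree_tail K \<le> (\<Sum>k\<in>{1..<K}. tree_coeff k * (u * exp (- u)) ^ (k - 1))"
    unfolding e by simp
qed

lemma tree_tail_nonneg: "0 \<le> tree_tail K"
  using tree_tail_bound[of 0 K] by simp

lemma limit_tree_mass:
  assumes p: "0 < p" "p \<le> 1" and t: "0 \<le> t"
  shows "\<bar>(1 - g_fun p t) - (\<Sum>k\<in>{1..<K}. smol k t * exp (- real k * (2 * t - 2 * (1 - p) * limit_integral p t)))\<bar> \<le> tree_tail K"
proof -
  define x u where "x = 1 - g_fun p t" and "u = 2 * t * x"
  have x: "0 < x" "x \<le> 1" using g_fun_bounds[OF p, of t] by (auto simp: x_def)
  have u: "0 \<le> u" "u \<le> 1" using limit_subcritical[OF p t] by (auto simp: u_def x_def)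
  have eq: "exp (- (2 * t - 2 * (1 - p) * limit_integral p t)) = x * exp (- u)"
    using limit_equation[OF p t] by (simp add: x_def u_def)
  let ?S = "\<Sum>k\<in>{1..<K}. tree_coeff k * (u * exp (- u)) ^ (k - 1)"
  have sum_eq: "(\<Sum>k\<in>{1..<K}. smol k t * exp (- real k * (2 * t - 2 * (1 - p) * limit_integral p t))) = x * exp (- u) * ?S"
    unfolding sum_distrib_left
  proof (rule sum.cong[OF refl])
    fix k assume "k \<in> {1..<K}"
    then obtain j where k: "k = Suc j" by (cases k) auto
    have "exp (- real k * (2 * t - 2 * (1 - p) * limit_integral p t)) = exp (real k * - (2 * t - 2 * (1 - p) * limit_integral p t))"
      by (simp only: mult_minus_left mult_minus_right)
    also have "\<dots> = (x * exp (- u)) ^ k" unfolding exp_of_nat_mult eq ..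
    finally show "smol k t * exp (- real k * (2 * t - 2 * (1 - p) * limit_integral p t)) = x * exp (- u) * (tree_coeff k * (u * exp (- u)) ^ (k - 1))"
      by (simp add: smol_def k u_def power_mult_distrib)
  qed
  have 1: "x * exp (- u) * exp u = x" by (simp add: exp_minus)
  have 2: "x * exp (- u) * ?S \<le> x * exp (- u) * exp u"
    using tree_tail_bound(1)[OF u] x by (intro mult_left_mono) auto
  have 3: "x * exp (- u) * (exp u - ?S) \<le> 1 * tree_tail K"
  proof (rule mult_mono)
    show "x * exp (- u) \<le> 1" using x u mult_mono[of x 1 "exp (- u)" 1] by simp
  qed (use tree_tail_bound[OF u, of K] in auto)
  show ?thesis unfolding sum_eq x_def[symmetric] using 1 2 3[unfolded right_diff_distrib] by linarith
qed

section \<open>Convergence of the small-tree densities\<close>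

lemma exp_minus_1_le: fixes x :: real shows "0 \<le> x \<Longrightarrow> \<bar>exp x - 1\<bar> \<le> x * exp x"
proof -
  assume x: "0 \<le> x"
  have "1 - x \<le> exp (- x)" using exp_ge_add_one_self[of "- x"] by simp
  then have "(1 - x) * exp x \<le> exp (- x) * exp x" by (rule mult_right_mono) simp
  then have "exp x - 1 \<le> x * exp x" by (simp add: algebra_simps exp_minus)
  then show ?thesis using x by simp
qed

lemma exp_minus_1_minus_le: fixes x :: real shows "0 \<le> x \<Longrightarrow> \<bar>exp x - 1 - x\<bar> \<le> x\<^sup>2 * exp x"
proof -
  assume x: "0 \<le> x"
  have "x * \<bar>exp x - 1\<bar> \<le> x * (x * exp x)" using exp_minus_1_le[OF x] x by (rule mult_left_mono)
  then have "x * (exp x - 1) \<le> x\<^sup>2 * exp x" using x by (simp add: power2_eq_square)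
  moreover have "exp x - 1 \<le> x * exp x" using exp_minus_1_le[OF x] by simp
  moreover have "1 + x \<le> exp x" by (rule exp_ge_add_one_self)
  ultimately show ?thesis by (simp add: algebra_simps)
qed

text \<open>Multiplication by the integrating factor \<open>exp (k q)\<close> removes the loss term of the drift \<open>d\<close>.\<close>

lemma integrating_factor_drift:
  fixes q \<nu> d s k n c :: real
  assumes n: "2 \<le> n" and k: "0 \<le> k" and q: "0 \<le> q" "q \<le> 2 / n" and \<nu>: "0 \<le> \<nu>" "\<nu> \<le> 1"
    and d: "\<bar>d\<bar> \<le> 2 * k / n" "\<bar>d - (s / n - k * q * \<nu>)\<bar> \<le> c / n\<^sup>2"
  shows "\<bar>exp (k * q) * (\<nu> + d) - \<nu> - s / n\<bar> \<le> (8 * k\<^sup>2 * exp k + c) / n\<^sup>2"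
proof -
  have kq: "0 \<le> k * q" "k * q \<le> 2 * k / n" using mult_left_mono[OF q(2) k] q k by (auto simp: mult.commute)
  have "2 * k / n \<le> k" using n mult_left_mono[OF n k] by (simp add: field_simps)
  then have ek: "exp (k * q) \<le> exp k" using kq by simp
  have 1: "\<bar>exp (k * q) - 1 - k * q\<bar> \<le> (2 * k / n)\<^sup>2 * exp k"
    using exp_minus_1_minus_le[OF kq(1)] mult_mono[OF power_mono[OF kq(2,1), of 2] ek] by fastforce
  have 2: "\<bar>exp (k * q) - 1\<bar> \<le> 2 * k / n * exp k"
    using exp_minus_1_le[OF kq(1)] mult_mono[OF kq(2) ek] kq by fastforce
  have "\<bar>(exp (k * q) - 1 - k * q) * \<nu>\<bar> \<le> (2 * k / n)\<^sup>2 * exp k * 1"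
    unfolding abs_mult by (rule mult_mono[OF 1]) (use \<nu> in auto)
  moreover have "\<bar>(exp (k * q) - 1) * d\<bar> \<le> (2 * k / n * exp k) * (2 * k / n)"
    unfolding abs_mult by (rule mult_mono[OF 2 d(1)]) (use k n in auto)
  \<comment> \<open>Second-order remainder times density, first-order factor times increment, and
    the error of the drift: each is of order 1 / n^2.\<close>
  moreover have "exp (k * q) * (\<nu> + d) - \<nu> - s / n = (exp (k * q) - 1 - k * q) * \<nu> + (exp (k * q) - 1) * d
     + (d - (s / n - k * q * \<nu>))" by (simp add: algebra_simps)
  ultimately have "\<bar>exp (k * q) * (\<nu> + d) - \<nu> - s / n\<bar> \<le> (2 * k / n)\<^sup>2 * exp k + (2 * k / n * exp k) * (2 * k / n) + c / n\<^sup>2"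
    using d(2) by linarith
  also have "\<dots> = (8 * k\<^sup>2 * exp k + c) / n\<^sup>2" by (simp add: power2_eq_square add_divide_distrib)
  finally show ?thesis .
qed

text \<open>One constant for the finitely many sizes below K on [0, T]: values, Lipschitz bound and
  second-order Taylor error. The derivative is quadratic in the \<open>smol i\<close>, so its own
  Lipschitz bound follows from the first two.\<close>

lemma smol_bounds:
  assumes "0 \<le> T"
  obtains B where "1 \<le> B" "\<And>k s. k < K \<Longrightarrow> 0 \<le> s \<Longrightarrow> s \<le> T \<Longrightarrow> smol k s \<le> B"
    "\<And>k s h. k < K \<Longrightarrow> 0 \<le> s \<Longrightarrow> 0 \<le> h \<Longrightarrow> s + h \<le> T \<Longrightarrow> \<bar>smol k (s + h) - smol k s\<bar> \<le> B * h"
    "\<And>k s h. k < K \<Longrightarrow> 0 \<le> s \<Longrightarrow> 0 \<le> h \<Longrightarrow> s + h \<le> T \<Longrightarrow>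
       \<bar>smol k (s + h) - smol k s - h * (real k * (\<Sum>i\<in>{1..<k}. smol i s * smol (k - i) s))\<bar> \<le> B * h\<^sup>2"
proof -
  define b where "b = 1 + (\<Sum>k<K. smol k T)"
  have mono: "smol k s \<le> smol k s'" if "0 \<le> s" "s \<le> s'" for k s s'
    unfolding smol_def using that by (intro mult_left_mono power_mono tree_coeff_nonneg) auto
  have b1: "1 \<le> b" unfolding b_def by (simp add: sum_nonneg smol_nonneg assms)
  have le_b: "smol k s \<le> b" if "k < K" "0 \<le> s" "s \<le> T" for k s
  proof -
    have "smol k s \<le> smol k T" by (rule mono) (use that in auto)
    also have "\<dots> \<le> (\<Sum>k<K. smol k T)" by (rule member_le_sum) (use that assms smol_nonneg in auto)
    finally show ?thesis by (simp add: b_def)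
  qed
  define r where "r k s = real k * (\<Sum>i\<in>{1..<k}. smol i s * smol (k - i) s)" for k s
  define L where "L = real K * real K * (b * b)"
  have r_bound: "\<bar>r k s\<bar> \<le> L" if "k < K" "0 \<le> s" "s \<le> T" for k s
  proof -
    have "(\<Sum>i\<in>{1..<k}. smol i s * smol (k - i) s) \<le> (\<Sum>i\<in>{1..<k}. b * b)"
      using that b1 by (intro sum_mono mult_mono le_b smol_nonneg) auto
    also have "\<dots> \<le> real K * (b * b)" using that b1 by (auto intro!: mult_right_mono)
    finally have "r k s \<le> real K * (real K * (b * b))" unfolding r_def using that
      by (intro mult_mono) (auto intro!: sum_nonneg mult_nonneg_nonneg smol_nonneg)
    moreover have "0 \<le> r k s" unfolding r_def using that by (auto intro!: sum_nonneg mult_nonneg_nonneg smol_nonneg)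
    ultimately show ?thesis by (simp add: L_def)
  qed
  have mvt: "\<exists>z. s \<le> z \<and> z \<le> s + h \<and> smol k (s + h) - smol k s = h * r k z" if "0 \<le> h" for k s h
  proof (cases "h = 0")
    case False
    then have "s < s + h" using that by simp
    from MVT2[OF this, of "smol k" "r k"] obtain z where z: "s < z" "z < s + h" and eq: "smol k (s + h) - smol k s = (s + h - s) * r k z"
      using smol_deriv unfolding r_def by blast
    have "smol k (s + h) - smol k s = h * r k z" unfolding eq by simp
    with z show ?thesis by (meson less_imp_le)
  qed auto
  have lip: "\<bar>smol k (s + h) - smol k s\<bar> \<le> L * h" if h: "k < K" "0 \<le> s" "0 \<le> h" "s + h \<le> T" for k s h
  proof -
    obtain z where z: "s \<le> z" "z \<le> s + h" "smol k (s + h) - smol k s = h * r k z" using mvt[where h = h and s = s and k = k] h(3) by blast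
    have "h * \<bar>r k z\<bar> \<le> h * L" using r_bound[of k z] z h by (intro mult_left_mono) auto
    then show ?thesis unfolding z(3) abs_mult using h by (simp add: mult.commute)
  qed
  define L2 where "L2 = real K * real K * (2 * b * L)"
  have L0: "0 \<le> L" using b1 by (simp add: L_def)
  have r_lip: "\<bar>r k (s + h) - r k s\<bar> \<le> L2 * h" if h: "k < K" "0 \<le> s" "0 \<le> h" "s + h \<le> T" for k s h
  proof -
    have "\<bar>smol i (s + h) * smol (k - i) (s + h) - smol i s * smol (k - i) s\<bar> \<le> 2 * b * L * h" if i: "i \<in> {1..<k}" for i
    proof -
      have "smol i (s + h) * smol (k - i) (s + h) - smol i s * smol (k - i) s =
        smol i (s + h) * (smol (k - i) (s + h) - smol (k - i) s) + (smol i (s + h) - smol i s) * smol (k - i) s"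
        by (simp add: algebra_simps)
      moreover have "\<bar>smol i (s + h) * (smol (k - i) (s + h) - smol (k - i) s)\<bar> \<le> b * (L * h)"
        unfolding abs_mult using i h lip[of "k - i" s h] le_b[of i "s + h"] b1 smol_nonneg[of "s + h" i]
        by (intro mult_mono) auto
      moreover have "\<bar>(smol i (s + h) - smol i s) * smol (k - i) s\<bar> \<le> (L * h) * b"
        unfolding abs_mult using i h lip[of i s h] le_b[of "k - i" s] L0 smol_nonneg[of s "k - i"]
        by (intro mult_mono) auto
      moreover have "b * (L * h) + (L * h) * b = 2 * b * L * h" by simp
      ultimately show ?thesis by linarith
    qed
    then have "(\<Sum>i\<in>{1..<k}. \<bar>smol i (s + h) * smol (k - i) (s + h) - smol i s * smol (k - i) s\<bar>) \<le> (\<Sum>i\<in>{1..<k}. 2 * b * L * h)"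
      by (rule sum_mono)
    also have "\<dots> \<le> real K * (2 * b * L * h)" using h b1 L0 by (auto intro!: mult_right_mono)
    finally have "\<bar>(\<Sum>i\<in>{1..<k}. smol i (s + h) * smol (k - i) (s + h)) - (\<Sum>i\<in>{1..<k}. smol i s * smol (k - i) s)\<bar> \<le> real K * (2 * b * L * h)"
      unfolding sum_subtractf[symmetric] by (rule order_trans[OF sum_abs])
    then have "real k * \<bar>(\<Sum>i\<in>{1..<k}. smol i (s + h) * smol (k - i) (s + h)) - (\<Sum>i\<in>{1..<k}. smol i s * smol (k - i) s)\<bar> \<le> real K * (real K * (2 * b * L * h))"
      using h by (intro mult_mono) auto
    then show ?thesis unfolding r_def right_diff_distrib[symmetric] abs_mult by (simp add: L2_def mult_ac)
  qed
  have L20: "0 \<le> L2" using b1 L0 by (simp add: L2_def)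
  define B where "B = b + L + L2"
  show thesis
  proof
    show "1 \<le> B" using b1 L0 L20 by (simp add: B_def)
    show "smol k s \<le> B" if "k < K" "0 \<le> s" "s \<le> T" for k s using le_b[OF that] L0 L20 by (simp add: B_def)
    show "\<bar>smol k (s + h) - smol k s\<bar> \<le> B * h" if "k < K" "0 \<le> s" "0 \<le> h" "s + h \<le> T" for k s h
    proof -
      have "L * h \<le> B * h" using that b1 L20 by (intro mult_right_mono) (auto simp: B_def)
      then show ?thesis using lip[OF that] by linarith
    qed
    show "\<bar>smol k (s + h) - smol k s - h * (real k * (\<Sum>i\<in>{1..<k}. smol i s * smol (k - i) s))\<bar> \<le> B * h\<^sup>2"
      if h: "k < K" "0 \<le> s" "0 \<le> h" "s + h \<le> T" for k s h
    proof -
      obtain z where z: "s \<le> z" "z \<le> s + h" "smol k (s + h) - smol k s = h * r k z" using mvt[where h = h and s = s and k = k] h(3) by blast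
      have "\<bar>r k z - r k s\<bar> \<le> L2 * (z - s)" using r_lip[of k s "z - s"] h z by simp
      also have "\<dots> \<le> B * h" using z b1 L0 L20 by (intro mult_mono) (auto simp: B_def)
      finally have "h * \<bar>r k z - r k s\<bar> \<le> h * (B * h)" using h by (intro mult_left_mono) auto
      then show ?thesis unfolding z(3) r_def[symmetric] right_diff_distrib[symmetric] abs_mult
        using h by (simp add: power2_eq_square mult_ac)
    qed
  qed
qed

section \<open>Densities, their drift and the second moment recursion\<close>

definition frozen_fraction :: "nat \<Rightarrow> multigraph \<Rightarrow> real" where
  "frozen_fraction n G = frozen_count n G / real n"

definition tree_density :: "nat \<Rightarrow> nat \<Rightarrow> multigraph \<Rightarrow> real" where
  "tree_density n k G = size_count n k G / real n"

lemma frozen_fraction_bounds: "0 \<le> frozen_fraction n G" "frozen_fraction n G \<le> 1"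
  using frozen_count_bounds[of n G] by (auto simp: frozen_fraction_def divide_le_eq_1)

lemma tree_density_bounds: "0 \<le> tree_density n k G" "tree_density n k G \<le> 1"
  using tree_sum_le[of "\<lambda>a. of_bool (a = k)" 1 n G] tree_sum_nonneg[of "\<lambda>a. of_bool (a = k)" n G]
  by (auto simp: tree_density_def divide_le_eq_1)

text \<open>Two errors of the same order: that of \<open>drift_size_count\<close> after scaling, and
  that of replacing n - 1 by n in the denominator. Each is at most
  \<open>\<kappa> / (n * (n - 1))\<close>, hence at most \<open>2 * \<kappa> / n^2\<close>, which
  explains the factor 4.\<close>

lemma tree_density_drift:
  assumes n: "2 \<le> n" and p: "0 \<le> p" "p \<le> 1" and wf: "wf_state n G"
  shows "\<bar>measure_pmf.expectation (frozen_step p n G) (tree_density n k) - tree_density n k G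
    - (real k * (\<Sum>a\<in>{1..<k}. tree_density n a G * tree_density n (k - a) G) / real n
       - 2 * real k * tree_density n k G * (1 - (1 - p) * frozen_fraction n G) / real n)\<bar>
    \<le> 4 * (real k ^ 2 + 2 * real k) / (real n)\<^sup>2"
proof -
  define N \<kappa> \<Sigma> Y where "N = real n" and "\<kappa> = real k ^ 2 + 2 * real k"
    and "\<Sigma> = (\<Sum>i\<in>{1..n}. \<Sum>j\<in>{1..n} - {i}. drift_term p (\<lambda>a. of_bool (a = k)) G i j)"
    and "Y = real k * (\<Sum>a\<in>{1..<k}. tree_density n a G * tree_density n (k - a) G)
       - 2 * real k * tree_density n k G * (1 - (1 - p) * frozen_fraction n G)"
  have N: "2 \<le> N" using n by (simp add: N_def)
  have e1: "(\<Sum>a\<in>{1..<k}. size_count n a G * size_count n (k - a) G) = N\<^sup>2 * (\<Sum>a\<in>{1..<k}. tree_density n a G * tree_density n (k - a) G)"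
    unfolding sum_distrib_left by (rule sum.cong) (use N in \<open>auto simp: tree_density_def N_def power2_eq_square\<close>)
  have e2: "tree_sum n (\<lambda>_. 1) G + p * frozen_count n G = N * (1 - (1 - p) * frozen_fraction n G)"
    unfolding tree_sum_one[OF wf] frozen_fraction_def using N by (simp add: N_def field_simps)
  have e3: "size_count n k G = N * tree_density n k G" using N by (simp add: tree_density_def N_def)
  have "real k * (\<Sum>a\<in>{1..<k}. size_count n a G * size_count n (k - a) G)
       - 2 * real k * size_count n k G * (tree_sum n (\<lambda>_. 1) G + p * frozen_count n G) = N\<^sup>2 * Y"
    unfolding e1 e2 e3 Y_def power2_eq_square by (simp add: right_diff_distrib mult_ac)
  then have 1: "\<bar>\<Sigma> - N\<^sup>2 * Y\<bar> \<le> N * \<kappa>"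
    using drift_size_count[OF wf p, of k] by (simp only: \<Sigma>_def \<kappa>_def N_def)
  have 2: "\<bar>Y\<bar> \<le> \<kappa>"
  proof -
    let ?s = "\<Sum>a\<in>{1..<k}. tree_density n a G * tree_density n (k - a) G"
    let ?c = "1 - (1 - p) * frozen_fraction n G"
    have "?s \<le> (\<Sum>a\<in>{1..<k}. 1 * 1)" by (intro sum_mono mult_mono tree_density_bounds) auto
    then have "?s \<le> real k" by simp
    then have "real k * ?s \<le> real k ^ 2" by (simp add: power2_eq_square mult_left_mono)
    moreover have "0 \<le> real k * ?s" by (intro mult_nonneg_nonneg sum_nonneg tree_density_bounds) auto
    moreover have c: "0 \<le> ?c" "?c \<le> 1"
      using frozen_fraction_bounds[of n G] p mult_le_one[of "1 - p" "frozen_fraction n G"] by auto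
    have "tree_density n k G * ?c \<le> 1 * 1" using c by (intro mult_mono tree_density_bounds) auto
    then have "2 * real k * (tree_density n k G * ?c) \<le> 2 * real k * 1" by (intro mult_left_mono) auto
    moreover have "0 \<le> 2 * real k * (tree_density n k G * ?c)" using c by (intro mult_nonneg_nonneg tree_density_bounds) auto
    ultimately show ?thesis unfolding Y_def \<kappa>_def by (simp add: mult.assoc)
  qed
  have "measure_pmf.expectation (frozen_step p n G) (tree_density n k) = (size_count n k G + \<Sigma> / (N * (N - 1))) / N"
    unfolding tree_density_def[abs_def] using expectation_tree_sum[OF n p wf, of "\<lambda>a. of_bool (a = k)"] by (simp add: \<Sigma>_def N_def)
  then have A: "measure_pmf.expectation (frozen_step p n G) (tree_density n k) - tree_density n k G - Y / N
    = (\<Sigma> - N\<^sup>2 * Y) / (N * (N * (N - 1))) + Y / (N * (N - 1))"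
  proof -
    have "(S + \<Sigma> / (N * (N - 1))) / N - S / N - Y / N = (\<Sigma> - N\<^sup>2 * Y) / (N * (N * (N - 1))) + Y / (N * (N - 1))" for S
      using N by (simp add: divide_simps) (simp add: algebra_simps power2_eq_square)
    then show ?thesis unfolding \<open>measure_pmf.expectation (frozen_step p n G) (tree_density n k) = _\<close>
      by (simp only: tree_density_def N_def)
  qed
  have B: "\<bar>(\<Sigma> - N\<^sup>2 * Y) / (N * (N * (N - 1)))\<bar> \<le> (N * \<kappa>) / (N * (N * (N - 1)))"
    unfolding abs_divide using 1 N by (intro frac_le) auto
  have C: "(N * \<kappa>) / (N * (N * (N - 1))) = \<kappa> / (N * (N - 1))" using N by simp
  have D: "\<bar>Y / (N * (N - 1))\<bar> \<le> \<kappa> / (N * (N - 1))" unfolding abs_divide using 2 N by (intro frac_le) auto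
  have "\<bar>measure_pmf.expectation (frozen_step p n G) (tree_density n k) - tree_density n k G - Y / N\<bar> \<le> 2 * (\<kappa> / (N * (N - 1)))"
  proof -
    have "x = a + b \<Longrightarrow> \<bar>a\<bar> \<le> c \<Longrightarrow> c = d \<Longrightarrow> \<bar>b\<bar> \<le> d \<Longrightarrow> \<bar>x\<bar> \<le> 2 * d" for x a b c d :: real by linarith
    from this[OF A B C D] show ?thesis .
  qed
  also have "\<kappa> / (N * (N - 1)) \<le> \<kappa> / (N * (N / 2))" using N by (intro divide_left_mono) (auto simp: \<kappa>_def)
  also have "2 * (\<kappa> / (N * (N / 2))) = 4 * \<kappa> / N\<^sup>2" by (simp add: power2_eq_square)
  finally show ?thesis by (simp add: Y_def \<kappa>_def N_def diff_divide_distrib)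
qed

lemma tree_density_step:
  assumes n: "2 \<le> n" and wf: "wf_state n G" and G': "G' \<in> set_pmf (frozen_step p n G)"
  shows "\<bar>tree_density n k G' - tree_density n k G\<bar> \<le> 2 * real k / real n"
  using size_count_step[OF assms, of k] n
  unfolding tree_density_def diff_divide_distrib[symmetric] abs_divide by (simp add: divide_right_mono)

text \<open>Random counterpart of \<open>2 * t - 2 * (1 - p) * A\<close>. Only the strict past
  enters, so the damping of \<open>G # hs\<close> does not depend on G and leaves the conditional
  expectation as a constant.\<close>

definition damping :: "real \<Rightarrow> nat \<Rightarrow> multigraph list \<Rightarrow> real" where
  "damping p n hs = 2 / real n * (\<Sum>G\<leftarrow>tl hs. 1 - (1 - p) * frozen_fraction n G)"

text \<open>Multiplying the density by the random factor, instead of dividing \<open>smol\<close> by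
  it, leaves a deterministic comparison function. \<open>length (tl hs)\<close> is the number of
  steps made.\<close>

definition deviation :: "real \<Rightarrow> nat \<Rightarrow> nat \<Rightarrow> multigraph list \<Rightarrow> real" where
  "deviation p n k hs = exp (real k * damping p n hs) * tree_density n k (hd hs) - smol k (real (length (tl hs)) / real n)"

lemma abs_diff_add_le:
  fixes a b c :: real
  shows "\<bar>a\<bar> \<le> x \<Longrightarrow> \<bar>b\<bar> \<le> y \<Longrightarrow> \<bar>c\<bar> \<le> z \<Longrightarrow> \<bar>a - b + c\<bar> \<le> x + y + z"
  by linarith

context
  fixes p :: real
  assumes p: "0 < p" "p \<le> 1"
begin

lemma survival_rate_bounds: "0 \<le> 1 - (1 - p) * frozen_fraction n G" "1 - (1 - p) * frozen_fraction n G \<le> 1"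
  using frozen_fraction_bounds[of n G] p mult_le_one[of "1 - p" "frozen_fraction n G"] by auto

lemma damping_bounds: "0 \<le> damping p n hs" "damping p n hs \<le> 2 * (real (length (tl hs)) / real n)"
proof -
  have "0 \<le> (\<Sum>G\<leftarrow>xs. 1 - (1 - p) * frozen_fraction n G) \<and> (\<Sum>G\<leftarrow>xs. 1 - (1 - p) * frozen_fraction n G) \<le> real (length xs)" for xs
  proof (induction xs)
    case (Cons G xs)
    then show ?case using survival_rate_bounds[of n G] by auto
  qed simp
  from this[of "tl hs"] show "0 \<le> damping p n hs" "damping p n hs \<le> 2 * (real (length (tl hs)) / real n)"
    unfolding damping_def by (auto simp: divide_right_mono)
qed

lemma damping_Cons:
  "hs \<noteq> [] \<Longrightarrow> damping p n (G # hs) = 2 / real n * (1 - (1 - p) * frozen_fraction n (hd hs)) + damping p n hs"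
  unfolding damping_def by (cases hs) (simp_all add: algebra_simps)

text \<open>Since \<open>e i * e (k - i) = e k\<close>, the gain term times the integrating factor
  is the quadratic form of \<open>smol_deriv\<close> in the quantities \<open>e i * \<nu> i\<close>,
  and its deviation is bounded linearly by the deviations of smaller sizes. The mean increment thus
  adds a multiple of the sum of squares divided by n, up to order 1 / n^2, and the squared jump is
  itself of order 1 / n^2.\<close>

lemma deviation_step:
  assumes T: "0 \<le> T"
  obtains C where "0 \<le> C" "\<And>n hs. 2 \<le> n \<Longrightarrow> hs \<noteq> [] \<Longrightarrow> wf_state n (hd hs) \<Longrightarrow> real (length hs) \<le> T * real n \<Longrightarrow>
    measure_pmf.expectation (frozen_step p n (hd hs)) (\<lambda>G. \<Sum>k\<in>{1..<K}. (deviation p n k (G # hs))\<^sup>2)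
    \<le> (1 + C / real n) * (\<Sum>k\<in>{1..<K}. (deviation p n k hs)\<^sup>2) + C / (real n)\<^sup>2"
proof -
  obtain B where B: "1 \<le> B" "\<And>k s. k < K \<Longrightarrow> 0 \<le> s \<Longrightarrow> s \<le> T \<Longrightarrow> smol k s \<le> B"
    "\<And>k s h. k < K \<Longrightarrow> 0 \<le> s \<Longrightarrow> 0 \<le> h \<Longrightarrow> s + h \<le> T \<Longrightarrow> \<bar>smol k (s + h) - smol k s\<bar> \<le> B * h"
    "\<And>k s h. k < K \<Longrightarrow> 0 \<le> s \<Longrightarrow> 0 \<le> h \<Longrightarrow> s + h \<le> T \<Longrightarrow>
       \<bar>smol k (s + h) - smol k s - h * (real k * (\<Sum>i\<in>{1..<k}. smol i s * smol (k - i) s))\<bar> \<le> B * h\<^sup>2"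
    using smol_bounds[OF T, of K] by blast
  define L M where "L = real K" and "M = exp (L * (2 * T))"
  have L: "0 \<le> L" by (simp add: L_def)
  have M: "1 \<le> M" using T L by (simp add: M_def)
  \<comment> \<open>\<open>C1 / n\<close> bounds a jump and \<open>C2 / n * R + C3 / n^2\<close> the
    mean increment; M bounds the integrating factors, since the damping is at most 2 T.\<close>
  define C1 C2 C3 where "C1 = M * (4 * L * exp L) + B" and "C2 = L * (M + B)"
    and "C3 = M * (8 * L\<^sup>2 * exp L + 4 * (L\<^sup>2 + 2 * L)) + B"
  have C_nonneg: "0 \<le> C1" "0 \<le> C2" "0 \<le> C3" using L M B(1) by (auto simp: C1_def C2_def C3_def)
  define C4 where "C4 = 2 * (M + B) * C3 + C1\<^sup>2"
  have C4: "0 \<le> C4" using C_nonneg M B(1) by (simp add: C4_def)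
  have single: "measure_pmf.expectation (frozen_step p n (hd hs)) (\<lambda>G. (deviation p n k (G # hs))\<^sup>2)
    \<le> (deviation p n k hs)\<^sup>2 + C2 * (L + 1) / real n * (\<Sum>i\<in>{1..<K}. (deviation p n i hs)\<^sup>2) + C4 / (real n)\<^sup>2"
    if n: "2 \<le> n" and hs: "hs \<noteq> []" and wf: "wf_state n (hd hs)" and len: "real (length hs) \<le> T * real n"
      and k: "k \<in> {1..<K}" for n hs k
  proof -
    define N s h e q \<nu> X where "N = real n" and "s = real (length (tl hs)) / N" and "h = 1 / N"
      and "e = (\<lambda>i. exp (real i * damping p n hs))" and "q = 2 / N * (1 - (1 - p) * frozen_fraction n (hd hs))"
      and "\<nu> = (\<lambda>i. tree_density n i (hd hs))" and "X = (\<lambda>i. deviation p n i hs)"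
    note intb = integrable_frozen_step[OF n]
    have N: "2 \<le> N" using n by (simp add: N_def)
    have len': "real (length hs) = N * s + 1" using hs N by (cases hs) (auto simp: s_def)
    have s: "0 \<le> s" "0 \<le> h" "s + h \<le> T"
    proof -
      have "N * s + 1 \<le> T * N" using len len' by (simp add: N_def)
      then have "(N * s + 1) / N \<le> T" using N by (simp add: divide_le_eq)
      then show "s + h \<le> T" using N by (simp add: h_def add_divide_distrib)
    qed (use N in \<open>auto simp: s_def h_def\<close>)
    have X_eq: "X i = e i * \<nu> i - smol i s" for i
      by (simp add: X_def deviation_def e_def \<nu>_def s_def N_def)
    have q: "0 \<le> q" "q \<le> 2 / N"
      using survival_rate_bounds[of n "hd hs"] N mult_left_mono[of "1 - (1 - p) * frozen_fraction n (hd hs)" 1 "2 / N"]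
      by (auto simp: q_def)
    have e: "1 \<le> e i" "i < K \<Longrightarrow> e i \<le> M" for i
    proof -
      show "1 \<le> e i" using damping_bounds(1)[of n hs] by (simp add: e_def)
      have "damping p n hs \<le> 2 * T" using damping_bounds(2)[of n hs] s by (simp add: s_def N_def)
      then show "e i \<le> M" if "i < K" unfolding e_def M_def L_def
        using that damping_bounds(1)[of n hs] by (auto intro!: mult_mono)
    qed
    have \<nu>: "0 \<le> \<nu> i" "\<nu> i \<le> 1" for i using tree_density_bounds by (auto simp: \<nu>_def)
    have kL: "real k \<le> L" "0 \<le> real k" using k by (auto simp: L_def)
    define Y where "Y G = exp (real k * q) * tree_density n k G - \<nu> k" for G
    have dev_Cons: "deviation p n k (G # hs) = X k + (e k * Y G - (smol k (s + h) - smol k s))" for G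
    proof -
      have "real (length hs) / N = s + h" unfolding len' using N by (simp add: add_divide_distrib h_def)
      moreover have "damping p n (G # hs) = q + damping p n hs" using damping_Cons[OF hs] by (simp add: q_def N_def)
      moreover have "exp (real k * (q + damping p n hs)) = exp (real k * q) * e k"
        by (simp only: e_def distrib_left exp_add)
      ultimately show ?thesis
        unfolding deviation_def X_eq Y_def by (simp add: N_def[symmetric] algebra_simps)
    qed
    have ekq: "exp (real k * q) \<le> exp L" "\<bar>exp (real k * q) - 1\<bar> \<le> 2 * L / N * exp L"
    proof -
      have kq: "real k * q \<le> L * (2 / N)" using kL q by (intro mult_mono) auto
      have "L * (2 / N) \<le> L * 1" using N L by (intro mult_left_mono) auto
      then show 1: "exp (real k * q) \<le> exp L" using kq by simp
      have "\<bar>exp (real k * q) - 1\<bar> \<le> (real k * q) * exp (real k * q)" by (rule exp_minus_1_le) (use q in simp)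
      also have "\<dots> \<le> (L * (2 / N)) * exp L" by (rule mult_mono[OF kq 1]) (use L N in auto)
      finally show "\<bar>exp (real k * q) - 1\<bar> \<le> 2 * L / N * exp L" by (simp add: mult_ac)
    qed
    have step: "\<bar>tree_density n k G - \<nu> k\<bar> \<le> 2 * real k / N" if "G \<in> set_pmf (frozen_step p n (hd hs))" for G
      using tree_density_step[OF n wf that] by (simp add: \<nu>_def N_def)
    have step_dev: "\<bar>e k * Y G - (smol k (s + h) - smol k s)\<bar> \<le> C1 / N" if G: "G \<in> set_pmf (frozen_step p n (hd hs))" for G
    proof -
      have "Y G = exp (real k * q) * (tree_density n k G - \<nu> k) + (exp (real k * q) - 1) * \<nu> k"
        by (simp add: Y_def algebra_simps)
      moreover have "\<bar>exp (real k * q) * (tree_density n k G - \<nu> k)\<bar> \<le> exp L * (2 * L / N)"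
      proof -
        have "2 * real k / N \<le> 2 * L / N" using kL N by (intro divide_right_mono) auto
        then show ?thesis unfolding abs_mult using ekq(1) step[OF G] by (intro mult_mono) auto
      qed
      moreover have "\<bar>(exp (real k * q) - 1) * \<nu> k\<bar> \<le> (2 * L / N * exp L) * 1"
        unfolding abs_mult using ekq(2) \<nu>[of k] N L by (intro mult_mono) auto
      moreover have "exp L * (2 * L / N) + (2 * L / N * exp L) * 1 = 4 * L * exp L / N" by (simp add: add_divide_distrib[symmetric])
      ultimately have "\<bar>Y G\<bar> \<le> 4 * L * exp L / N" by linarith
      then have "\<bar>e k * Y G\<bar> \<le> M * (4 * L * exp L / N)" unfolding abs_mult using e[of k] k M
        by (intro mult_mono) auto
      moreover have "\<bar>smol k (s + h) - smol k s\<bar> \<le> B * h" using B(3)[of k s h] k s by simp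
      ultimately have "\<bar>e k * Y G - (smol k (s + h) - smol k s)\<bar> \<le> M * (4 * L * exp L / N) + B * h" by linarith
      also have "\<dots> = C1 / N" by (simp add: C1_def h_def add_divide_distrib)
      finally show ?thesis .
    qed
    let ?E = "measure_pmf.expectation (frozen_step p n (hd hs))"
    define d \<sigma> where "d = ?E (tree_density n k) - \<nu> k" and "\<sigma> = (\<Sum>i\<in>{1..<k}. \<nu> i * \<nu> (k - i))"
    have EY: "?E Y = exp (real k * q) * (\<nu> k + d) - \<nu> k"
      by (simp add: Y_def[abs_def] d_def intb)
    have d1: "\<bar>d\<bar> \<le> 2 * real k / N"
    proof -
      have "d = ?E (\<lambda>G. tree_density n k G - \<nu> k)" by (simp add: d_def intb)
      also have "\<bar>\<dots>\<bar> \<le> ?E (\<lambda>G. \<bar>tree_density n k G - \<nu> k\<bar>)" by (rule integral_abs_bound)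
      also have "\<dots> \<le> 2 * real k / N"
        by (rule measure_pmf.integral_le_const[OF intb]) (simp add: AE_measure_pmf_iff step)
      finally show ?thesis .
    qed
    have d2: "\<bar>d - (real k * \<sigma> / N - real k * q * \<nu> k)\<bar> \<le> 4 * (real k ^ 2 + 2 * real k) / N\<^sup>2"
    proof -
      have "real k * q * \<nu> k = 2 * real k * \<nu> k * (1 - (1 - p) * frozen_fraction n (hd hs)) / N"
        by (simp add: q_def)
      then show ?thesis using tree_density_drift[OF n _ p(2) wf, of k] p by (simp only: d_def \<sigma>_def \<nu>_def N_def less_imp_le)
    qed
    have EY_bound: "\<bar>?E Y - real k * \<sigma> / N\<bar> \<le> (8 * L\<^sup>2 * exp L + 4 * (L\<^sup>2 + 2 * L)) / N\<^sup>2"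
    proof -
      have "\<bar>?E Y - real k * \<sigma> / N\<bar> \<le> (8 * (real k)\<^sup>2 * exp (real k) + 4 * (real k ^ 2 + 2 * real k)) / N\<^sup>2"
        unfolding EY by (rule integrating_factor_drift[OF N _ q \<nu> d1 d2]) simp
      also have "\<dots> \<le> (8 * L\<^sup>2 * exp L + 4 * (L\<^sup>2 + 2 * L)) / N\<^sup>2"
        using kL by (intro divide_right_mono add_mono mult_mono power_mono) auto
      finally show ?thesis .
    qed
    define R where "R = (\<Sum>i\<in>{1..<K}. \<bar>X i\<bar>)"
    have conv: "\<bar>e k * \<sigma> - (\<Sum>i\<in>{1..<k}. smol i s * smol (k - i) s)\<bar> \<le> (M + B) * R"
    proof -
      have ek: "e k * \<sigma> = (\<Sum>i\<in>{1..<k}. (e i * \<nu> i) * (e (k - i) * \<nu> (k - i)))"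
        unfolding \<sigma>_def sum_distrib_left
      proof (rule sum.cong[OF refl])
        fix i assume "i \<in> {1..<k}"
        then have "real k * damping p n hs = real i * damping p n hs + real (k - i) * damping p n hs"
          by (simp add: of_nat_diff algebra_simps)
        then have "e k = e i * e (k - i)" unfolding e_def by (simp only: exp_add)
        then show "e k * (\<nu> i * \<nu> (k - i)) = (e i * \<nu> i) * (e (k - i) * \<nu> (k - i))" by simp
      qed
      have "\<bar>e k * \<sigma> - (\<Sum>i\<in>{1..<k}. smol i s * smol (k - i) s)\<bar> \<le>
        (\<Sum>i\<in>{1..<k}. \<bar>(e i * \<nu> i) * (e (k - i) * \<nu> (k - i)) - smol i s * smol (k - i) s\<bar>)"
        unfolding ek sum_subtractf[symmetric] by (rule sum_abs)
      also have "\<dots> \<le> (\<Sum>i\<in>{1..<k}. M * \<bar>X i\<bar> + B * \<bar>X (k - i)\<bar>)"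
      proof (rule sum_mono)
        fix i assume i: "i \<in> {1..<k}"
        have "(e i * \<nu> i) * (e (k - i) * \<nu> (k - i)) - smol i s * smol (k - i) s =
          (e (k - i) * \<nu> (k - i)) * X i + smol i s * X (k - i)" by (simp add: X_eq algebra_simps)
        moreover have "\<bar>(e (k - i) * \<nu> (k - i)) * X i\<bar> \<le> (M * 1) * \<bar>X i\<bar>"
        proof -
          have "\<bar>e (k - i) * \<nu> (k - i)\<bar> \<le> M * 1" unfolding abs_mult
            using e[of "k - i"] i k \<nu>[of "k - i"] M by (intro mult_mono) auto
          then show ?thesis unfolding abs_mult by (intro mult_right_mono) auto
        qed
        moreover have "\<bar>smol i s * X (k - i)\<bar> \<le> B * \<bar>X (k - i)\<bar>"
          unfolding abs_mult using B(2)[of i s] smol_nonneg[of s i] i k s by (intro mult_right_mono) auto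
        ultimately show "\<bar>(e i * \<nu> i) * (e (k - i) * \<nu> (k - i)) - smol i s * smol (k - i) s\<bar> \<le> M * \<bar>X i\<bar> + B * \<bar>X (k - i)\<bar>"
          by linarith
      qed
      also have "\<dots> = M * (\<Sum>i\<in>{1..<k}. \<bar>X i\<bar>) + B * (\<Sum>i\<in>{1..<k}. \<bar>X (k - i)\<bar>)"
        by (simp add: sum.distrib sum_distrib_left)
      also have "(\<Sum>i\<in>{1..<k}. \<bar>X (k - i)\<bar>) = (\<Sum>i\<in>{1..<k}. \<bar>X i\<bar>)"
        by (rule sum.reindex_bij_witness[of _ "\<lambda>i. k - i" "\<lambda>i. k - i"]) auto
      also have "M * (\<Sum>i\<in>{1..<k}. \<bar>X i\<bar>) + B * (\<Sum>i\<in>{1..<k}. \<bar>X i\<bar>) = (M + B) * (\<Sum>i\<in>{1..<k}. \<bar>X i\<bar>)"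
        by (simp add: algebra_simps)
      also have "\<dots> \<le> (M + B) * R" unfolding R_def
        using k M B(1) by (intro mult_left_mono sum_mono2) auto
      finally show ?thesis .
    qed
    define \<delta> where "\<delta> G = e k * Y G - (smol k (s + h) - smol k s)" for G
    have E\<delta>: "\<bar>?E \<delta>\<bar> \<le> C2 / N * R + C3 / N\<^sup>2"
    proof -
      let ?b = "\<Sum>i\<in>{1..<k}. smol i s * smol (k - i) s"
      have "?E \<delta> = e k * ?E Y - (smol k (s + h) - smol k s)" by (simp add: \<delta>_def[abs_def] intb)
      also have "\<dots> = e k * (?E Y - real k * \<sigma> / N) - (smol k (s + h) - smol k s - h * (real k * ?b)) + real k / N * (e k * \<sigma> - ?b)"
        by (simp add: h_def algebra_simps)
      finally have 1: "?E \<delta> = \<dots>" .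
      have "\<bar>e k * (?E Y - real k * \<sigma> / N)\<bar> \<le> M * ((8 * L\<^sup>2 * exp L + 4 * (L\<^sup>2 + 2 * L)) / N\<^sup>2)"
        unfolding abs_mult using EY_bound e[of k] k M by (intro mult_mono) auto
      moreover have "\<bar>smol k (s + h) - smol k s - h * (real k * ?b)\<bar> \<le> B * h\<^sup>2"
        using B(4)[of k s h] k s by simp
      moreover have "\<bar>real k / N * (e k * \<sigma> - ?b)\<bar> \<le> L / N * ((M + B) * R)"
        unfolding abs_mult using conv kL N by (intro mult_mono) (auto intro: divide_right_mono)
      ultimately have "\<bar>?E \<delta>\<bar> \<le> M * ((8 * L\<^sup>2 * exp L + 4 * (L\<^sup>2 + 2 * L)) / N\<^sup>2) + B * h\<^sup>2 + L / N * ((M + B) * R)"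
        unfolding 1 by (rule abs_diff_add_le)
      also have "\<dots> = C2 / N * R + C3 / N\<^sup>2"
      proof -
        have "M * (Q / N\<^sup>2) + B * (1 / N)\<^sup>2 + L / N * ((M + B) * R) = L * (M + B) / N * R + (M * Q + B) / N\<^sup>2" for Q
          by (simp add: add_divide_distrib power_divide)
        then show ?thesis by (simp only: C2_def C3_def h_def)
      qed
      finally show ?thesis .
    qed
    have Xk: "\<bar>X k\<bar> \<le> M + B"
    proof -
      have "\<bar>e k * \<nu> k\<bar> \<le> M * 1" unfolding abs_mult using e[of k] k \<nu>[of k] M by (intro mult_mono) auto
      moreover have "\<bar>smol k s\<bar> \<le> B" using B(2)[of k s] smol_nonneg[of s k] k s by simp
      ultimately show ?thesis unfolding X_eq by linarith
    qed
    let ?S = "\<Sum>i\<in>{1..<K}. (X i)\<^sup>2"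
    \<comment> \<open>The cross term becomes a sum of squares by
      \<open>2 * a * b \<le> a^2 + b^2\<close> for each i; the summand of index k is repeated for
      every i, which accounts for L.\<close>
    have XR: "2 * \<bar>X k\<bar> * R \<le> (L + 1) * ?S"
    proof -
      have "2 * \<bar>X k\<bar> * R = (\<Sum>i\<in>{1..<K}. 2 * \<bar>X k\<bar> * \<bar>X i\<bar>)" by (simp add: R_def sum_distrib_left)
      also have "\<dots> \<le> (\<Sum>i\<in>{1..<K}. (X k)\<^sup>2 + (X i)\<^sup>2)"
      proof (rule sum_mono)
        fix i
        show "2 * \<bar>X k\<bar> * \<bar>X i\<bar> \<le> (X k)\<^sup>2 + (X i)\<^sup>2"
          using sum_squares_bound[of "\<bar>X k\<bar>" "\<bar>X i\<bar>"] by simp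
      qed
      also have "\<dots> = real (K - 1) * (X k)\<^sup>2 + ?S" by (simp add: sum.distrib)
      also have "(X k)\<^sup>2 \<le> ?S" by (rule member_le_sum) (use k in auto)
      then have "real (K - 1) * (X k)\<^sup>2 \<le> L * ?S" by (intro mult_mono) (auto simp: L_def sum_nonneg)
      finally show ?thesis by (simp add: algebra_simps)
    qed
    have "?E (\<lambda>G. (deviation p n k (G # hs))\<^sup>2) = ?E (\<lambda>G. (X k)\<^sup>2 + 2 * X k * \<delta> G + (\<delta> G)\<^sup>2)"
      unfolding dev_Cons \<delta>_def[symmetric] by (simp add: power2_sum add_ac)
    also have "\<dots> = (X k)\<^sup>2 + 2 * X k * ?E \<delta> + ?E (\<lambda>G. (\<delta> G)\<^sup>2)"
      by (simp add: intb)
    also have "?E (\<lambda>G. (\<delta> G)\<^sup>2) \<le> (C1 / N)\<^sup>2"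
    proof (rule measure_pmf.integral_le_const[OF intb], unfold AE_measure_pmf_iff, rule ballI)
      fix G assume "G \<in> set_pmf (frozen_step p n (hd hs))"
      from step_dev[OF this] show "(\<delta> G)\<^sup>2 \<le> (C1 / N)\<^sup>2"
        unfolding \<delta>_def[symmetric] by (rule power2_le_iff_abs_le[THEN iffD2, rotated]) (use C_nonneg N in auto)
    qed
    also have "2 * X k * ?E \<delta> \<le> C2 * (L + 1) / N * ?S + 2 * (M + B) * C3 / N\<^sup>2"
    proof -
      have "2 * X k * ?E \<delta> \<le> 2 * \<bar>X k\<bar> * \<bar>?E \<delta>\<bar>"
        using abs_ge_self[of "2 * X k * ?E \<delta>"] by (simp only: abs_mult abs_numeral)
      also have "\<dots> \<le> 2 * \<bar>X k\<bar> * (C2 / N * R + C3 / N\<^sup>2)" using E\<delta> by (intro mult_left_mono) auto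
      also have "\<dots> = C2 / N * (2 * \<bar>X k\<bar> * R) + 2 * \<bar>X k\<bar> * (C3 / N\<^sup>2)" by (simp add: algebra_simps)
      also have "\<dots> \<le> C2 / N * ((L + 1) * ?S) + 2 * (M + B) * (C3 / N\<^sup>2)"
        using XR Xk C_nonneg N by (intro add_mono mult_left_mono mult_right_mono) auto
      finally show ?thesis by (simp add: mult_ac)
    qed
    finally show ?thesis by (simp add: X_def C4_def N_def add_divide_distrib power_divide)
  qed
  define C where "C = L * (C2 * (L + 1)) + L * C4"
  show thesis
  proof
    show "0 \<le> C" using C_nonneg C4 L by (simp add: C_def)
    fix n hs assume n: "2 \<le> n" and hs: "hs \<noteq> []" and wf: "wf_state n (hd hs)" and len: "real (length hs) \<le> T * real n"
    let ?E = "measure_pmf.expectation (frozen_step p n (hd hs))"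
    let ?S = "\<Sum>i\<in>{1..<K}. (deviation p n i hs)\<^sup>2"
    have S: "0 \<le> ?S" by (simp add: sum_nonneg)
    have "?E (\<lambda>G. \<Sum>k\<in>{1..<K}. (deviation p n k (G # hs))\<^sup>2) = (\<Sum>k\<in>{1..<K}. ?E (\<lambda>G. (deviation p n k (G # hs))\<^sup>2))"
      by (rule Bochner_Integration.integral_sum) (rule integrable_frozen_step[OF n])
    also have "\<dots> \<le> (\<Sum>k\<in>{1..<K}. (deviation p n k hs)\<^sup>2 + (C2 * (L + 1) / real n * ?S + C4 / (real n)\<^sup>2))"
      using single[OF n hs wf len] by (intro sum_mono) (simp add: add.assoc)
    also have "\<dots> = ?S + real (K - 1) * (C2 * (L + 1) / real n * ?S + C4 / (real n)\<^sup>2)"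
      by (simp add: sum.distrib)
    also have "\<dots> \<le> ?S + L * (C2 * (L + 1) / real n * ?S + C4 / (real n)\<^sup>2)"
      using C_nonneg C4 L S by (intro add_left_mono mult_right_mono) (auto simp: L_def intro!: add_nonneg_nonneg mult_nonneg_nonneg)
    also have "\<dots> = ?S + (L * (C2 * (L + 1))) / real n * ?S + (L * C4) / (real n)\<^sup>2"
      by (simp add: distrib_left)
    also have "\<dots> \<le> ?S + C / real n * ?S + C / (real n)\<^sup>2"
      using C_nonneg C4 L S by (intro add_mono mult_right_mono divide_right_mono) (auto simp: C_def)
    finally show "?E (\<lambda>G. \<Sum>k\<in>{1..<K}. (deviation p n k (G # hs))\<^sup>2) \<le> (1 + C / real n) * ?S + C / (real n)\<^sup>2"
      by (simp add: distrib_right)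
  qed
qed

text \<open>Discrete Gronwall: the initial deviation is 0, each of the at most T n steps adds
  \<open>C / n^2\<close>, and the accumulated growth factor stays below
  \<open>exp (C * T)\<close>.\<close>

lemma deviation_bound:
  assumes T: "0 \<le> T"
  obtains C where "0 \<le> C" "\<And>n m. 2 \<le> n \<Longrightarrow> real m \<le> T * real n \<Longrightarrow>
    measure_pmf.expectation (path_law p n m) (\<lambda>hs. \<Sum>k\<in>{1..<K}. (deviation p n k hs)\<^sup>2) \<le> C / real n"
proof -
  obtain C where C: "0 \<le> C" and step: "\<And>n hs. 2 \<le> n \<Longrightarrow> hs \<noteq> [] \<Longrightarrow> wf_state n (hd hs) \<Longrightarrow> real (length hs) \<le> T * real n \<Longrightarrow>
    measure_pmf.expectation (frozen_step p n (hd hs)) (\<lambda>G. \<Sum>k\<in>{1..<K}. (deviation p n k (G # hs))\<^sup>2)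
    \<le> (1 + C / real n) * (\<Sum>k\<in>{1..<K}. (deviation p n k hs)\<^sup>2) + C / (real n)\<^sup>2"
    using deviation_step[OF T, of K] by blast
  have "measure_pmf.expectation (path_law p n m) (\<lambda>hs. \<Sum>k\<in>{1..<K}. (deviation p n k hs)\<^sup>2) \<le> (C * T * exp (C * T)) / real n"
    if n: "2 \<le> n" and m: "real m \<le> T * real n" for n m
  proof -
    have N: "0 < real n" using n by simp
    have "real m \<le> T * real n \<Longrightarrow> measure_pmf.expectation (path_law p n m) (\<lambda>hs. \<Sum>k\<in>{1..<K}. (deviation p n k hs)\<^sup>2)
      \<le> C / (real n)\<^sup>2 * real m * (1 + C / real n) ^ m"
    proof (induction m)
      case 0
      have "deviation p n k [{#}] = 0" if "k \<in> {1..<K}" for k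
      proof -
        have "size_count n k {#} = (\<Sum>v\<in>{1..n}. of_bool (k = 1))"
          unfolding tree_sum_def by (rule sum.cong) (auto simp: in_tree_empty component_empty)
        then show ?thesis using N by (simp add: deviation_def damping_def tree_density_def smol_at_0)
      qed
      then show ?case by simp
    next
      case (Suc m)
      let ?S = "\<lambda>hs. \<Sum>k\<in>{1..<K}. (deviation p n k hs)\<^sup>2"
      let ?r = "1 + C / real n"
      have r: "1 \<le> ?r" using C N by simp
      have "measure_pmf.expectation (path_law p n (Suc m)) ?S \<le> measure_pmf.expectation (path_law p n m) (\<lambda>hs. ?r * ?S hs + C / (real n)\<^sup>2)"
        unfolding expectation_path_law_Suc[OF n]
      proof (rule integral_mono_AE[OF integrable_path_law[OF n] integrable_path_law[OF n]], unfold AE_measure_pmf_iff, rule ballI)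
        fix hs assume "hs \<in> set_pmf (path_law p n m)"
        then have hs: "length hs = Suc m" "wf_state n (hd hs)" using path_law_support[OF n] by blast+
        then show "measure_pmf.expectation (frozen_step p n (hd hs)) (\<lambda>G. ?S (G # hs)) \<le> ?r * ?S hs + C / (real n)\<^sup>2"
          using Suc.prems by (intro step[OF n]) auto
      qed
      also have "\<dots> = ?r * measure_pmf.expectation (path_law p n m) ?S + C / (real n)\<^sup>2"
        by (simp add: integrable_path_law[OF n])
      also have "\<dots> \<le> ?r * (C / (real n)\<^sup>2 * real m * ?r ^ m) + C / (real n)\<^sup>2 * ?r ^ Suc m"
      proof (rule add_mono)
        show "?r * measure_pmf.expectation (path_law p n m) ?S \<le> ?r * (C / (real n)\<^sup>2 * real m * ?r ^ m)"
          by (rule mult_left_mono) (use Suc r in auto)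
        show "C / (real n)\<^sup>2 \<le> C / (real n)\<^sup>2 * ?r ^ Suc m"
          using mult_left_mono[OF one_le_power[OF r, of "Suc m"], of "C / (real n)\<^sup>2"] C by simp
      qed
      also have "\<dots> = C / (real n)\<^sup>2 * real (Suc m) * ?r ^ Suc m"
      proof -
        have "r * (c * real m * r ^ m) + c * r ^ Suc m = c * real (Suc m) * r ^ Suc m" for c r :: real
          by (simp add: algebra_simps)
        then show ?thesis .
      qed
      finally show ?case .
    qed
    also have "\<dots> \<le> C / (real n)\<^sup>2 * (T * real n) * exp (C * T)"
    proof (intro mult_mono)
      have "(1 + C / real n) ^ m \<le> exp (C / real n) ^ m" using C N by (intro power_mono) auto
      also have "\<dots> = exp (real m * (C / real n))" by (simp only: exp_of_nat_mult)
      also have "\<dots> \<le> exp (C * T)"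
      proof -
        have "real m * (C / real n) \<le> T * real n * (C / real n)" using C N m by (intro mult_right_mono) auto
        then show ?thesis using N by (simp add: mult_ac)
      qed
      finally show "(1 + C / real n) ^ m \<le> exp (C * T)" .
    qed (use C T m N in auto)
    also have "\<dots> = (C * T * exp (C * T)) / real n" using N by (simp add: power2_eq_square)
    finally show ?thesis using m by simp
  qed
  moreover have "0 \<le> C * T * exp (C * T)" using C T by simp
  ultimately show thesis using that by blast
qed

end

section \<open>Large trees and convergence of the frozen mass\<close>

definition large_fraction :: "nat \<Rightarrow> nat \<Rightarrow> multigraph \<Rightarrow> real" where
  "large_fraction n K G = tree_sum n (\<lambda>a. of_bool (K \<le> a)) G / real n"

lemma large_fraction_nonneg: "0 \<le> large_fraction n K G"
  by (auto simp: large_fraction_def intro!: divide_nonneg_nonneg tree_sum_nonneg)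

lemma frozen_fraction_eq:
  assumes n: "0 < n" and wf: "wf_state n G"
  shows "1 - frozen_fraction n G = (\<Sum>k\<in>{1..<K}. tree_density n k G) + large_fraction n K G"
proof -
  have "tree_sum n (\<lambda>_. 1) G = (\<Sum>k\<in>{1..<K}. size_count n k G) + tree_sum n (\<lambda>a. of_bool (K \<le> a)) G"
    unfolding tree_sum_def sum.swap[of _ "{1..n}"] sum.distrib[symmetric]
  proof (rule sum.cong[OF refl])
    fix v assume v: "v \<in> {1..n}"
    let ?a = "card (component G v)"
    have "1 \<le> ?a" by (rule card_component_bounds(1)[OF wf v])
    moreover have "(\<Sum>k\<in>{1..<K}. of_bool (?a = k)) = (of_bool (?a \<in> {1..<K}) :: real)"
      by (simp add: of_bool_def)
    ultimately show "(if in_tree G v then 1 else 0) = (\<Sum>k\<in>{1..<K}. if in_tree G v then of_bool (?a = k) else 0)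
      + (if in_tree G v then of_bool (K \<le> ?a) else (0::real))" by auto
  qed
  then have "1 - frozen_fraction n G = ((\<Sum>k\<in>{1..<K}. size_count n k G) + tree_sum n (\<lambda>a. of_bool (K \<le> a)) G) / real n"
    unfolding tree_sum_one[OF wf, symmetric] frozen_fraction_def using n tree_sum_one[OF wf] by (simp add: field_simps)
  then show ?thesis by (simp add: large_fraction_def tree_density_def add_divide_distrib sum_divide_distrib)
qed

text \<open>A left Riemann sum of \<gamma> over the steps already made; by
  \<open>damping_occupation\<close> it and the elapsed time determine the damping.\<close>

definition occupation :: "nat \<Rightarrow> multigraph list \<Rightarrow> real" where
  "occupation n hs = (\<Sum>G\<leftarrow>tl hs. frozen_fraction n G) / real n"

lemma occupation_Cons: "hs \<noteq> [] \<Longrightarrow> occupation n (G # hs) = occupation n hs + frozen_fraction n (hd hs) / real n"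
  unfolding occupation_def by (cases hs) (simp_all add: add_divide_distrib)

lemma occupation_bounds: "0 \<le> occupation n hs" "occupation n hs \<le> real (length (tl hs)) / real n"
proof -
  have "0 \<le> (\<Sum>G\<leftarrow>xs. frozen_fraction n G) \<and> (\<Sum>G\<leftarrow>xs. frozen_fraction n G) \<le> real (length xs)" for xs
  proof (induction xs)
    case (Cons G xs)
    then show ?case using frozen_fraction_bounds[of n G] by auto
  qed simp
  from this[of "tl hs"] show "0 \<le> occupation n hs" "occupation n hs \<le> real (length (tl hs)) / real n"
    unfolding occupation_def by (auto simp: divide_right_mono)
qed

lemma damping_occupation: "damping p n hs = 2 * (real (length (tl hs)) / real n) - 2 * (1 - p) * occupation n hs"
proof -
  have "(\<Sum>G\<leftarrow>xs. 1 - (1 - p) * frozen_fraction n G) = real (length xs) - (1 - p) * (\<Sum>G\<leftarrow>xs. frozen_fraction n G)" for xs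
    by (induction xs) (auto simp: algebra_simps)
  then show ?thesis by (simp add: damping_def occupation_def diff_divide_distrib right_diff_distrib)
qed

definition discrepancy :: "real \<Rightarrow> nat \<Rightarrow> multigraph list \<Rightarrow> real" where
  "discrepancy p n hs = occupation n hs - limit_integral p (real (length (tl hs)) / real n)"

context
  fixes p :: real
  assumes p: "0 < p" "p \<le> 1"
begin

text \<open>The mean potential starts at \<open>2 * n / K\<close> and stays nonnegative, so its net
  expected decrease is at most that. For fixed K and m of order n the first term of the bound stays
  bounded, and what remains is of order 1 / K per step.\<close>

lemma sum_large_fraction:
  assumes n: "2 \<le> n" and K: "1 \<le> K"
  shows "(\<Sum>l<m. measure_pmf.expectation (path_law p n l) (\<lambda>hs. (large_fraction n K (hd hs))\<^sup>2))
    \<le> real m * (real K + 1) / real n + 2 * real n / real K"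
proof -
  define E :: "nat \<Rightarrow> (multigraph list \<Rightarrow> real) \<Rightarrow> real"
    where "E = (\<lambda>l. measure_pmf.expectation (path_law p n l))"
  define N V where "N = real n"
    and "V = (\<lambda>hs. tree_sum n (\<lambda>a. of_bool (K \<le> a)) (hd hs))"
  have N: "2 \<le> N" using n by (simp add: N_def)
  have p': "0 \<le> p" using p by simp
  note int = integrable_path_law[OF n]
  have "E m (\<lambda>hs. large_potential n K (hd hs)) + (\<Sum>l<m. (E l (\<lambda>hs. (V hs)\<^sup>2) - N * (real K + 1)) / (N * (N - 1))) \<le> 2 * N / real K" for m
  proof (induction m)
    case 0
    have "large_potential n K {#} = (\<Sum>v\<in>{1..n}. 2 / real K)"
      unfolding large_potential_def tree_sum_def by (rule sum.cong) (use K in \<open>auto simp: in_tree_empty component_empty max_def\<close>)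
    then show ?case by (simp add: E_def N_def mult.commute)
  next
    case (Suc m)
    have "E (Suc m) (\<lambda>hs. large_potential n K (hd hs)) = E m (\<lambda>hs. measure_pmf.expectation (frozen_step p n (hd hs)) (large_potential n K))"
      unfolding E_def expectation_path_law_Suc[OF n] by simp
    also have "\<dots> \<le> E m (\<lambda>hs. large_potential n K (hd hs) - ((V hs)\<^sup>2 - N * (real K + 1)) / (N * (N - 1)))"
      unfolding E_def
    proof (rule integral_mono_AE[OF int int], unfold AE_measure_pmf_iff, rule ballI)
      fix hs assume "hs \<in> set_pmf (path_law p n m)"
      then have "wf_state n (hd hs)" using path_law_support[OF n] by blast
      from expectation_large_potential[OF n p' p(2) this K]
      show "measure_pmf.expectation (frozen_step p n (hd hs)) (large_potential n K) \<le>
        large_potential n K (hd hs) - ((V hs)\<^sup>2 - N * (real K + 1)) / (N * (N - 1))" by (simp add: V_def N_def)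
    qed
    also have "\<dots> = E m (\<lambda>hs. large_potential n K (hd hs)) - (E m (\<lambda>hs. (V hs)\<^sup>2) - N * (real K + 1)) / (N * (N - 1))"
      unfolding E_def by (simp add: int)
    finally show ?case using Suc by simp
  qed
  then have pot: "E m (\<lambda>hs. large_potential n K (hd hs)) + (\<Sum>l<m. (E l (\<lambda>hs. (V hs)\<^sup>2) - N * (real K + 1)) / (N * (N - 1))) \<le> 2 * N / real K" .
  have "0 \<le> E m (\<lambda>hs. large_potential n K (hd hs))" unfolding E_def
    by (rule Bochner_Integration.integral_nonneg) (simp add: large_potential_def tree_sum_nonneg)
  with pot have "(\<Sum>l<m. (E l (\<lambda>hs. (V hs)\<^sup>2) - N * (real K + 1)) / (N * (N - 1))) \<le> 2 * N / real K" by linarith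
  then have "((\<Sum>l<m. E l (\<lambda>hs. (V hs)\<^sup>2)) - real m * (N * (real K + 1))) / (N * (N - 1)) \<le> 2 * N / real K"
    by (simp add: sum_divide_distrib[symmetric] sum_subtractf)
  then have "(\<Sum>l<m. E l (\<lambda>hs. (V hs)\<^sup>2)) - real m * (N * (real K + 1)) \<le> 2 * N / real K * (N * (N - 1))"
    using N by (subst (asm) pos_divide_le_eq) auto
  also have "\<dots> \<le> 2 * N / real K * (N * N)" using N by (intro mult_left_mono) auto
  finally have "(\<Sum>l<m. E l (\<lambda>hs. (V hs)\<^sup>2)) \<le> real m * (N * (real K + 1)) + 2 * N / real K * (N * N)" by simp
  then have "(\<Sum>l<m. E l (\<lambda>hs. (V hs)\<^sup>2)) / N\<^sup>2 \<le> (real m * (N * (real K + 1)) + 2 * N / real K * (N * N)) / N\<^sup>2"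
    by (rule divide_right_mono) simp
  also have "\<dots> = real m * (real K + 1) / N + 2 * N / real K" using N by (simp add: add_divide_distrib power2_eq_square)
  finally show ?thesis
    by (simp add: E_def V_def N_def large_fraction_def power_divide sum_divide_distrib)
qed

text \<open>The map \<open>A \<mapsto> 1 - \<Sum>\<^sub>k smol k s * exp (- k (2 s - 2 (1 - p) A))\<close> is decreasing, so the drift
  of the discrepancy is directed towards \<open>0\<close> up to the error terms.\<close>

lemma discrepancy_step:
  assumes n: "2 \<le> n" and hs: "hs \<noteq> []" and wf: "wf_state n (hd hs)" and len: "real (length hs) \<le> T * real n"
    and s: "s = real (length (tl hs)) / real n"
  shows "(discrepancy p n (G # hs))\<^sup>2 \<le> (discrepancy p n hs)\<^sup>2
    + 2 * T / real n * ((\<Sum>k\<in>{1..<K}. \<bar>deviation p n k hs\<bar>) + large_fraction n K (hd hs) + tree_tail K)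
    + 2 * T / real n * (g_fun p (s + 1 / real n) - g_fun p s) + 1 / (real n)\<^sup>2"
proof -
  define N D \<gamma> A A' where "N = real n" and "D = discrepancy p n hs" and "\<gamma> = frozen_fraction n (hd hs)"
    and "A = limit_integral p s" and "A' = limit_integral p (s + 1 / N)"
  define \<Delta> where "\<Delta> = \<gamma> / N - (A' - A)"
  have N: "2 \<le> N" using n by (simp add: N_def)
  have len': "real (length hs) / N = s + 1 / N" using hs N by (cases hs) (auto simp: s N_def add_divide_distrib)
  have s0: "0 \<le> s" by (simp add: s)
  have sT: "s + 1 / N \<le> T" using len N unfolding len'[symmetric] by (simp add: N_def divide_le_eq)
  have "discrepancy p n (G # hs) = occupation n hs + \<gamma> / N - A'"
    unfolding discrepancy_def occupation_Cons[OF hs] \<gamma>_def A'_def N_def using len' by (simp add: N_def)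
  then have D': "discrepancy p n (G # hs) = D + \<Delta>"
    by (simp add: D_def discrepancy_def \<Delta>_def A_def s)
  note inc = limit_integral_increment[OF p s0, of "s + 1 / N"]
  have inc': "g_fun p s / N \<le> A' - A" "A' - A \<le> g_fun p (s + 1 / N) / N"
    using inc N by (auto simp: A_def A'_def)
  have \<Delta>1: "\<bar>\<Delta>\<bar> \<le> 1 / N"
  proof -
    have "0 \<le> \<gamma> / N" "\<gamma> / N \<le> 1 / N" using frozen_fraction_bounds[of n "hd hs"] N
      by (auto simp: \<gamma>_def divide_right_mono)
    moreover have "0 \<le> g_fun p s / N" "g_fun p (s + 1 / N) / N \<le> 1 / N"
      using g_fun_bounds[OF p] N by (auto intro!: divide_right_mono simp: less_imp_le)
    ultimately show ?thesis using inc' by (simp add: \<Delta>_def abs_le_iff)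
  qed
  have DT: "\<bar>D\<bar> \<le> T"
  proof -
    have "s \<le> T" using sT N by (smt (verit) divide_nonneg_nonneg)
    then show ?thesis using occupation_bounds[of n hs] limit_integral_bounds[OF p s0]
      by (simp add: D_def discrepancy_def s abs_le_iff)
  qed
  define a where "a = damping p n hs"
  \<comment> \<open>The value the damping would have if the discrepancy were 0; \<open>a - b\<close>
    is a nonpositive multiple of \<open>D\<close>.\<close>
  define b where "b = 2 * s - 2 * (1 - p) * A"
  have a: "a = b - 2 * (1 - p) * D"
    by (simp add: a_def b_def damping_occupation D_def discrepancy_def A_def s algebra_simps)
  have a0: "0 \<le> a" using damping_bounds(1)[OF p] by (simp add: a_def)
  define E1 where "E1 = (\<Sum>k\<in>{1..<K}. exp (- real k * a) * deviation p n k hs)"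
  have E1: "\<bar>E1\<bar> \<le> (\<Sum>k\<in>{1..<K}. \<bar>deviation p n k hs\<bar>)"
  proof -
    have "\<bar>E1\<bar> \<le> (\<Sum>k\<in>{1..<K}. \<bar>exp (- real k * a) * deviation p n k hs\<bar>)" unfolding E1_def by (rule sum_abs)
    also have "\<dots> \<le> (\<Sum>k\<in>{1..<K}. 1 * \<bar>deviation p n k hs\<bar>)"
      unfolding abs_mult using a0 by (intro sum_mono mult_right_mono) auto
    finally show ?thesis by simp
  qed
  define F where "F x = (\<Sum>k\<in>{1..<K}. smol k s * exp (- real k * x))" for x
  have "(\<Sum>k\<in>{1..<K}. tree_density n k (hd hs)) = E1 + F a"
    unfolding E1_def F_def sum.distrib[symmetric]
  proof (rule sum.cong[OF refl])
    fix k
    have "exp (- real k * a) * exp (real k * a) = 1" by (simp add: exp_minus)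
    then show "tree_density n k (hd hs) = exp (- real k * a) * deviation p n k hs + smol k s * exp (- real k * a)"
      unfolding deviation_def a_def[symmetric] s[symmetric] by (simp add: right_diff_distrib mult.assoc[symmetric])
  qed
  then have \<gamma>: "\<gamma> = 1 - E1 - F a - large_fraction n K (hd hs)"
    using frozen_fraction_eq[OF _ wf, of K] n by (simp add: \<gamma>_def)
  have gs: "\<bar>1 - g_fun p s - F b\<bar> \<le> tree_tail K"
    using limit_tree_mass[OF p s0, of K] by (simp add: F_def b_def A_def)
  have mono: "D * (F b - F a) \<le> 0"
  proof -
    have F_anti: "F y \<le> F x" if "x \<le> y" for x y
      unfolding F_def using that s0 by (intro sum_mono mult_left_mono smol_nonneg) (auto intro!: mult_left_mono)
    show ?thesis
    proof (cases "0 \<le> D")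
      case True
      then have "a \<le> b" using p by (simp add: a)
      then show ?thesis using F_anti[of a b] True by (simp add: mult_nonneg_nonpos)
    next
      case False
      then have "b \<le> a" using p by (simp add: a mult_nonneg_nonpos)
      then show ?thesis using F_anti[of b a] False by (simp add: mult_nonpos_nonneg)
    qed
  qed
  define err where "err = (\<Sum>k\<in>{1..<K}. \<bar>deviation p n k hs\<bar>) + large_fraction n K (hd hs) + tree_tail K"
  have "D * (\<gamma> - g_fun p s) \<le> T * err"
  proof -
    define r where "r = (1 - E1 - large_fraction n K (hd hs)) - (1 - (1 - g_fun p s - F b))"
    have r: "\<bar>r\<bar> \<le> err" using E1 gs large_fraction_nonneg[of n K "hd hs"] unfolding r_def err_def by linarith
    have "\<gamma> - g_fun p s = (F b - F a) + r" unfolding \<gamma> r_def by simp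
    then have "D * (\<gamma> - g_fun p s) = D * (F b - F a) + D * r" by (simp only: distrib_left)
    also have "\<dots> \<le> \<bar>D\<bar> * \<bar>r\<bar>" using mono abs_ge_self[of "D * r"] by (simp add: abs_mult)
    also have "\<dots> \<le> T * err" using DT r by (intro mult_mono) auto
    finally show ?thesis .
  qed
  then have 1: "2 * D * (\<gamma> - g_fun p s) / N \<le> 2 * T / N * err" using N by (simp add: divide_right_mono)
  \<comment> \<open>By monotonicity the integral over one step differs from the Riemann term by at
    most an increment of g divided by n.\<close>
  have 2: "2 * D * (g_fun p s / N - (A' - A)) \<le> 2 * T / N * (g_fun p (s + 1 / N) - g_fun p s)"
  proof -
    have "\<bar>g_fun p s / N - (A' - A)\<bar> \<le> (g_fun p (s + 1 / N) - g_fun p s) / N" using inc' by (simp add: diff_divide_distrib)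
    then have "\<bar>D\<bar> * \<bar>g_fun p s / N - (A' - A)\<bar> \<le> T * ((g_fun p (s + 1 / N) - g_fun p s) / N)"
      using DT by (intro mult_mono) auto
    moreover have "D * (g_fun p s / N - (A' - A)) \<le> \<bar>D\<bar> * \<bar>g_fun p s / N - (A' - A)\<bar>"
      using abs_ge_self[of "D * (g_fun p s / N - (A' - A))"] by (simp only: abs_mult)
    ultimately show ?thesis by simp
  qed
  have 3: "\<Delta>\<^sup>2 \<le> 1 / N\<^sup>2" using power_mono[OF \<Delta>1, of 2] by (simp add: power_divide)
  have "(D + \<Delta>)\<^sup>2 = D\<^sup>2 + 2 * D * \<Delta> + \<Delta>\<^sup>2" by (simp add: power2_sum)
  also have "2 * D * \<Delta> = 2 * D * (\<gamma> - g_fun p s) / N + 2 * D * (g_fun p s / N - (A' - A))"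
    unfolding \<Delta>_def using N by (simp add: field_simps)
  finally show ?thesis unfolding D' D_def[symmetric] N_def[symmetric] err_def[symmetric] using 1 2 3 by linarith
qed

text \<open>The recursion does not amplify the square, so the errors of the single steps just add
  up; the increments of g telescope to a boundary value.\<close>

lemma expectation_discrepancy:
  assumes n: "2 \<le> n" and m: "real m \<le> T * real n"
  shows "measure_pmf.expectation (path_law p n m) (\<lambda>hs. (discrepancy p n hs)\<^sup>2) \<le>
    2 * T / real n * ((\<Sum>l<m. measure_pmf.expectation (path_law p n l) (\<lambda>hs. \<Sum>k\<in>{1..<K}. \<bar>deviation p n k hs\<bar>))
      + (\<Sum>l<m. measure_pmf.expectation (path_law p n l) (\<lambda>hs. large_fraction n K (hd hs))) + real m * tree_tail K)
    + 2 * T / real n * g_fun p (real m / real n) + real m / (real n)\<^sup>2"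
  using m
proof (induction m)
  case 0
  have "limit_integral p 0 = 0" by (rule limit_integral_0[OF p])
  then show ?case by (simp add: discrepancy_def occupation_def g_fun_early[OF p])
next
  case (Suc m)
  note int = integrable_path_law[OF n]
  let ?E = "\<lambda>l. measure_pmf.expectation (path_law p n l)"
  let ?dev = "\<lambda>hs. \<Sum>k\<in>{1..<K}. \<bar>deviation p n k hs\<bar>" and ?large = "\<lambda>hs. large_fraction n K (hd hs)"
  let ?g = "\<lambda>m. g_fun p (real m / real n)"
  let ?c = "2 * T / real n"
  have "?E (Suc m) (\<lambda>hs. (discrepancy p n hs)\<^sup>2) \<le> ?E m (\<lambda>hs. (discrepancy p n hs)\<^sup>2
    + ?c * (?dev hs + ?large hs + tree_tail K) + (?c * (?g (Suc m) - ?g m) + 1 / (real n)\<^sup>2))"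
    unfolding expectation_path_law_Suc[OF n]
  proof (rule integral_mono_AE[OF int int], unfold AE_measure_pmf_iff, rule ballI)
    fix hs assume "hs \<in> set_pmf (path_law p n m)"
    then have hs: "length hs = Suc m" "wf_state n (hd hs)" using path_law_support[OF n] by blast+
    then have hs': "hs \<noteq> []" "real (length hs) \<le> T * real n" using Suc.prems by auto
    have s: "real m / real n = real (length (tl hs)) / real n" using hs by simp
    have s': "real m / real n + 1 / real n = real (Suc m) / real n" by (simp add: add_divide_distrib)
    show "measure_pmf.expectation (frozen_step p n (hd hs)) (\<lambda>G. (discrepancy p n (G # hs))\<^sup>2) \<le> (discrepancy p n hs)\<^sup>2
      + ?c * (?dev hs + ?large hs + tree_tail K) + (?c * (?g (Suc m) - ?g m) + 1 / (real n)\<^sup>2)"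
      by (rule measure_pmf.integral_le_const[OF integrable_frozen_step[OF n]], rule AE_I2)
        (use discrepancy_step[OF n hs'(1) hs(2) hs'(2) s, of _ K] in \<open>simp only: s' add.assoc\<close>)
  qed
  also have "\<dots> = ?E m (\<lambda>hs. (discrepancy p n hs)\<^sup>2) + ?c * (?E m ?dev + ?E m ?large + tree_tail K)
    + (?c * (?g (Suc m) - ?g m) + 1 / (real n)\<^sup>2)"
    by (simp add: int)
  also have "?E m (\<lambda>hs. (discrepancy p n hs)\<^sup>2) \<le> ?c * ((\<Sum>l<m. ?E l ?dev) + (\<Sum>l<m. ?E l ?large) + real m * tree_tail K)
    + ?c * ?g m + real m / (real n)\<^sup>2"
    using Suc by simp
  finally show ?case by (simp add: algebra_simps add_divide_distrib)
qed

text \<open>Order of choice: \<epsilon> first, then K, then n. The large trees contribute \<epsilon>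
  plus \<open>2 / K\<close> divided by \<epsilon>, so K has to be chosen after \<epsilon>; the
  deviations have a constant C that depends on K, so n comes last.\<close>

lemma discrepancy_tendsto:
  assumes T: "0 < T" and \<eta>: "0 < \<eta>"
  shows "\<forall>\<^sub>F n in sequentially. \<forall>m. real m \<le> T * real n \<longrightarrow>
    measure_pmf.expectation (path_law p n m) (\<lambda>hs. (discrepancy p n hs)\<^sup>2) < \<eta>"
proof -
  define \<epsilon> where "\<epsilon> = \<eta> / (8 * T\<^sup>2)"
  have \<epsilon>: "0 < \<epsilon>" "2 * T * (T * \<epsilon>) = \<eta> / 4" using \<eta> T by (auto simp: \<epsilon>_def power2_eq_square)
  have "(\<lambda>K. 2 * T * (2 / real K / \<epsilon> + T * tree_tail K)) \<longlonglongrightarrow> 2 * T * (0 / \<epsilon> + T * 0)"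
    by (intro tendsto_intros tree_tail_tendsto lim_const_over_n) (use \<epsilon> in simp)
  then have "\<forall>\<^sub>F K in sequentially. 2 * T * (2 / real K / \<epsilon> + T * tree_tail K) < \<eta> / 4"
    using \<eta> by (intro order_tendstoD(2)[of _ "0"]) auto
  then have "\<forall>\<^sub>F K in sequentially. 1 \<le> K \<and> 2 * T * (2 / real K / \<epsilon> + T * tree_tail K) < \<eta> / 4"
    using eventually_ge_at_top[of 1] by eventually_elim auto
  then obtain K :: nat where K: "1 \<le> K" "2 * T * (2 / real K / \<epsilon> + T * tree_tail K) < \<eta> / 4"
    using eventually_happens'[OF sequentially_bot] by blast
  obtain C where C: "0 \<le> C" "\<And>n m. 2 \<le> n \<Longrightarrow> real m \<le> T * real n \<Longrightarrow>
    measure_pmf.expectation (path_law p n m) (\<lambda>hs. \<Sum>k\<in>{1..<K}. (deviation p n k hs)\<^sup>2) \<le> C / real n"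
    using deviation_bound[OF p, of T K] T by auto
  define bnd where "bnd n = 2 * T * (T * ((real K + C) / sqrt (real n)) + (T * \<epsilon> + (T * (real K + 1) / real n + 2 / real K) / \<epsilon>) + T * tree_tail K)
    + 2 * T / real n + T / real n" for n
  have "bnd \<longlonglongrightarrow> 2 * T * (T * 0 + (T * \<epsilon> + (0 + 2 / real K) / \<epsilon>) + T * tree_tail K) + 0 + 0"
    unfolding bnd_def
    by (intro tendsto_intros lim_const_over_n) (use \<epsilon> in \<open>auto intro!: real_tendsto_divide_at_top filterlim_compose[OF sqrt_at_top filterlim_real_sequentially]\<close>)
  moreover have "2 * T * (T * 0 + (T * \<epsilon> + (0 + 2 / real K) / \<epsilon>) + T * tree_tail K) + 0 + 0 < \<eta>"
    using \<epsilon> K \<eta> by (simp add: distrib_left)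
  ultimately have "\<forall>\<^sub>F n in sequentially. bnd n < \<eta>" by (rule order_tendstoD(2))
  then show ?thesis using eventually_ge_at_top[of 2]
  proof (eventually_elim, intro allI impI)
    fix n m :: nat assume b: "bnd n < \<eta>" and n: "2 \<le> n" and m: "real m \<le> T * real n"
    define N where "N = real n"
    have N: "2 \<le> N" using n by (simp add: N_def)
    note int = integrable_path_law[OF n]
    let ?E = "\<lambda>l. measure_pmf.expectation (path_law p n l)"
    \<comment> \<open>Turns second moments into first moments: with e = 1 / sqrt n for the
      deviations, whose second moment is of order 1 / n, and with e = \<epsilon> for the large
      trees.\<close>
    have abs_le: "\<bar>x\<bar> \<le> e + x\<^sup>2 / e" if "0 < e" for x e :: real
    proof (cases "\<bar>x\<bar> \<le> e")
      case True
      then show ?thesis using that by (simp add: add_increasing2)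
    next
      case False
      then have "e * \<bar>x\<bar> \<le> \<bar>x\<bar> * \<bar>x\<bar>" by (intro mult_right_mono) auto
      then have "\<bar>x\<bar> \<le> x\<^sup>2 / e" using that by (simp add: field_simps power2_eq_square)
      then show ?thesis using that by linarith
    qed
    have sq: "0 < sqrt N" using N by simp
    have dev: "?E l (\<lambda>hs. \<Sum>k\<in>{1..<K}. \<bar>deviation p n k hs\<bar>) \<le> (real K + C) / sqrt N" if l: "l < m" for l
    proof -
      have "?E l (\<lambda>hs. \<Sum>k\<in>{1..<K}. \<bar>deviation p n k hs\<bar>) \<le> ?E l (\<lambda>hs. \<Sum>k\<in>{1..<K}. 1 / sqrt N + sqrt N * (deviation p n k hs)\<^sup>2)"
        using abs_le[of "1 / sqrt N"] sq by (intro integral_mono[OF int int] sum_mono) (simp add: mult.commute)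
      also have "\<dots> = ?E l (\<lambda>hs. real (K - 1) * (1 / sqrt N) + sqrt N * (\<Sum>k\<in>{1..<K}. (deviation p n k hs)\<^sup>2))"
        by (simp add: sum.distrib sum_distrib_left)
      also have "\<dots> = real (K - 1) * (1 / sqrt N) + sqrt N * ?E l (\<lambda>hs. \<Sum>k\<in>{1..<K}. (deviation p n k hs)\<^sup>2)"
        by (simp add: int)
      also have "\<dots> \<le> real K * (1 / sqrt N) + sqrt N * (C / N)"
        using C(2)[OF n, of l] l m sq by (intro add_mono mult_left_mono mult_right_mono) (auto simp: N_def)
      also have "sqrt N * (C / N) = C / sqrt N" using N by (simp add: field_simps)
      finally show ?thesis by (simp add: add_divide_distrib)
    qed
    have "(\<Sum>l<m. ?E l (\<lambda>hs. \<Sum>k\<in>{1..<K}. \<bar>deviation p n k hs\<bar>)) \<le> (\<Sum>l<m. (real K + C) / sqrt N)"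
      by (rule sum_mono) (use dev in auto)
    also have "\<dots> \<le> T * N * ((real K + C) / sqrt N)" using m C sq by (simp add: N_def mult_right_mono divide_right_mono del: times_divide_eq_right)
    finally have 1: "(\<Sum>l<m. ?E l (\<lambda>hs. \<Sum>k\<in>{1..<K}. \<bar>deviation p n k hs\<bar>)) \<le> N * (T * ((real K + C) / sqrt N))" by (simp add: mult_ac)
    have "(\<Sum>l<m. ?E l (\<lambda>hs. large_fraction n K (hd hs))) \<le> (\<Sum>l<m. \<epsilon> + ?E l (\<lambda>hs. (large_fraction n K (hd hs))\<^sup>2) / \<epsilon>)"
    proof (rule sum_mono)
      fix l
      have "?E l (\<lambda>hs. large_fraction n K (hd hs)) \<le> ?E l (\<lambda>hs. \<epsilon> + (large_fraction n K (hd hs))\<^sup>2 / \<epsilon>)"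
        using abs_le[OF \<epsilon>(1)] by (intro integral_mono[OF int int]) (meson abs_ge_self order_trans)
      then show "?E l (\<lambda>hs. large_fraction n K (hd hs)) \<le> \<epsilon> + ?E l (\<lambda>hs. (large_fraction n K (hd hs))\<^sup>2) / \<epsilon>"
        by (simp add: int)
    qed
    also have "\<dots> = real m * \<epsilon> + (\<Sum>l<m. ?E l (\<lambda>hs. (large_fraction n K (hd hs))\<^sup>2)) / \<epsilon>"
      by (simp add: sum.distrib sum_divide_distrib)
    also have "\<dots> \<le> T * N * \<epsilon> + (T * N * (real K + 1) / N + 2 * N / real K) / \<epsilon>"
    proof (intro add_mono mult_right_mono divide_right_mono)
      have "real m * (real K + 1) / N \<le> T * N * (real K + 1) / N" using m N by (intro divide_right_mono mult_right_mono) (auto simp: N_def)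
      then show "(\<Sum>l<m. ?E l (\<lambda>hs. (large_fraction n K (hd hs))\<^sup>2)) \<le> T * N * (real K + 1) / N + 2 * N / real K"
        using sum_large_fraction[OF n K(1), of m] by (simp add: N_def)
    qed (use m \<epsilon> in \<open>auto simp: N_def\<close>)
    also have "\<dots> = N * (T * \<epsilon> + (T * (real K + 1) / N + 2 / real K) / \<epsilon>)" using N by (simp add: field_simps)
    finally have 2: "(\<Sum>l<m. ?E l (\<lambda>hs. large_fraction n K (hd hs))) \<le> N * (T * \<epsilon> + (T * (real K + 1) / N + 2 / real K) / \<epsilon>)" .
    have 3: "real m * tree_tail K \<le> N * (T * tree_tail K)"
      using mult_right_mono[OF m tree_tail_nonneg[of K]] by (simp add: N_def mult_ac)
    have 4: "2 * T / N * g_fun p (real m / N) \<le> 2 * T / N" using g_fun_bounds(2)[OF p, of "real m / N"] T N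
      by (simp add: divide_right_mono mult_left_le)
    have 5: "real m / N\<^sup>2 \<le> T / N" using m N by (simp add: N_def field_simps power2_eq_square)
    have "?E m (\<lambda>hs. (discrepancy p n hs)\<^sup>2) \<le> 2 * T / N * (N * (T * ((real K + C) / sqrt N))
      + N * (T * \<epsilon> + (T * (real K + 1) / N + 2 / real K) / \<epsilon>) + N * (T * tree_tail K)) + 2 * T / N + T / N"
      using expectation_discrepancy[OF n m, of K] unfolding N_def[symmetric]
    proof (rule order_trans)
      show "2 * T / N * ((\<Sum>l<m. ?E l (\<lambda>hs. \<Sum>k\<in>{1..<K}. \<bar>deviation p n k hs\<bar>)) + (\<Sum>l<m. ?E l (\<lambda>hs. large_fraction n K (hd hs))) + real m * tree_tail K)
         + 2 * T / N * g_fun p (real m / N) + real m / N\<^sup>2 \<le> 2 * T / N * (N * (T * ((real K + C) / sqrt N))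
      + N * (T * \<epsilon> + (T * (real K + 1) / N + 2 / real K) / \<epsilon>) + N * (T * tree_tail K)) + 2 * T / N + T / N"
        using 1 2 3 4 5 T N by (intro add_mono mult_left_mono) auto
    qed
    also have "\<dots> = bnd n" unfolding bnd_def N_def[symmetric]
    proof -
      have "2 * T / N * (N * x + N * y + N * z) = 2 * T * (x + y + z)" for x y z using N by (simp add: distrib_left[symmetric] del: distrib_left)
      then show "2 * T / N * (N * (T * ((real K + C) / sqrt N))
      + N * (T * \<epsilon> + (T * (real K + 1) / N + 2 / real K) / \<epsilon>) + N * (T * tree_tail K)) + 2 * T / N + T / N =
       2 * T * (T * ((real K + C) / sqrt N) + (T * \<epsilon> + (T * (real K + 1) / N + 2 / real K) / \<epsilon>) + T * tree_tail K)
    + 2 * T / N + T / N" by (simp only:)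
    qed
    finally show "?E m (\<lambda>hs. (discrepancy p n hs)\<^sup>2) < \<eta>" using b by simp
  qed
qed

end

section \<open>Probability that vertex 1 is frozen\<close>

definition freeze_prob :: "real \<Rightarrow> nat \<Rightarrow> nat \<Rightarrow> real" where
  "freeze_prob p n m = measure_pmf.prob (path_law p n m) {hs. frozen (hd hs) 1}"

lemma freeze_prob_nonneg: "0 \<le> freeze_prob p n m"
  by (simp add: freeze_prob_def)

lemma freeze_prob_mono:
  assumes n: "2 \<le> n" shows "l \<le> m \<Longrightarrow> freeze_prob p n l \<le> freeze_prob p n m"
proof (rule lift_Suc_mono_le[of "freeze_prob p n"])
  fix m
  have e: "freeze_prob p n m = measure_pmf.expectation (path_law p n m) (\<lambda>hs. of_bool (frozen (hd hs) 1))" for m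
  proof -
    have "(\<lambda>hs. of_bool (frozen (hd hs) 1)) = (indicator {hs. frozen (hd hs) 1} :: multigraph list \<Rightarrow> real)"
      by (auto simp: indicator_def)
    then show ?thesis by (simp add: freeze_prob_def)
  qed
  show "freeze_prob p n m \<le> freeze_prob p n (Suc m)"
    unfolding e expectation_path_law_Suc[OF n]
  proof (rule integral_mono_AE[OF integrable_path_law[OF n] integrable_path_law[OF n]], unfold AE_measure_pmf_iff, rule ballI)
    fix hs assume "hs \<in> set_pmf (path_law p n m)"
    then have wf: "wf_state n (hd hs)" using path_law_support[OF n] by blast
    show "(of_bool (frozen (hd hs) 1) :: real) \<le> measure_pmf.expectation (frozen_step p n (hd hs)) (\<lambda>G. of_bool (frozen (hd (G # hs)) 1))"
    proof (cases "frozen (hd hs) 1")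
      case True
      then have "AE G in frozen_step p n (hd hs). frozen G 1"
        unfolding AE_measure_pmf_iff using wf_state_step(2)[OF n wf] n by auto
      then have "measure_pmf.expectation (frozen_step p n (hd hs)) (\<lambda>G. of_bool (frozen (hd (G # hs)) 1) :: real)
        = measure_pmf.expectation (frozen_step p n (hd hs)) (\<lambda>G. 1 :: real)"
        by (intro integral_cong_AE) auto
      then show ?thesis using True by simp
    qed simp
  qed
qed

lemma expectation_frozen_fraction:
  assumes n: "2 \<le> n"
  shows "measure_pmf.expectation (path_law p n m) (\<lambda>hs. frozen_fraction n (hd hs)) = freeze_prob p n m"
  using expectation_frozen_count[OF n, of p m] n by (simp add: frozen_fraction_def freeze_prob_def)

lemma expectation_occupation:
  assumes n: "2 \<le> n"
  shows "measure_pmf.expectation (path_law p n m) (occupation n) = (\<Sum>l<m. freeze_prob p n l) / real n"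
proof (induction m)
  case 0
  then show ?case by (simp add: occupation_def)
next
  case (Suc m)
  have "measure_pmf.expectation (path_law p n (Suc m)) (occupation n) =
    measure_pmf.expectation (path_law p n m) (\<lambda>hs. measure_pmf.expectation (frozen_step p n (hd hs)) (\<lambda>G. occupation n (G # hs)))"
    by (rule expectation_path_law_Suc[OF n])
  also have "\<dots> = measure_pmf.expectation (path_law p n m) (\<lambda>hs. occupation n hs + frozen_fraction n (hd hs) / real n)"
  proof (rule integral_cong_AE)
    show "AE hs in path_law p n m. measure_pmf.expectation (frozen_step p n (hd hs)) (\<lambda>G. occupation n (G # hs)) =
      occupation n hs + frozen_fraction n (hd hs) / real n"
      unfolding AE_measure_pmf_iff
    proof
      fix hs assume "hs \<in> set_pmf (path_law p n m)"
      then have "length hs = Suc m" using path_law_support[OF n] by blast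
      then have "hs \<noteq> []" by auto
      then show "measure_pmf.expectation (frozen_step p n (hd hs)) (\<lambda>G. occupation n (G # hs)) =
        occupation n hs + frozen_fraction n (hd hs) / real n" by (simp add: occupation_Cons)
    qed
  qed auto
  finally show ?case using Suc by (simp add: integrable_path_law[OF n] expectation_frozen_fraction[OF n] add_divide_distrib)
qed

context
  fixes p :: real
  assumes p: "0 < p" "p \<le> 1"
begin

lemma freeze_prob_average:
  assumes T: "0 < T" and \<eta>: "0 < \<eta>"
  shows "\<forall>\<^sub>F n in sequentially. \<forall>m. real m \<le> T * real n \<longrightarrow>
    \<bar>(\<Sum>l<m. freeze_prob p n l) / real n - limit_integral p (real m / real n)\<bar> \<le> \<eta>"
proof -
  \<comment> \<open>The elementary bound \<open>\<bar>x\<bar> \<le> e + x^2 / e\<close> with e =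
    \<eta> / 2 gives \<eta> once the second moment is below e^2.\<close>
  have "0 < (\<eta> / 2) * (\<eta> / 2)" using \<eta> by simp
  from discrepancy_tendsto[OF p T this] eventually_ge_at_top[of 2]
  show ?thesis
  proof (eventually_elim, intro allI impI)
    fix n m :: nat
    assume D: "\<forall>m. real m \<le> T * real n \<longrightarrow> measure_pmf.expectation (path_law p n m) (\<lambda>hs. (discrepancy p n hs)\<^sup>2) < (\<eta> / 2) * (\<eta> / 2)"
      and n: "2 \<le> n" and m: "real m \<le> T * real n"
    note int = integrable_path_law[OF n]
    let ?E = "measure_pmf.expectation (path_law p n m)"
    have "?E (discrepancy p n) = ?E (\<lambda>hs. occupation n hs - limit_integral p (real m / real n))"
    proof (rule integral_cong_AE)
      show "AE hs in path_law p n m. discrepancy p n hs = occupation n hs - limit_integral p (real m / real n)"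
        unfolding AE_measure_pmf_iff using path_law_support[OF n] by (auto simp: discrepancy_def)
    qed auto
    also have "\<dots> = (\<Sum>l<m. freeze_prob p n l) / real n - limit_integral p (real m / real n)"
      by (simp add: int expectation_occupation[OF n])
    finally have eq: "?E (discrepancy p n) = \<dots>" .
    have "\<bar>?E (discrepancy p n)\<bar> \<le> ?E (\<lambda>hs. \<bar>discrepancy p n hs\<bar>)" by (rule integral_abs_bound)
    also have "\<dots> \<le> ?E (\<lambda>hs. \<eta> / 2 + (discrepancy p n hs)\<^sup>2 / (\<eta> / 2))"
    proof (rule integral_mono[OF int int])
      fix hs
      show "\<bar>discrepancy p n hs\<bar> \<le> \<eta> / 2 + (discrepancy p n hs)\<^sup>2 / (\<eta> / 2)"
      proof (cases "\<bar>discrepancy p n hs\<bar> \<le> \<eta> / 2")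
        case True
        then show ?thesis using \<eta> by (simp add: add_increasing2)
      next
        case False
        then have "\<bar>discrepancy p n hs\<bar> * (\<eta> / 2) \<le> \<bar>discrepancy p n hs\<bar> * \<bar>discrepancy p n hs\<bar>"
          by (intro mult_left_mono) auto
        then have "\<bar>discrepancy p n hs\<bar> \<le> (discrepancy p n hs)\<^sup>2 / (\<eta> / 2)"
          using \<eta> by (subst pos_le_divide_eq) (auto simp: power2_eq_square)
        then show ?thesis using \<eta> by linarith
      qed
    qed
    also have "\<dots> = \<eta> / 2 + ?E (\<lambda>hs. (discrepancy p n hs)\<^sup>2) / (\<eta> / 2)" by (simp add: int)
    also have "?E (\<lambda>hs. (discrepancy p n hs)\<^sup>2) / (\<eta> / 2) \<le> \<eta> / 2"
      using D m \<eta> by (subst pos_divide_le_eq) (auto intro: less_imp_le)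
    finally show "\<bar>(\<Sum>l<m. freeze_prob p n l) / real n - limit_integral p (real m / real n)\<bar> \<le> \<eta>"
      unfolding eq by simp
  qed
qed

text \<open>Monotonicity in time upgrades the convergence of time averages to pointwise convergence.\<close>

lemma freeze_prob_increment:
  assumes n: "2 \<le> n" and ab: "a < b"
    and avg: "\<And>m. m \<in> {a, b} \<Longrightarrow> \<bar>(\<Sum>l<m. freeze_prob p n l) / real n - limit_integral p (real m / real n)\<bar> \<le> \<delta>"
  shows "freeze_prob p n a \<le> g_fun p (real b / real n) + 2 * \<delta> / (real (b - a) / real n)"
    "g_fun p (real a / real n) - 2 * \<delta> / (real (b - a) / real n) \<le> freeze_prob p n b"
proof -
  define N where "N = real n"
  define w where "w = real (b - a) / N"
  have N: "0 < N" and w: "0 < w" using n ab by (auto simp: N_def w_def)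
  have w_eq: "w = real b / N - real a / N" using ab by (simp add: w_def of_nat_diff diff_divide_distrib)
  have le: "0 \<le> real a / N" "real a / N \<le> real b / N" using ab N by (auto simp: divide_right_mono)
  define Q where "Q = (\<Sum>l\<in>{a..<b}. freeze_prob p n l) / N"
  have "(\<Sum>l<b. freeze_prob p n l) = (\<Sum>l<a. freeze_prob p n l) + (\<Sum>l\<in>{a..<b}. freeze_prob p n l)"
    using ab sum.atLeastLessThan_concat[of 0 a b "freeze_prob p n"] by (simp add: lessThan_atLeast0)
  then have Q: "Q = (\<Sum>l<b. freeze_prob p n l) / N - (\<Sum>l<a. freeze_prob p n l) / N"
    by (simp add: Q_def add_divide_distrib)
  have Q_bounds: "\<bar>Q - (limit_integral p (real b / N) - limit_integral p (real a / N))\<bar> \<le> 2 * \<delta>"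
    using avg[of a] avg[of b] unfolding Q N_def by auto
  note inc = limit_integral_increment[OF p le]
  have "freeze_prob p n a * w \<le> Q"
  proof -
    have "(\<Sum>l\<in>{a..<b}. freeze_prob p n a) \<le> (\<Sum>l\<in>{a..<b}. freeze_prob p n l)"
      by (rule sum_mono) (auto intro: freeze_prob_mono[OF n])
    then show ?thesis using N by (simp add: Q_def w_def divide_right_mono mult.commute)
  qed
  also have "\<dots> \<le> g_fun p (real b / N) * w + 2 * \<delta>" using Q_bounds inc(2) unfolding w_eq by linarith
  finally have "freeze_prob p n a \<le> (g_fun p (real b / N) * w + 2 * \<delta>) / w" using w by (simp add: pos_le_divide_eq)
  then show "freeze_prob p n a \<le> g_fun p (real b / real n) + 2 * \<delta> / (real (b - a) / real n)"
    using w by (simp add: add_divide_distrib w_def[symmetric] N_def[symmetric])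
  have "Q \<le> freeze_prob p n b * w"
  proof -
    have "(\<Sum>l\<in>{a..<b}. freeze_prob p n l) \<le> (\<Sum>l\<in>{a..<b}. freeze_prob p n b)"
      by (rule sum_mono) (auto intro: freeze_prob_mono[OF n])
    then show ?thesis using N by (simp add: Q_def w_def divide_right_mono mult.commute)
  qed
  moreover have "g_fun p (real a / N) * w - 2 * \<delta> \<le> Q" using Q_bounds inc(1) unfolding w_eq by linarith
  ultimately have "g_fun p (real a / N) * w - 2 * \<delta> \<le> freeze_prob p n b * w" by linarith
  then have "(g_fun p (real a / N) * w - 2 * \<delta>) / w \<le> freeze_prob p n b" using w by (simp add: pos_divide_le_eq)
  then show "g_fun p (real a / real n) - 2 * \<delta> / (real (b - a) / real n) \<le> freeze_prob p n b"
    using w by (simp add: diff_divide_distrib w_def[symmetric] N_def[symmetric])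
qed

lemma freeze_prob_tendsto:
  assumes t: "0 \<le> t"
  shows "(\<lambda>n. freeze_prob p n (nat \<lfloor>t * real n\<rfloor>)) \<longlonglongrightarrow> g_fun p t"
proof (rule LIMSEQ_I)
  fix r :: real assume r: "0 < r"
  have "isCont (g_fun p) t" by (rule g_fun_cont[OF p])
  then obtain d where d: "0 < d" "\<And>x. \<bar>x - t\<bar> < d \<Longrightarrow> \<bar>g_fun p x - g_fun p t\<bar> < r / 2"
    using r unfolding continuous_at_eps_delta real_norm_def dist_real_def by (metis half_gt_zero)
  \<comment> \<open>For t \<le> 1/2 only the upper bound needs a window, since g vanishes there;
    otherwise the window to the left of t has to stay in the nonnegative half-line.\<close>
  define h where "h = (if t \<le> 1 / 2 then d / 2 else min (d / 4) (t / 4))"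
  have h: "0 < h" "h \<le> d / 2" using d t by (auto simp: h_def)
  \<comment> \<open>For n \<ge> n0 a window of length h keeps length at least h / 2 after both ends
    are rounded, and \<open>2 * \<delta> / (h / 2)\<close> equals r / 4.\<close>
  define \<delta> where "\<delta> = r * h / 16"
  have \<delta>: "0 < \<delta>" using r h by (simp add: \<delta>_def)
  have T: "0 < t + h + 1" using t h by simp
  obtain n0 :: nat where n0: "2 / h < real n0" using reals_Archimedean2 by blast
  have "\<forall>\<^sub>F n in sequentially. norm (freeze_prob p n (nat \<lfloor>t * real n\<rfloor>) - g_fun p t) < r"
    using freeze_prob_average[OF T \<delta>] eventually_ge_at_top[of "max 2 n0"]
  proof eventually_elim
    fix n assume avg: "\<forall>m. real m \<le> (t + h + 1) * real n \<longrightarrow>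
      \<bar>(\<Sum>l<m. freeze_prob p n l) / real n - limit_integral p (real m / real n)\<bar> \<le> \<delta>"
      and n': "max 2 n0 \<le> n"
    then have n: "2 \<le> n" by simp
    define N where "N = real n"
    have N: "0 < N" "2 / h < N" using n n' n0 by (auto simp: N_def)
    have hN: "2 < h * N" using N h by (simp add: field_simps)
    define fl where "fl x = nat \<lfloor>x * N\<rfloor>" for x
    have fl: "real (fl x) \<le> x * N" "x * N - 1 < real (fl x)" if "0 \<le> x" for x
      using that N by (auto simp: fl_def)
    have small: "2 * \<delta> / (real (fl y - fl x) / N) \<le> r / 4 \<and> fl x < fl y" if "0 \<le> x" "y = x + h" for x y
    proof -
      have "h * N - 1 \<le> real (fl y) - real (fl x)"
        using fl(1)[of x] fl(2)[of y] that h by (simp add: algebra_simps)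
      then have 1: "h * N / 2 \<le> real (fl y) - real (fl x)" using hN by linarith
      then have 2: "fl x < fl y" using hN by linarith
      have 3: "h / 2 \<le> real (fl y - fl x) / N" using 1 2 N by (simp add: of_nat_diff pos_le_divide_eq)
      have "2 * \<delta> / W \<le> 2 * \<delta> / (h / 2)" if "h / 2 \<le> W" for W
        using that h \<delta> by (intro divide_left_mono mult_pos_pos) auto
      note this[OF 3]
      also have "\<dots> = r / 4" using h by (simp add: \<delta>_def)
      finally show ?thesis using 2 by simp
    qed
    have avg': "\<bar>(\<Sum>l<m. freeze_prob p n l) / real n - limit_integral p (real m / real n)\<bar> \<le> \<delta>"
      if "m = fl x" "0 \<le> x" "x \<le> t + h" for m x
    proof -
      have "x * N \<le> (t + h + 1) * N" using that N by (intro mult_right_mono) auto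
      then show ?thesis using avg fl(1)[OF that(2)] that(1) by (auto simp: N_def)
    qed
    have upper: "freeze_prob p n (fl t) < g_fun p t + r"
    proof -
      note s = small[OF t refl]
      have "freeze_prob p n (fl t) \<le> g_fun p (real (fl (t + h)) / real n) + 2 * \<delta> / (real (fl (t + h) - fl t) / real n)"
        by (rule freeze_prob_increment(1)[OF n]) (use s t h avg' in auto)
      moreover have "real (fl (t + h)) / N \<le> t + h" using fl(1)[of "t + h"] t h N by (simp add: pos_divide_le_eq)
      then have "g_fun p (real (fl (t + h)) / N) \<le> g_fun p (t + h)" by (rule monoD[OF g_fun_mono[OF p]])
      moreover have "\<bar>g_fun p (t + h) - g_fun p t\<bar> < r / 2" using d(1) h by (intro d(2)) auto
      ultimately show ?thesis using s r unfolding N_def by linarith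
    qed
    have lower: "g_fun p t - r < freeze_prob p n (fl t)"
    proof (cases "t \<le> 1 / 2")
      case True
      then show ?thesis using freeze_prob_nonneg[of p n "fl t"] r by (simp add: g_fun_early[OF p])
    next
      case False
      then have h2: "0 \<le> t - h" "2 * h < d" using h d by (auto simp: h_def min_def split: if_splits)
      have s: "2 * \<delta> / (real (fl t - fl (t - h)) / N) \<le> r / 4 \<and> fl (t - h) < fl t"
        by (rule small[OF h2(1)]) simp
      have "g_fun p (real (fl (t - h)) / real n) - 2 * \<delta> / (real (fl t - fl (t - h)) / real n) \<le> freeze_prob p n (fl t)"
        by (rule freeze_prob_increment(2)[OF n]) (use s t h h2 avg' in auto)
      moreover have "t - 2 * h \<le> real (fl (t - h)) / N"
      proof -
        have "(t - 2 * h) * N \<le> (t - h) * N - 1" using hN by (simp add: algebra_simps)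
        then show ?thesis using fl(2)[OF h2(1)] N by (simp add: pos_le_divide_eq)
      qed
      then have "g_fun p (t - 2 * h) \<le> g_fun p (real (fl (t - h)) / N)" by (rule monoD[OF g_fun_mono[OF p]])
      moreover have "\<bar>g_fun p (t - 2 * h) - g_fun p t\<bar> < r / 2" using h2 h by (intro d(2)) auto
      ultimately show ?thesis using s r unfolding N_def by linarith
    qed
    show "norm (freeze_prob p n (nat \<lfloor>t * real n\<rfloor>) - g_fun p t) < r"
      using upper lower by (simp add: fl_def N_def abs_less_iff)
  qed
  then show "\<exists>no. \<forall>n\<ge>no. norm (freeze_prob p n (nat \<lfloor>t * real n\<rfloor>) - g_fun p t) < r"
    by (simp add: eventually_sequentially)
qed

end

section \<open>Freezing time of a vertex\<close>

definition history :: "(nat \<Rightarrow> 'a \<Rightarrow> multigraph) \<Rightarrow> nat \<Rightarrow> 'a \<Rightarrow> multigraph list" where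
  "history F m \<omega> = map (\<lambda>i. F i \<omega>) (rev [0..<Suc m])"

lemma history_0: "history F 0 \<omega> = [F 0 \<omega>]"
  by (simp add: history_def)

lemma history_Suc: "history F (Suc m) \<omega> = F (Suc m) \<omega> # history F m \<omega>"
  by (simp add: history_def)

lemma hd_history: "hd (history F m \<omega>) = F m \<omega>"
  by (simp add: history_def)

lemma length_history: "length (history F m \<omega>) = Suc m"
  by (simp add: history_def)

lemma set_history: "set (history F m \<omega>) = (\<lambda>i. F i \<omega>) ` {..m}"
proof -
  have "set (rev [0..<Suc m]) = {..m}" by auto
  then show ?thesis by (simp only: history_def set_map)
qed

lemma history_eq_iff:
  assumes "length hs = Suc m"
  shows "history F m \<omega> = hs \<longleftrightarrow> (\<forall>i\<le>m. F i \<omega> = hs ! (m - i))"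
  using assms
proof (induction m arbitrary: hs)
  case 0
  then show ?case by (cases hs) (auto simp: history_0)
next
  case (Suc m)
  then obtain G hs' where hs: "hs = G # hs'" "length hs' = Suc m" by (cases hs) auto
  have "hs ! (Suc m - i) = hs' ! (m - i)" if "i \<le> m" for i using that by (simp add: hs Suc_diff_le)
  then show ?case unfolding history_Suc using Suc.IH[OF hs(2)] by (auto simp: hs le_Suc_eq)
qed

lemma pmf_path_law_Cons:
  "pmf (path_law p n (Suc m)) (G # hs) = pmf (path_law p n m) hs * pmf (frozen_step p n (hd hs)) G"
proof -
  have "pmf (map_pmf (\<lambda>G. G # xs) (frozen_step p n (hd xs))) (G # hs) = (if xs = hs then pmf (frozen_step p n (hd hs)) G else 0)" for xs
  proof (cases "xs = hs")
    case True
    have "inj (\<lambda>G. G # hs)" by (simp add: inj_def)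
    then show ?thesis using True pmf_map_inj'[of "\<lambda>G. G # hs" "frozen_step p n (hd hs)" G] by simp
  next
    case False
    then have "G # hs \<notin> set_pmf (map_pmf (\<lambda>G. G # xs) (frozen_step p n (hd xs)))" by auto
    then show ?thesis using False by (simp add: pmf_eq_0_set_pmf)
  qed
  then have "pmf (path_law p n (Suc m)) (G # hs) = measure_pmf.expectation (path_law p n m) (\<lambda>xs. if xs = hs then pmf (frozen_step p n (hd hs)) G else 0)"
    by (simp add: pmf_bind)
  also have "\<dots> = (\<Sum>xs\<in>{hs}. (if xs = hs then pmf (frozen_step p n (hd hs)) G else 0) * pmf (path_law p n m) xs)"
    by (rule integral_measure_pmf_real) (auto split: if_splits)
  finally show ?thesis by simp
qed

section \<open>Transfer to an arbitrary version of the process\<close>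

context
  fixes p :: real and n :: nat and M :: "'a measure" and F :: "nat \<Rightarrow> 'a \<Rightarrow> multigraph"
  assumes p: "0 < p" "p \<le> 1" and n: "2 \<le> n" and process: "frozen_process p n M F"
begin

interpretation prob_space M
  using process by (simp add: frozen_process_def)

lemma F_measurable: "F m \<in> measurable M (count_space UNIV)"
  using process by (simp add: frozen_process_def)

lemma F_event: "{\<omega>\<in>space M. P (F m \<omega>)} \<in> events"
proof -
  have "{\<omega>\<in>space M. P (F m \<omega>)} = F m -` {G. P G} \<inter> space M" by auto
  then show ?thesis using measurable_sets[OF F_measurable[of m], of "{G. P G}"] by simp
qed

lemma history_event: "{\<omega>\<in>space M. history F m \<omega> = hs} \<in> events"
proof (cases "length hs = Suc m")
  case True
  have "{\<omega>\<in>space M. \<forall>i\<in>{..m}. F i \<omega> = hs ! (m - i)} \<in> events"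
  proof (rule sets.sets_Collect_finite_All)
    show "{\<omega>\<in>space M. F i \<omega> = hs ! (m - i)} \<in> events" for i
      by (rule F_event[of "\<lambda>G. G = hs ! (m - i)"])
  qed simp
  moreover have "{\<omega>\<in>space M. history F m \<omega> = hs} = {\<omega>\<in>space M. \<forall>i\<in>{..m}. F i \<omega> = hs ! (m - i)}"
    unfolding history_eq_iff[OF True] Ball_def atMost_iff ..
  ultimately show ?thesis by (simp only:)
next
  case False
  then have "history F m \<omega> \<noteq> hs" for \<omega> using length_history[of F m \<omega>] by metis
  then have "{\<omega>\<in>space M. history F m \<omega> = hs} = {}" by blast
  then show ?thesis by (simp only: sets.empty_sets)
qed

text \<open>Chain rule: the definition of the process prescribes exactly the conditional laws from
  which \<open>path_law\<close> is built.\<close>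

lemma history_prob:
  "length hs = Suc m \<Longrightarrow> \<P>(\<omega> in M. history F m \<omega> = hs) = pmf (path_law p n m) hs"
proof (induction m arbitrary: hs)
  case 0
  then obtain G where hs: "hs = [G]" by (cases hs) auto
  have "AE \<omega> in M. F 0 \<omega> = {#}" using process by (simp add: frozen_process_def)
  then have "\<P>(\<omega> in M. F 0 \<omega> = G) = \<P>(\<omega> in M. {#} = G)"
    by (intro prob_eq_AE F_event) (auto elim!: eventually_mono)
  also have "\<dots> = pmf (path_law p n 0) hs"
    by (cases "G = {#}") (auto simp: hs prob_space pmf_return)
  finally show ?case by (simp add: history_0 hs)
next
  case (Suc m)
  then obtain G hs' where hs: "hs = G # hs'" "length hs' = Suc m" by (cases hs) auto
  define h where "h i = hs' ! (m - i)" for i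
  have hm: "h m = hd hs'" using hs(2) by (cases hs') (auto simp: h_def)
  have past: "history F m \<omega> = hs' \<longleftrightarrow> (\<forall>i\<le>m. F i \<omega> = h i)" for \<omega>
    unfolding h_def by (rule history_eq_iff[OF hs(2)])
  have "\<P>(\<omega> in M. F (Suc m) \<omega> = G \<and> (\<forall>i\<le>m. F i \<omega> = h i)) =
    pmf (frozen_step p n (hd hs')) G * \<P>(\<omega> in M. \<forall>i\<le>m. F i \<omega> = h i)"
  proof (cases "\<P>(\<omega> in M. \<forall>i\<le>m. F i \<omega> = h i) > 0")
    case True
    then have "\<P>(\<omega> in M. F (Suc m) \<omega> = G \<bar> \<forall>i\<le>m. F i \<omega> = h i) = pmf (frozen_step p n (h m)) G"
      using process by (simp add: frozen_process_def)
    then show ?thesis using True by (simp add: cond_prob_def hm field_simps)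
  next
    \<comment> \<open>Given a null past the process is unconstrained; here both sides of the product
      formula vanish.\<close>
    case False
    then have z: "\<P>(\<omega> in M. \<forall>i\<le>m. F i \<omega> = h i) = 0" by (simp only: zero_less_measure_iff not_not)
    have "\<P>(\<omega> in M. F (Suc m) \<omega> = G \<and> (\<forall>i\<le>m. F i \<omega> = h i)) \<le> \<P>(\<omega> in M. \<forall>i\<le>m. F i \<omega> = h i)"
    proof (rule finite_measure_mono)
      show "{\<omega>\<in>space M. \<forall>i\<le>m. F i \<omega> = h i} \<in> events" using history_event[of m hs'] unfolding past .
    qed blast
    then show ?thesis unfolding z mult_zero_right measure_le_0_iff .
  qed
  then show ?case
    using Suc.IH[OF hs(2)] unfolding hs(1) history_Suc list.inject past pmf_path_law_Cons
    by (simp only: mult.commute)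
qed

text \<open>The law of the history has finite support, so its point probabilities determine it.\<close>

lemma history_prob_set:
  assumes A: "{\<omega>\<in>space M. history F m \<omega> \<in> A} \<in> events"
  shows "\<P>(\<omega> in M. history F m \<omega> \<in> A) = measure_pmf.prob (path_law p n m) A"
proof -
  let ?S = "set_pmf (path_law p n m)"
  have fin: "finite ?S" by (rule finite_set_path_law[OF n])
  have sum: "\<P>(\<omega> in M. history F m \<omega> \<in> B) = measure_pmf.prob (path_law p n m) B"
    and ev: "{\<omega>\<in>space M. history F m \<omega> \<in> B} \<in> events" if "B \<subseteq> ?S" for B
  proof -
    have finB: "finite B" using fin that by (rule rev_finite_subset)
    have eq: "{\<omega>\<in>space M. history F m \<omega> \<in> B} = (\<Union>hs\<in>B. {\<omega>\<in>space M. history F m \<omega> = hs})" by auto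
    show "{\<omega>\<in>space M. history F m \<omega> \<in> B} \<in> events" unfolding eq
      by (intro sets.finite_UN finB history_event)
    have "\<P>(\<omega> in M. history F m \<omega> \<in> B) = (\<Sum>hs\<in>B. \<P>(\<omega> in M. history F m \<omega> = hs))"
      unfolding eq by (rule finite_measure_finite_Union[OF finB]) (auto simp: disjoint_family_on_def history_event)
    also have "\<dots> = (\<Sum>hs\<in>B. pmf (path_law p n m) hs)"
      using that path_law_support[OF n] by (intro sum.cong refl history_prob) blast
    also have "\<dots> = measure_pmf.prob (path_law p n m) B" by (rule measure_measure_pmf_finite[OF finB, symmetric])
    finally show "\<P>(\<omega> in M. history F m \<omega> \<in> B) = measure_pmf.prob (path_law p n m) B" .
  qed
  have "\<P>(\<omega> in M. history F m \<omega> \<in> ?S) = 1"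
    using sum[of ?S] by (simp add: measure_pmf.prob_eq_1 AE_measure_pmf_iff)
  then have ae: "AE \<omega> in M. history F m \<omega> \<in> ?S" using prob_eq_1[OF ev[of ?S]] by auto
  have "\<P>(\<omega> in M. history F m \<omega> \<in> A) = \<P>(\<omega> in M. history F m \<omega> \<in> A \<inter> ?S)"
    using ae by (intro prob_eq_AE A ev) (auto elim!: eventually_mono)
  also have "\<dots> = measure_pmf.prob (path_law p n m) (A \<inter> ?S)" by (rule sum) simp
  finally show ?thesis by (simp add: measure_Int_set_pmf)
qed

lemma frozen_prob_process: "\<P>(\<omega> in M. frozen (F m \<omega>) 1) = freeze_prob p n m"
  using history_prob_set[of m "{hs. frozen (hd hs) 1}"] F_event[of "\<lambda>G. frozen G 1" m]
  by (simp add: hd_history freeze_prob_def)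

lemma frozen_before_event: "{\<omega>\<in>space M. \<exists>i\<le>m. frozen (F i \<omega>) 1} \<in> events"
proof -
  have "{\<omega>\<in>space M. \<exists>i\<le>m. frozen (F i \<omega>) 1} = (\<Union>i\<in>{..m}. {\<omega>\<in>space M. frozen (F i \<omega>) 1})" by auto
  also have "\<dots> \<in> events" by (intro sets.finite_UN F_event[of "\<lambda>G. frozen G 1"]) simp
  finally show ?thesis .
qed

text \<open>Permanence of freezing holds on the support of \<open>path_law\<close>, hence only
  almost surely for F. So the two events are compared through the law of the history and not
  pointwise.\<close>

lemma frozen_before_prob: "\<P>(\<omega> in M. \<exists>i\<le>m. frozen (F i \<omega>) 1) = freeze_prob p n m"
proof -
  have eq: "(\<exists>G\<in>set (history F m \<omega>). frozen G 1) \<longleftrightarrow> (\<exists>i\<le>m. frozen (F i \<omega>) 1)" for \<omega>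
    unfolding set_history by auto
  have "\<P>(\<omega> in M. \<exists>i\<le>m. frozen (F i \<omega>) 1) = measure_pmf.prob (path_law p n m) {hs. \<exists>G\<in>set hs. frozen G 1}"
    using history_prob_set[of m "{hs. \<exists>G\<in>set hs. frozen G 1}"] frozen_before_event[of m]
    by (simp only: mem_Collect_eq eq)
  also have "\<dots> = freeze_prob p n m" unfolding freeze_prob_def
  proof (rule measure_pmf.finite_measure_eq_AE)
    show "AE hs in path_law p n m. (hs \<in> {hs. \<exists>G\<in>set hs. frozen G 1}) = (hs \<in> {hs. frozen (hd hs) 1})"
      unfolding AE_measure_pmf_iff mem_Collect_eq
    proof
      fix hs assume "hs \<in> set_pmf (path_law p n m)"
      from path_law_support[OF n this] have "\<forall>v\<in>{1..n}. (\<exists>G\<in>set hs. frozen G v) \<longleftrightarrow> frozen (hd hs) v" by blast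
      then show "(\<exists>G\<in>set hs. frozen G 1) = frozen (hd hs) 1" by (rule bspec) (use n in simp)
    qed
  qed simp_all
  finally show ?thesis .
qed

lemma freezing_time_measurable: "freezing_time F \<in> measurable M (count_space UNIV)"
proof -
  have "(\<lambda>\<omega>. frozen (F m \<omega>) 1) \<in> measurable M (count_space UNIV)" for m
    by (rule measurable_compose[OF F_measurable]) simp
  then show ?thesis unfolding freezing_time_def[abs_def] by (rule measurable_Least)
qed

text \<open>If vertex 1 never freezes, \<open>LEAST\<close> may have any value, possibly a small
  one, so only the lower bound is direct. In the upper bound this case is covered by the probability
  of not being frozen at an arbitrary time l, which is left free to be chosen large.\<close>

lemma freezing_time_cdf:
  assumes "0 \<le> x"
  shows "freeze_prob p n (nat \<lfloor>x * real n\<rfloor>) \<le> cdf (distr M borel (\<lambda>\<omega>. real (freezing_time F \<omega>) / real n)) x"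
    "cdf (distr M borel (\<lambda>\<omega>. real (freezing_time F \<omega>) / real n)) x \<le> freeze_prob p n (nat \<lfloor>x * real n\<rfloor>) + (1 - freeze_prob p n l)"
proof -
  define k where "k = nat \<lfloor>x * real n\<rfloor>"
  have meas: "(\<lambda>\<omega>. real (freezing_time F \<omega>) / real n) \<in> borel_measurable M"
    by (rule measurable_compose[OF freezing_time_measurable]) simp
  have iff: "real j / real n \<le> x \<longleftrightarrow> j \<le> k" for j
  proof -
    have "real j / real n \<le> x \<longleftrightarrow> real j \<le> x * real n" using n by (simp add: pos_divide_le_eq)
    also have "\<dots> \<longleftrightarrow> j \<le> k" using assms by (simp add: k_def le_nat_iff le_floor_iff)
    finally show ?thesis .
  qed
  have cdf: "cdf (distr M borel (\<lambda>\<omega>. real (freezing_time F \<omega>) / real n)) x = \<P>(\<omega> in M. freezing_time F \<omega> \<le> k)"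
    unfolding cdf_def by (subst measure_distr[OF meas]) (auto simp: iff intro!: arg_cong[where f = prob])
  have ev: "{\<omega>\<in>space M. freezing_time F \<omega> \<le> k} \<in> events"
  proof -
    have "{\<omega>\<in>space M. freezing_time F \<omega> \<le> k} = freezing_time F -` {..k} \<inter> space M" by auto
    then show ?thesis using measurable_sets[OF freezing_time_measurable, of "{..k}"] by simp
  qed
  have early: "freezing_time F \<omega> \<le> i" if "frozen (F i \<omega>) 1" for i \<omega>
    unfolding freezing_time_def using that by (rule Least_le)
  have attained: "frozen (F (freezing_time F \<omega>) \<omega>) 1" if "frozen (F i \<omega>) 1" for i \<omega>
    unfolding freezing_time_def using that by (rule LeastI)
  show "freeze_prob p n (nat \<lfloor>x * real n\<rfloor>) \<le> cdf (distr M borel (\<lambda>\<omega>. real (freezing_time F \<omega>) / real n)) x"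
    unfolding k_def[symmetric] cdf frozen_prob_process[symmetric]
    by (rule finite_measure_mono[OF _ ev]) (use early in blast)
  have "\<P>(\<omega> in M. freezing_time F \<omega> \<le> k) \<le> prob ({\<omega>\<in>space M. \<exists>i\<le>k. frozen (F i \<omega>) 1} \<union> {\<omega>\<in>space M. \<not> frozen (F l \<omega>) 1})"
  proof (rule finite_measure_mono)
    show "{\<omega>\<in>space M. freezing_time F \<omega> \<le> k} \<subseteq> {\<omega>\<in>space M. \<exists>i\<le>k. frozen (F i \<omega>) 1} \<union> {\<omega>\<in>space M. \<not> frozen (F l \<omega>) 1}"
      using attained by blast
    show "{\<omega>\<in>space M. \<exists>i\<le>k. frozen (F i \<omega>) 1} \<union> {\<omega>\<in>space M. \<not> frozen (F l \<omega>) 1} \<in> events"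
      by (intro sets.Un frozen_before_event F_event[of "\<lambda>G. \<not> frozen G 1"])
  qed
  also have "\<dots> \<le> \<P>(\<omega> in M. \<exists>i\<le>k. frozen (F i \<omega>) 1) + \<P>(\<omega> in M. \<not> frozen (F l \<omega>) 1)"
    by (rule measure_Un_le[OF frozen_before_event F_event[of "\<lambda>G. \<not> frozen G 1"]])
  also have "\<dots> = freeze_prob p n k + (1 - freeze_prob p n l)"
    unfolding frozen_before_prob prob_neg[OF F_event[of "\<lambda>G. frozen G 1"]] frozen_prob_process ..
  finally show "cdf (distr M borel (\<lambda>\<omega>. real (freezing_time F \<omega>) / real n)) x
      \<le> freeze_prob p n (nat \<lfloor>x * real n\<rfloor>) + (1 - freeze_prob p n l)"
    unfolding k_def[symmetric] cdf .
qed

lemma freezing_time_cdf_neg: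
  assumes "x < 0" shows "cdf (distr M borel (\<lambda>\<omega>. real (freezing_time F \<omega>) / real n)) x = 0"
proof -
  have meas: "(\<lambda>\<omega>. real (freezing_time F \<omega>) / real n) \<in> borel_measurable M"
    by (rule measurable_compose[OF freezing_time_measurable]) simp
  have "\<not> real j / real n \<le> x" for j
    using less_le_trans[OF assms, of "real j / real n"] by (simp only: not_le) simp
  then have "(\<lambda>\<omega>. real (freezing_time F \<omega>) / real n) -` {..x} \<inter> space M = {}"
    by blast
  then show ?thesis unfolding cdf_def by (subst measure_distr[OF meas]) simp_all
qed

end

theorem corollary1p5:
  fixes p :: real
    and M :: "nat \<Rightarrow> 'a measure"
    and F :: "nat \<Rightarrow> nat \<Rightarrow> 'a \<Rightarrow> multigraph"
  assumes "0 < p" and "p \<le> 1"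
    and "\<And>n. n \<ge> 2 \<Longrightarrow> frozen_process p n (M n) (F n)"
  shows "\<exists>\<mu>. real_distribution \<mu> \<and> cdf \<mu> = g_fun p \<and>
    weak_conv_m (\<lambda>n. distr (M n) borel (\<lambda>\<omega>. real (freezing_time (F n) \<omega>) / real n)) \<mu>"
proof -
  note p = assms(1,2)
  have mono: "x \<le> y \<Longrightarrow> g_fun p x \<le> g_fun p y" for x y by (rule monoD[OF g_fun_mono[OF p]])
  have cont: "continuous (at_right a) (g_fun p)" for a
    using g_fun_cont[OF p, of a] by (rule continuous_within_subset) simp
  have bot: "(g_fun p \<longlongrightarrow> 0) at_bot"
    by (rule tendsto_eventually) (auto simp: eventually_at_bot_linorder g_fun_early[OF p] intro!: exI[of _ 0])
  let ?\<mu> = "interval_measure (g_fun p)"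
  let ?X = "\<lambda>n. distr (M n) borel (\<lambda>\<omega>. real (freezing_time (F n) \<omega>) / real n)"
  have cdf: "cdf ?\<mu> = g_fun p" by (rule cdf_interval_measure[OF mono cont bot])
  \<comment> \<open>As g is continuous, convergence is shown at every point. The hypothesis covers n
    \<ge> 2 only, hence the eventual statements below.\<close>
  have "(\<lambda>n. cdf (?X n) x) \<longlonglongrightarrow> g_fun p x" for x
  proof (cases "x < 0")
    case True
    have "\<forall>\<^sub>F n in sequentially. cdf (?X n) x = g_fun p x"
      using eventually_ge_at_top[of 2]
    proof eventually_elim
      fix n :: nat assume n: "2 \<le> n"
      show "cdf (?X n) x = g_fun p x"
        using freezing_time_cdf_neg[OF p n assms(3)[OF n] True] True by (simp add: g_fun_early[OF p])
    qed
    then show ?thesis by (rule tendsto_eventually)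
  next
    case False
    then have x: "0 \<le> x" by simp
    show ?thesis
    proof (rule order_tendstoI)
      fix a assume "a < g_fun p x"
      from order_tendstoD(1)[OF freeze_prob_tendsto[OF p x] this] eventually_ge_at_top[of 2]
      show "\<forall>\<^sub>F n in sequentially. a < cdf (?X n) x"
      proof eventually_elim
        fix n :: nat assume "a < freeze_prob p n (nat \<lfloor>x * real n\<rfloor>)" and n: "2 \<le> n"
        then show "a < cdf (?X n) x"
          using freezing_time_cdf(1)[OF p n assms(3)[OF n] x] by simp
      qed
    next
      fix a assume a: "g_fun p x < a"
      define e where "e = a - g_fun p x"
      have e: "0 < e" using a by (simp add: e_def)
      have "\<forall>\<^sub>F T in at_top. 1 - e / 2 < g_fun p T"
        by (rule order_tendstoD(1)[OF g_fun_at_top[OF p]]) (use e in simp)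
      \<comment> \<open>As g tends to 1, vertex 1 is frozen by time T n with probability above 1 - e
        / 2 for large n. This bounds the probability that it never freezes, and with it the effect
        of an unspecified \<open>LEAST\<close>.\<close>
      then obtain T where T: "0 \<le> T" "1 - e / 2 < g_fun p T"
        using eventually_happens'[OF _ eventually_conj[OF eventually_ge_at_top[of 0]], of "\<lambda>T. 1 - e / 2 < g_fun p T"]
        by auto
      from order_tendstoD(2)[OF freeze_prob_tendsto[OF p x], of "g_fun p x + e / 2"]
        order_tendstoD(1)[OF freeze_prob_tendsto[OF p T(1)] T(2)] eventually_ge_at_top[of 2]
      have "\<forall>\<^sub>F n in sequentially. freeze_prob p n (nat \<lfloor>x * real n\<rfloor>) < g_fun p x + e / 2
        \<and> 1 - e / 2 < freeze_prob p n (nat \<lfloor>T * real n\<rfloor>) \<and> 2 \<le> n"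
        using e by (auto intro!: eventually_conj)
      then show "\<forall>\<^sub>F n in sequentially. cdf (?X n) x < a"
      proof eventually_elim
        fix n :: nat
        assume *: "freeze_prob p n (nat \<lfloor>x * real n\<rfloor>) < g_fun p x + e / 2
          \<and> 1 - e / 2 < freeze_prob p n (nat \<lfloor>T * real n\<rfloor>) \<and> 2 \<le> n"
        then have n: "2 \<le> n" by blast
        have "g_fun p x + e / 2 + e / 2 = a" by (simp add: e_def)
        then show "cdf (?X n) x < a"
          using * freezing_time_cdf(2)[OF p n assms(3)[OF n] x, of "nat \<lfloor>T * real n\<rfloor>"] by linarith
      qed
    qed
  qed
  then have "weak_conv_m ?X ?\<mu>" by (simp add: weak_conv_m_def weak_conv_def cdf)
  moreover have "real_distribution ?\<mu>"
    by (rule real_distribution_interval_measure[OF mono cont bot g_fun_at_top[OF p]])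
  ultimately show ?thesis using cdf by blast
qed

end
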